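(* Let $G$ and $H$ be countable groups, and let $G\curvearrowright (X,\mu)$ and $H\curvearrowright (Y,\nu)$ be free p.m.p. actions which are boundedly orbit equivalent. Let $\mathscr{S}$ be a collection of sofic approximations for $G$. Suppose that $G$ has property $\mathscr{S}$-SC and that the action $H\curvearrowright (Y,\nu)$ is uniquely ergodic. Let $\Pi$ be a sofic approximation sequence for $G$ consisting of elements of $\mathscr{S}$. Then $$h_\nu(H\curvearrowright Y)\ge h_{\Pi,\mu}(G\curvearrowright X),$$ where $h_\nu$ is the maximum sofic measure entropy and $h_{\Pi,\mu}$ is the sofic measure entropy with respect to $\Pi$.
   Context: All groups are countable and discrete. $\mathcal{F}(G)$ is the collection of nonempty finite subsets of $G$, and $\overline{\mathcal{F}}(G)$ the collection of symmetric finite subsets of $G$ containing $e_G$. P.m.p. actions. A p.m.p. action $G\curvearrowright (X,\mu)$ is an action by measure-preserving transformations on a standard probability space (a standard Borel space with a probability measure). It is free if the set of $x\in X$ with $sx\neq x$ for all $s\in G\setminus\{e_G\}$ has measure one. It is uniquely ergodic if there is a unique state (mean, i.e. unital positive linear functional) on $L^\infty(X,\mu)$ invariant under the $G$-action $(gf)(x)=f(g^{-1}x)$. Partitions are Borel. Bounded orbit equivalence. Two free p.m.p. actions $G\curvearrowright (X,\mu)$ and $H\curvearrowright (Y,\nu)$ are orbit equivalent if there are a $G$-invariant conull set $X_0\subseteq X$, an $H$-invariant conull set $Y_0\subseteq Y$, and a measure isomorphism $\Psi:X_0\to Y_0$ with $\Psi(Gx)=H\Psi(x)$ for all $x\in X_0$.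 Associated to $\Psi$ are cocycles $\kappa:G\times X_0\to H$ and $\lambda:H\times Y_0\to G$, determined up to null sets by $\Psi(gx)=\kappa(g,x)\Psi(x)$ and $\Psi^{-1}(ty)=\lambda(t,y)\Psi^{-1}(y)$. The actions are boundedly orbit equivalent if $X_0,Y_0,\Psi$ can be chosen so that $\kappa(g,X_0)$ is finite for every $g\in G$ and $\lambda(t,Y_0)$ is finite for every $t\in H$. Sofic approximations. For a nonempty finite set $V$, $\mathrm{Sym}(V)$ is its permutation group, $\mathbb{P}_V$ is the algebra of all subsets of $V$, $\mathrm{m}$ is the uniform probability measure on $V$, and $\rho_{\mathrm{Hamm}}(T,S)=|\{v\in V:Tv\ne Sv\}|/|V|$ for $T,S\in V^V$. A sofic approximation for $G$ is a (not necessarily multiplicative) map $\sigma:G\to\mathrm{Sym}(V)$ for some nonempty finite set $V$. It is an $(F,\delta)$-approximation ($F\subseteq G$ finite, $\delta>0$) if $\rho_{\mathrm{Hamm}}(\sigma_{st},\sigma_s\sigma_t)\le\delta$ for all $s,t\in F$ and $\rho_{\mathrm{Hamm}}(\sigma_s,\sigma_t)\ge 1-\delta$ for all distinct $s,t\in F$. A sofic approximation sequence for $G$ is a sequence $\Sigma=\{\sigma_k:G\to\mathrm{Sym}(V_k)\}_{k=1}^\infty$ such that for every finite $F\subseteq G$ and $\delta>0$, $\sigma_k$ is an $(F,\delta)$-approximation for all sufficiently large $k$. Sofic measure entropy. Let $G\curvearrowright (X,\mu)$ be a p.m.p. action, $\mathscr{C}$ a finite partition of $X$, $F\subseteq G$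 finite with $e_G\in F$, $\delta>0$, and $\sigma:G\to\mathrm{Sym}(V)$ a sofic approximation. Let $\mathrm{alg}(\cdot)$ denote the (finite) algebra of sets generated by a partition and $\mathscr{C}_F=\bigvee_{s\in F}s\mathscr{C}$. Let $\mathrm{Hom}_\mu(\mathscr{C},F,\delta,\sigma)$ be the set of all (Boolean algebra) homomorphisms $\varphi:\mathrm{alg}(\mathscr{C}_F)\to\mathbb{P}_V$ with $\sum_{A\in\mathscr{C}}\mathrm{m}(\sigma_g\varphi(A)\,\Delta\,\varphi(gA))<\delta$ for all $g\in F$ and $\sum_{A\in\mathscr{C}_F}|\mathrm{m}(\varphi(A))-\mu(A)|<\delta$. For a partition $\mathscr{P}\le\mathscr{C}$ (i.e. $\mathscr{C}$ refines $\mathscr{P}$), $|\mathrm{Hom}_\mu(\mathscr{C},F,\delta,\sigma)|_{\mathscr{P}}$ is the number of distinct restrictions of its elements to $\mathscr{P}$. Then $$h_{\Sigma,\mu}(G\curvearrowright X)=\sup_{\mathscr{P}}\inf_{\mathscr{C}\ge\mathscr{P}}\inf_F\inf_{\delta>0}\limsup_{k\to\infty}\frac{1}{|V_k|}\log|\mathrm{Hom}_\mu(\mathscr{C},F,\delta,\sigma_k)|_{\mathscr{P}},$$ with $\mathscr{P},\mathscr{C}$ ranging over finite partitions, $F$ over finite subsets of $G$ containing $e_G$, and $\log 0=-\infty$. The maximum sofic measure entropy is $h_\mu(G\curvearrowright X)=\max_\Sigma h_{\Sigma,\mu}(G\curvearrowright X)$ over all sofic approximation sequences $\Sigma$ for $G$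 (the maximum exists), and is $-\infty$ by convention if there are none. Property $\mathscr{S}$-SC for a group. $G$ has property $\mathscr{S}$-SC if for any function $\Upsilon:\mathcal{F}(G)\to[0,\infty)$ there is an $S\in\overline{\mathcal{F}}(G)$ such that for any $T\in\overline{\mathcal{F}}(G)$ there are $C,n\in\mathbb{N}$ and $S_1,\dots,S_n\in\overline{\mathcal{F}}(G)$ such that for every good enough sofic approximation $\pi:G\to\mathrm{Sym}(V)$ in $\mathscr{S}$ there are subsets $W$ and $\mathcal{V}_j$ ($1\le j\le n$) of $V$ with: (i) $\sum_{j=1}^n\Upsilon(S_j)\mathrm{m}(\mathcal{V}_j)\le 1$; (ii) $\bigcup_{g\in S}\pi_gW=V$; (iii) if $w_1,w_2\in W$ satisfy $\pi_gw_1=w_2$ for some $g\in T$ then $w_1$ and $w_2$ are connected by a path (a tuple $(v_0,\dots,v_l)$ with $v_0=w_1$, $v_l=w_2$) of length $1\le l\le C$ in which each edge $(v_{i-1},v_i)$ is of the form $(v,\pi_hv)$ for some $1\le j\le n$, $h\in S_j$ and $v\in\mathcal{V}_j$ with $\pi_hv\in\mathcal{V}_j$. Here "for every good enough $\pi$" means: there are a finite $K\subseteq G$ and $\theta>0$ (depending on the previously chosen data) such that the assertion holds for every $\pi$ that is a $(K,\theta)$-approximation. *)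

theory Defs
  imports
    "HOL-Probability.Probability"
    "HOL-Algebra.Group_Action"
begin

section \<open>P.m.p. actions\<close>

definition standard_borel :: "'x measure \<Rightarrow> bool" where
  "standard_borel M \<longleftrightarrow>
     (\<exists>T. completely_metrizable_space T \<and> separable_space T \<and> topspace T = space M \<and>
          sets M = sigma_sets (space M) {U. openin T U})"

definition pmp_action ::
  "('g, 'r) monoid_scheme \<Rightarrow> 'x measure \<Rightarrow> ('g \<Rightarrow> 'x \<Rightarrow> 'x) \<Rightarrow> bool" where
  "pmp_action G M \<alpha> \<longleftrightarrow>
     prob_space M \<and> standard_borel M \<and> group_action G (space M) \<alpha> \<and>
     (\<forall>g\<in>carrier G. \<alpha> g \<in> measurable M M \<and> distr M M (\<alpha> g) = M)"

definition free_action ::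
  "('g, 'r) monoid_scheme \<Rightarrow> 'x measure \<Rightarrow> ('g \<Rightarrow> 'x \<Rightarrow> 'x) \<Rightarrow> bool" where
  "free_action G M \<alpha> \<longleftrightarrow> (AE x in M. \<forall>s\<in>carrier G - {\<one>\<^bsub>G\<^esub>}. \<alpha> s x \<noteq> x)"

text \<open>The space of (complex) \<open>L\<^sup>\<infinity>\<close> functions is given by representatives;
  functionals on it are required to respect almost everywhere equality, and to be extensional
  so that uniqueness of a functional can be expressed by \<open>\<exists>!\<close>.\<close>

definition Linfty :: "'x measure \<Rightarrow> ('x \<Rightarrow> complex) set" where
  "Linfty M = {f \<in> borel_measurable M. \<exists>B. AE x in M. norm (f x) \<le> B}"

definition mean_on_Linfty :: "'x measure \<Rightarrow> (('x \<Rightarrow> complex) \<Rightarrow> complex) \<Rightarrow> bool" where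
  "mean_on_Linfty M \<phi> \<longleftrightarrow>
     \<phi> \<in> extensional (Linfty M) \<and>
     (\<forall>f\<in>Linfty M. \<forall>f'\<in>Linfty M. (AE x in M. f x = f' x) \<longrightarrow> \<phi> f = \<phi> f') \<and>
     (\<forall>f\<in>Linfty M. \<forall>f'\<in>Linfty M. \<phi> (\<lambda>x. f x + f' x) = \<phi> f + \<phi> f') \<and>
     (\<forall>c. \<forall>f\<in>Linfty M. \<phi> (\<lambda>x. c * f x) = c * \<phi> f) \<and>
     (\<forall>f\<in>Linfty M. (AE x in M. f x \<in> \<real>\<^sub>\<ge>\<^sub>0) \<longrightarrow> \<phi> f \<in> \<real>\<^sub>\<ge>\<^sub>0) \<and>
     \<phi> (\<lambda>x. 1) = 1"

definition invariant_mean ::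
  "('g, 'r) monoid_scheme \<Rightarrow> 'x measure \<Rightarrow> ('g \<Rightarrow> 'x \<Rightarrow> 'x) \<Rightarrow> (('x \<Rightarrow> complex) \<Rightarrow> complex) \<Rightarrow> bool"
where
  "invariant_mean G M \<alpha> \<phi> \<longleftrightarrow>
     mean_on_Linfty M \<phi> \<and>
     (\<forall>g\<in>carrier G. \<forall>f\<in>Linfty M. \<phi> (\<lambda>x. f (\<alpha> (inv\<^bsub>G\<^esub> g) x)) = \<phi> f)"

definition uniquely_ergodic ::
  "('g, 'r) monoid_scheme \<Rightarrow> 'x measure \<Rightarrow> ('g \<Rightarrow> 'x \<Rightarrow> 'x) \<Rightarrow> bool" where
  "uniquely_ergodic G M \<alpha> \<longleftrightarrow> (\<exists>!\<phi>. invariant_mean G M \<alpha> \<phi>)"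


section \<open>Bounded orbit equivalence\<close>

definition measure_isomorphism :: "'x measure \<Rightarrow> 'y measure \<Rightarrow> ('x \<Rightarrow> 'y) \<Rightarrow> bool" where
  "measure_isomorphism M N \<Psi> \<longleftrightarrow>
     bij_betw \<Psi> (space M) (space N) \<and> \<Psi> \<in> measurable M N \<and>
     inv_into (space M) \<Psi> \<in> measurable N M \<and> distr M N \<Psi> = N"

definition invariant_conull ::
  "('g, 'r) monoid_scheme \<Rightarrow> 'x measure \<Rightarrow> ('g \<Rightarrow> 'x \<Rightarrow> 'x) \<Rightarrow> 'x set \<Rightarrow> bool" where
  "invariant_conull G M \<alpha> X0 \<longleftrightarrow>
     X0 \<in> sets M \<and> (AE x in M. x \<in> X0) \<and> (\<forall>g\<in>carrier G. \<alpha> g ` X0 \<subseteq> X0)"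

definition orbit_equivalence ::
  "('g, 'r) monoid_scheme \<Rightarrow> 'x measure \<Rightarrow> ('g \<Rightarrow> 'x \<Rightarrow> 'x) \<Rightarrow>
   ('h, 's) monoid_scheme \<Rightarrow> 'y measure \<Rightarrow> ('h \<Rightarrow> 'y \<Rightarrow> 'y) \<Rightarrow>
   'x set \<Rightarrow> 'y set \<Rightarrow> ('x \<Rightarrow> 'y) \<Rightarrow> bool" where
  "orbit_equivalence G M \<alpha> H N \<beta> X0 Y0 \<Psi> \<longleftrightarrow>
     invariant_conull G M \<alpha> X0 \<and> invariant_conull H N \<beta> Y0 \<and>
     measure_isomorphism (restrict_space M X0) (restrict_space N Y0) \<Psi> \<and>
     (\<forall>x\<in>X0. \<Psi> ` orbit G \<alpha> x = orbit H \<beta> (\<Psi> x))"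

text \<open>Where the action \<open>\<beta>\<close> is free, the last condition determines \<open>\<kappa>\<close> and forces
  the cocycle identity.\<close>

definition orbit_cocycle ::
  "('g, 'r) monoid_scheme \<Rightarrow> 'x measure \<Rightarrow> ('g \<Rightarrow> 'x \<Rightarrow> 'x) \<Rightarrow>
   ('h, 's) monoid_scheme \<Rightarrow> ('h \<Rightarrow> 'y \<Rightarrow> 'y) \<Rightarrow>
   'x set \<Rightarrow> ('x \<Rightarrow> 'y) \<Rightarrow> ('g \<Rightarrow> 'x \<Rightarrow> 'h) \<Rightarrow> bool" where
  "orbit_cocycle G M \<alpha> H \<beta> X0 \<Psi> \<kappa> \<longleftrightarrow>
     (\<forall>g\<in>carrier G. \<kappa> g \<in> measurable (restrict_space M X0) (count_space (carrier H)) \<and>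
        (\<forall>x\<in>X0. \<Psi> (\<alpha> g x) = \<beta> (\<kappa> g x) (\<Psi> x)))"

definition boundedly_orbit_equivalent ::
  "('g, 'r) monoid_scheme \<Rightarrow> 'x measure \<Rightarrow> ('g \<Rightarrow> 'x \<Rightarrow> 'x) \<Rightarrow>
   ('h, 's) monoid_scheme \<Rightarrow> 'y measure \<Rightarrow> ('h \<Rightarrow> 'y \<Rightarrow> 'y) \<Rightarrow> bool" where
  "boundedly_orbit_equivalent G M \<alpha> H N \<beta> \<longleftrightarrow>
     (\<exists>X0 Y0 \<Psi> \<kappa> lam.
        orbit_equivalence G M \<alpha> H N \<beta> X0 Y0 \<Psi> \<and>
        orbit_cocycle G M \<alpha> H \<beta> X0 \<Psi> \<kappa> \<and>
        orbit_cocycle H N \<beta> G \<alpha> Y0 (inv_into X0 \<Psi>) lam \<and>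
        (\<forall>g\<in>carrier G. finite (\<kappa> g ` X0)) \<and>
        (\<forall>t\<in>carrier H. finite (lam t ` Y0)))"


section \<open>Sofic approximations\<close>

text \<open>A map from \<open>G\<close> to the permutations of \<open>V\<close> is encoded as the pair of \<open>V\<close> and the map.\<close>

type_synonym ('g, 'v) sofic_map = "'v set \<times> ('g \<Rightarrow> 'v \<Rightarrow> 'v)"

definition sofic_approximation :: "('g, 'r) monoid_scheme \<Rightarrow> ('g, 'v) sofic_map \<Rightarrow> bool" where
  "sofic_approximation G = (\<lambda>(V, \<sigma>).
     finite V \<and> V \<noteq> {} \<and> \<sigma> \<in> carrier G \<rightarrow> {p. p permutes V})"

definition hamming :: "'v set \<Rightarrow> ('v \<Rightarrow> 'v) \<Rightarrow> ('v \<Rightarrow> 'v) \<Rightarrow> real" where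
  "hamming V p q = real (card {v \<in> V. p v \<noteq> q v}) / real (card V)"

definition good_approximation ::
  "('g, 'r) monoid_scheme \<Rightarrow> 'g set \<Rightarrow> real \<Rightarrow> ('g, 'v) sofic_map \<Rightarrow> bool" where
  "good_approximation G F \<delta> = (\<lambda>(V, \<sigma>).
     (\<forall>s\<in>F. \<forall>t\<in>F. hamming V (\<sigma> (s \<otimes>\<^bsub>G\<^esub> t)) (\<sigma> s \<circ> \<sigma> t) \<le> \<delta>) \<and>
     (\<forall>s\<in>F. \<forall>t\<in>F. s \<noteq> t \<longrightarrow> hamming V (\<sigma> s) (\<sigma> t) \<ge> 1 - \<delta>))"

definition sofic_approximation_sequence ::
  "('g, 'r) monoid_scheme \<Rightarrow> (nat \<Rightarrow> ('g, 'v) sofic_map) \<Rightarrow> bool" where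
  "sofic_approximation_sequence G \<Sigma> \<longleftrightarrow>
     (\<forall>k. sofic_approximation G (\<Sigma> k)) \<and>
     (\<forall>F \<delta>. finite F \<and> F \<subseteq> carrier G \<and> 0 < \<delta> \<longrightarrow>
        (\<forall>\<^sub>F k in sequentially. good_approximation G F \<delta> (\<Sigma> k)))"


section \<open>Sofic measure entropy\<close>

definition fin_borel_partition :: "'x measure \<Rightarrow> 'x set set \<Rightarrow> bool" where
  "fin_borel_partition M P \<longleftrightarrow> finite P \<and> P \<subseteq> sets M \<and> partition_on (space M) P"

definition translate_join :: "('g \<Rightarrow> 'x \<Rightarrow> 'x) \<Rightarrow> 'x set set \<Rightarrow> 'g set \<Rightarrow> 'x set set" where
  "translate_join \<alpha> C F = common_refinement ((\<lambda>s. (`) (\<alpha> s) ` C) ` F)"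

definition boolean_homs :: "'x set \<Rightarrow> 'x set set \<Rightarrow> 'v set \<Rightarrow> ('x set \<Rightarrow> 'v set) set" where
  "boolean_homs X \<A> V = {\<phi> \<in> \<A> \<rightarrow>\<^sub>E Pow V.
     \<phi> {} = {} \<and> \<phi> X = V \<and>
     (\<forall>A\<in>\<A>. \<phi> (X - A) = V - \<phi> A) \<and>
     (\<forall>A\<in>\<A>. \<forall>B\<in>\<A>. \<phi> (A \<union> B) = \<phi> A \<union> \<phi> B \<and> \<phi> (A \<inter> B) = \<phi> A \<inter> \<phi> B)}"

definition Hom_mu ::
  "'x measure \<Rightarrow> ('g \<Rightarrow> 'x \<Rightarrow> 'x) \<Rightarrow> 'x set set \<Rightarrow> 'g set \<Rightarrow> real \<Rightarrow> ('g, 'v) sofic_map \<Rightarrow>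
   ('x set \<Rightarrow> 'v set) set" where
  "Hom_mu M \<alpha> C F \<delta> = (\<lambda>(V, \<sigma>).
     {\<phi> \<in> boolean_homs (space M) (algebra (space M) hull translate_join \<alpha> C F) V.
        (\<forall>g\<in>F. (\<Sum>A\<in>C. measure (uniform_count_measure V)
                          (sym_diff (\<sigma> g ` \<phi> A) (\<phi> (\<alpha> g ` A)))) < \<delta>) \<and>
        (\<Sum>A\<in>translate_join \<alpha> C F.
            \<bar>measure (uniform_count_measure V) (\<phi> A) - measure M A\<bar>) < \<delta>})"

text \<open>This is \<open>log n / d\<close> with the convention \<open>log 0 = - \<infinity>\<close>
  (the library has \<open>ln 0 = 0\<close>).\<close>

definition normalized_log :: "nat \<Rightarrow> nat \<Rightarrow> ereal" where
  "normalized_log n d = (if n = 0 then - \<infinity> else ereal (ln (real n) / real d))"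

definition sofic_entropy ::
  "('g, 'r) monoid_scheme \<Rightarrow> 'x measure \<Rightarrow> ('g \<Rightarrow> 'x \<Rightarrow> 'x) \<Rightarrow>
   (nat \<Rightarrow> ('g, 'v) sofic_map) \<Rightarrow> ereal" where
  "sofic_entropy G M \<alpha> \<Sigma> =
     (SUP P\<in>{P. fin_borel_partition M P}.
      INF C\<in>{C. fin_borel_partition M C \<and> refines (space M) C P}.
      INF F\<in>{F. finite F \<and> F \<subseteq> carrier G \<and> \<one>\<^bsub>G\<^esub> \<in> F}.
      INF \<delta>\<in>{0<..}.
        limsup (\<lambda>k. normalized_log
          (card ((\<lambda>\<phi>. restrict \<phi> P) ` Hom_mu M \<alpha> C F \<delta> (\<Sigma> k))) (card (fst (\<Sigma> k)))))"

text \<open>The supremum over all sofic approximation sequences is attained whenever there is one, and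
  is \<open>- \<infinity>\<close> if there is none. Every finite set is in bijection with a set of natural numbers and
  the entropy is invariant under relabelling, so it is enough to use subsets of
  \<^typ>\<open>nat\<close>.\<close>

definition max_sofic_entropy ::
  "('g, 'r) monoid_scheme \<Rightarrow> 'x measure \<Rightarrow> ('g \<Rightarrow> 'x \<Rightarrow> 'x) \<Rightarrow> ereal" where
  "max_sofic_entropy G M \<alpha> =
     (SUP \<Sigma>\<in>{\<Sigma> :: nat \<Rightarrow> ('g, nat) sofic_map. sofic_approximation_sequence G \<Sigma>}.
        sofic_entropy G M \<alpha> \<Sigma>)"


section \<open>Property SC relative to a collection of sofic approximations\<close>

definition fin_sets :: "('g, 'r) monoid_scheme \<Rightarrow> 'g set set" where
  "fin_sets G = {F. F \<subseteq> carrier G \<and> finite F \<and> F \<noteq> {}}"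

definition symm_fin_sets :: "('g, 'r) monoid_scheme \<Rightarrow> 'g set set" where
  "symm_fin_sets G = {F. F \<subseteq> carrier G \<and> finite F \<and> \<one>\<^bsub>G\<^esub> \<in> F \<and> (\<forall>g\<in>F. inv\<^bsub>G\<^esub> g \<in> F)}"

definition SC_edge ::
  "('g \<Rightarrow> 'v \<Rightarrow> 'v) \<Rightarrow> nat \<Rightarrow> (nat \<Rightarrow> 'g set) \<Rightarrow> (nat \<Rightarrow> 'v set) \<Rightarrow> 'v \<Rightarrow> 'v \<Rightarrow> bool" where
  "SC_edge \<pi> n Ss Vs v w \<longleftrightarrow>
     (\<exists>j\<in>{1..n}. \<exists>h\<in>Ss j. v \<in> Vs j \<and> \<pi> h v \<in> Vs j \<and> w = \<pi> h v)"

definition property_SC ::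
  "('g, 'r) monoid_scheme \<Rightarrow> ('g, 'v) sofic_map set \<Rightarrow> bool" where
  "property_SC G \<S> \<longleftrightarrow>
     (\<forall>\<Upsilon> :: 'g set \<Rightarrow> real. (\<forall>F\<in>fin_sets G. 0 \<le> \<Upsilon> F) \<longrightarrow>
       (\<exists>S\<in>symm_fin_sets G. \<forall>T\<in>symm_fin_sets G. \<exists>(C::nat) (n::nat) (Ss :: nat \<Rightarrow> 'g set).
          (\<forall>j\<in>{1..n}. Ss j \<in> symm_fin_sets G) \<and>
          (\<exists>K \<theta>. finite K \<and> K \<subseteq> carrier G \<and> 0 < \<theta> \<and>
            (\<forall>(V, \<pi>)\<in>\<S>. good_approximation G K \<theta> (V, \<pi>) \<longrightarrow>
              (\<exists>W Vs. W \<subseteq> V \<and> (\<forall>j\<in>{1..n}. Vs j \<subseteq> V) \<and>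
                (\<Sum>j=1..n. \<Upsilon> (Ss j) * measure (uniform_count_measure V) (Vs j)) \<le> 1 \<and>
                (\<Union>g\<in>S. \<pi> g ` W) = V \<and>
                (\<forall>w1\<in>W. \<forall>w2\<in>W. (\<exists>g\<in>T. \<pi> g w1 = w2) \<longrightarrow>
                  (\<exists>l p. 1 \<le> l \<and> l \<le> C \<and> p 0 = w1 \<and> p l = w2 \<and>
                     (\<forall>i\<in>{1..l}. SC_edge \<pi> n Ss Vs (p (i - 1)) (p i)))))))))"

end

theory Submission
  imports Defs
begin

text \<open>A homomorphism from a finite algebra of events to the subsets of \<open>V\<close> is the preimage map of some
  \<open>p: V \<rightarrow> X\<close>. Such a model \<open>p\<close> pulls the cocycle of the orbit equivalence back to \<open>V\<close>, so that
  \<open>t v = \<pi>\<^sub>g v\<close>, with \<open>g\<close> the element of \<open>G\<close> that moves \<open>p v\<close> as \<open>t\<close> moves \<open>\<Psi> (p v)\<close>, is a sofic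
  approximation of \<open>H\<close> on \<open>V\<close> which however depends on \<open>p\<close>. Since the cocycles take finitely many values, the
  cocycle data of \<open>p\<close> on the sparse edges of property SC can be fixed at subexponential cost, by
  pigeonhole. Multiplying along paths, two models with the same data have the same \<open>H\<close>-orbit
  structure on \<open>W\<close>; as the translates of \<open>W\<close> by \<open>S\<close> cover \<open>V\<close>, the identity of \<open>W\<close> extends to a
  permutation of \<open>V\<close> that nearly intertwines the two actions of \<open>H\<close>. So all models of one class
  become models for a single sofic approximation of \<open>H\<close>. A transported model, together with the
  cocycle on \<open>S\<close>, determines the original one up to a small Hamming distance.\<close>

section \<open>Finite sets\<close>

lemma permutation_extending:
  assumes "finite V" "D \<subseteq> V" "inj_on f D" "f ` D \<subseteq> V"
  obtains p where "p permutes V" "\<And>x. x \<in> D \<Longrightarrow> p x = f x"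
proof -
  have "card (V - D) = card (V - f ` D)"
    using assms by (simp add: card_Diff_subset card_image finite_subset)
  then obtain h where h: "bij_betw h (V - D) (V - f ` D)"
    using assms(1) finite_same_card_bij by (metis finite_Diff)
  define p where "p x = (if x \<in> D then f x else if x \<in> V then h x else x)" for x
  have "bij_betw p D (f ` D)"
    using assms(3) by (auto simp: p_def bij_betw_def inj_on_def)
  moreover have "bij_betw p (V - D) (V - f ` D)"
    using h by (rule bij_betw_cong[THEN iffD1, rotated]) (auto simp: p_def)
  ultimately have "bij_betw p (D \<union> (V - D)) (f ` D \<union> (V - f ` D))"
    by (rule bij_betw_combine) auto
  then have "bij_betw p V V"
    using assms by (simp add: Un_absorb1 Un_Diff_cancel)
  then have "p permutes V"
    by (rule bij_imp_permutes) (use assms in \<open>auto simp: p_def\<close>)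
  then show thesis by (rule that) (simp add: p_def)
qed

lemma card_image_Union_fibres:
  fixes c :: nat
  assumes "finite (g ` A)" "\<And>a. a \<in> A \<Longrightarrow> card (f ` {b \<in> A. g b = g a}) \<le> c"
    "\<And>a. a \<in> A \<Longrightarrow> finite (f ` {b \<in> A. g b = g a})"
  shows "card (f ` A) \<le> card (g ` A) * c"
proof -
  have "f ` A = (\<Union>y\<in>g ` A. f ` {b \<in> A. g b = y})" by auto
  also have "card \<dots> \<le> (\<Sum>y\<in>g ` A. card (f ` {b \<in> A. g b = y}))"
    using assms(1) by (rule card_UN_le)
  also have "\<dots> \<le> (\<Sum>y\<in>g ` A. c)"
    using assms(2) by (intro sum_mono) auto
  finally show ?thesis by simp
qed

lemma pigeonhole_fibre:
  assumes "finite (g ` A)" "A \<noteq> {}" "finite (f ` A)"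
  obtains a where "a \<in> A" "card (f ` A) \<le> card (g ` A) * card (f ` {b \<in> A. g b = g a})"
proof -
  define S where "S = (\<lambda>y. card (f ` {b \<in> A. g b = y})) ` (g ` A)"
  have fin: "finite S" and ne: "S \<noteq> {}" using assms by (auto simp: S_def)
  have "Max S \<in> S" using fin ne by (rule Max_in)
  then obtain y where "y \<in> g ` A" "Max S = card (f ` {b \<in> A. g b = y})"
    using S_def imageE by meson
  then obtain a where a: "a \<in> A" "Max S = card (f ` {b \<in> A. g b = g a})" by blast
  have "card (f ` A) \<le> card (g ` A) * Max S"
  proof (rule card_image_Union_fibres[OF assms(1)])
    fix b assume "b \<in> A"
    then have "card (f ` {x \<in> A. g x = g b}) \<in> S" unfolding S_def by blast
    then show "card (f ` {x \<in> A. g x = g b}) \<le> Max S"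
      using fin by simp
    show "finite (f ` {x \<in> A. g x = g b})"
      using assms(3) by (rule finite_subset[rotated]) auto
  qed
  with a show thesis using that by simp
qed

lemma sum_PiE_power_mismatches:
  fixes x :: real
  assumes "finite V" "finite P" "\<And>v. v \<in> V \<Longrightarrow> f0 v \<in> P"
  shows "(\<Sum>f\<in>(\<Pi>\<^sub>E v\<in>V. P). x ^ card {v \<in> V. f v \<noteq> f0 v}) = (1 + real (card P - 1) * x) ^ card V"
proof -
  have "(\<Sum>f\<in>(\<Pi>\<^sub>E v\<in>V. P). x ^ card {v \<in> V. f v \<noteq> f0 v})
      = (\<Sum>f\<in>(\<Pi>\<^sub>E v\<in>V. P). \<Prod>v\<in>V. if f v \<noteq> f0 v then x else 1)"
    using assms(1) by (simp add: prod.If_cases Int_def)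
  also have "\<dots> = (\<Prod>v\<in>V. \<Sum>a\<in>P. if a \<noteq> f0 v then x else 1)"
    using assms(1,2) by (rule prod_sum_PiE[symmetric])
  also have "\<dots> = (\<Prod>v\<in>V. 1 + real (card P - 1) * x)"
  proof (intro prod.cong refl)
    fix v assume "v \<in> V"
    then have "(\<Sum>a\<in>P. if a \<noteq> f0 v then x else 1) = 1 + (\<Sum>a\<in>P - {f0 v}. if a \<noteq> f0 v then x else 1)"
      using assms(2,3) by (subst sum.remove[of P "f0 v"]) auto
    also have "(\<Sum>a\<in>P - {f0 v}. if a \<noteq> f0 v then x else 1) = (\<Sum>a\<in>P - {f0 v}. x)"
      by (intro sum.cong) auto
    also have "\<dots> = real (card P - 1) * x"
      using assms \<open>v \<in> V\<close> by (simp add: card_Diff_singleton)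
    finally show "(\<Sum>a\<in>P. if a \<noteq> f0 v then x else 1) = 1 + real (card P - 1) * x" .
  qed
  finally show ?thesis by simp
qed

text \<open>The exponential Chebyshev inequality for the weight \<open>x\<^sup>d\<close>, \<open>d\<close> the Hamming distance.\<close>

lemma card_hamming_ball_le:
  assumes "finite P" "0 < \<epsilon>"
  obtains \<eta> :: real where "0 < \<eta>"
    "\<And>V f0. finite V \<Longrightarrow> (\<And>v. v \<in> V \<Longrightarrow> f0 v \<in> P) \<Longrightarrow>
       real (card {f \<in> (\<Pi>\<^sub>E v\<in>V. P). real (card {v \<in> V. f v \<noteq> f0 v}) \<le> \<eta> * real (card V)})
         \<le> exp (\<epsilon> * real (card V))"
proof -
  define a where "a = real (card P) + 1"
  have a0: "0 < a" by (simp add: a_def)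
  define x where "x = min (1/2) (\<epsilon> / (2 * a))"
  have x: "0 < x" "x < 1" using assms(2) a0 by (auto simp: x_def)
  have "a * x \<le> a * (\<epsilon> / (2 * a))"
    using a0 by (intro mult_left_mono) (auto simp: x_def)
  then have ax: "a * x \<le> \<epsilon> / 2" using a0 by simp
  define \<eta> where "\<eta> = \<epsilon> / (2 * ln (1/x))"
  have lnx: "0 < ln (1/x)" using x by simp
  have \<eta>: "0 < \<eta>" "\<eta> * ln (1/x) = \<epsilon> / 2" using lnx assms(2) by (auto simp: \<eta>_def)
  show thesis
  proof (rule that[OF \<eta>(1)])
    fix V :: "'c set" and f0 :: "'c \<Rightarrow> 'a"
    assume V: "finite V" "\<And>v. v \<in> V \<Longrightarrow> f0 v \<in> P"
    define n where "n = real (card V)"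
    let ?d = "\<lambda>f. card {v \<in> V. f v \<noteq> f0 v}"
    let ?B = "{f \<in> (\<Pi>\<^sub>E v\<in>V. P). real (?d f) \<le> \<eta> * n}"
    have fin: "finite (\<Pi>\<^sub>E v\<in>V. P)" using V(1) assms(1) by (intro finite_PiE) auto
    have "real (card ?B) * exp (- (\<epsilon> / 2) * n) = (\<Sum>f\<in>?B. exp (- (\<epsilon> / 2) * n))" by simp
    also have "\<dots> \<le> (\<Sum>f\<in>?B. x ^ ?d f)"
    proof (rule sum_mono)
      fix f assume f: "f \<in> ?B"
      have "real (?d f) * ln (1/x) \<le> (\<eta> * n) * ln (1/x)"
        using f lnx by (intro mult_right_mono) auto
      also have "\<dots> = \<epsilon> / 2 * n" using \<eta>(2) by (metis mult.commute mult.left_commute)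
      finally have "- (\<epsilon> / 2) * n \<le> real (?d f) * ln x"
        using x by (simp add: ln_div)
      then have "exp (- (\<epsilon> / 2) * n) \<le> exp (real (?d f) * ln x)" by simp
      also have "\<dots> = x ^ ?d f" using x by (simp add: exp_of_nat_mult)
      finally show "exp (- (\<epsilon> / 2) * n) \<le> x ^ ?d f" .
    qed
    also have "\<dots> \<le> (\<Sum>f\<in>(\<Pi>\<^sub>E v\<in>V. P). x ^ ?d f)"
      using fin x by (intro sum_mono2) auto
    also have "\<dots> = (1 + real (card P - 1) * x) ^ card V"
      by (rule sum_PiE_power_mismatches[OF V(1) assms(1) V(2)])
    also have "\<dots> \<le> exp (\<epsilon> / 2) ^ card V"
    proof (rule power_mono)
      have "real (card P - 1) * x \<le> a * x" using x by (intro mult_right_mono) (auto simp: a_def)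
      then have "1 + real (card P - 1) * x \<le> 1 + \<epsilon> / 2" using ax by simp
      also have "\<dots> \<le> exp (\<epsilon> / 2)" by (rule exp_ge_add_one_self)
      finally show "1 + real (card P - 1) * x \<le> exp (\<epsilon> / 2)" .
    qed (use x in auto)
    also have "\<dots> = exp (\<epsilon> / 2 * n)" by (simp add: n_def exp_of_nat_mult[symmetric] mult.commute)
    finally have "real (card ?B) \<le> exp (\<epsilon> / 2 * n) / exp (- (\<epsilon> / 2) * n)"
      by (simp only: pos_le_divide_eq exp_gt_zero)
    also have "\<dots> = exp (\<epsilon> * n)" by (simp flip: exp_diff)
    finally show "real (card {f \<in> (\<Pi>\<^sub>E v\<in>V. P). real (card {v \<in> V. f v \<noteq> f0 v}) \<le> \<eta> * real (card V)})
         \<le> exp (\<epsilon> * real (card V))" by (simp add: n_def)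
  qed
qed

lemma card_UN_le_bound:
  fixes c :: real
  assumes "finite I" "\<And>i. i \<in> I \<Longrightarrow> real (card (B i)) \<le> c"
  shows "real (card (\<Union>i\<in>I. B i)) \<le> real (card I) * c"
proof -
  have "real (card (\<Union>i\<in>I. B i)) \<le> real (\<Sum>i\<in>I. card (B i))"
    using card_UN_le[OF assms(1)] of_nat_mono by blast
  also have "\<dots> = (\<Sum>i\<in>I. real (card (B i)))" by simp
  also have "\<dots> \<le> (\<Sum>i\<in>I. c)" by (intro sum_mono assms)
  finally show ?thesis by simp
qed

lemma card_permutes_preimage:
  assumes "p permutes V"
  shows "card {v \<in> V. p v \<in> B} = card (V \<inter> B)"
proof -
  have "bij_betw p {v \<in> V. p v \<in> B} (V \<inter> B)"
    unfolding bij_betw_def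
  proof
    show "inj_on p {v \<in> V. p v \<in> B}"
      using permutes_inj_on[OF assms] by (rule inj_on_subset) auto
    show "p ` {v \<in> V. p v \<in> B} = V \<inter> B"
      using permutes_image[OF assms] permutes_in_image[OF assms] by (fastforce simp: image_iff)
  qed
  then show ?thesis by (rule bij_betw_same_card)
qed

section \<open>Cocycles along a sofic approximation\<close>

text \<open>For a map \<open>p\<close> from \<open>V\<close> to a space with a cocycle \<open>\<kappa>\<close>, the function \<open>k v g\<close> stands for
  \<open>\<kappa> g (p v)\<close>, and \<open>l v t\<close> for the group element with \<open>k v (l v t) = t\<close>.\<close>

locale vertex_cocycle = G: group G + H: group H
  for G :: "('g, 'r) monoid_scheme" and H :: "('h, 's) monoid_scheme" +
  fixes V :: "'v set" and \<pi> :: "'g \<Rightarrow> 'v \<Rightarrow> 'v" and F :: "'g set" and R :: "'h set"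
    and k :: "'v \<Rightarrow> 'g \<Rightarrow> 'h" and l :: "'v \<Rightarrow> 'h \<Rightarrow> 'g"
  assumes perm: "g \<in> carrier G \<Longrightarrow> \<pi> g permutes V"
    and F_carrier: "F \<subseteq> carrier G" and F_one: "\<one>\<^bsub>G\<^esub> \<in> F" and F_inv: "g \<in> F \<Longrightarrow> inv\<^bsub>G\<^esub> g \<in> F"
begin

definition base :: "'v \<Rightarrow> bool" where
  "base v \<longleftrightarrow> v \<in> V \<and> k v \<in> carrier G \<rightarrow> carrier H \<and> inj_on (k v) (carrier G) \<and>
     k v \<one>\<^bsub>G\<^esub> = \<one>\<^bsub>H\<^esub> \<and> (\<forall>t\<in>carrier H. l v t \<in> carrier G \<and> k v (l v t) = t) \<and> (\<forall>t\<in>R. l v t \<in> F)"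

definition coherent :: "'v \<Rightarrow> bool" where
  "coherent v \<longleftrightarrow> base v \<and> (\<forall>g\<in>F. base (\<pi> g v) \<and> (\<forall>g'\<in>F.
     k (\<pi> g v) g' \<otimes>\<^bsub>H\<^esub> k v g = k v (g' \<otimes>\<^bsub>G\<^esub> g) \<and> \<pi> (g' \<otimes>\<^bsub>G\<^esub> g) v = \<pi> g' (\<pi> g v) \<and>
     (g \<noteq> g' \<longrightarrow> \<pi> g v \<noteq> \<pi> g' v)))"

definition act :: "'v \<Rightarrow> 'h \<Rightarrow> 'v" where
  "act v t = \<pi> (l v t) v"

lemma F_closed [simp]: "g \<in> F \<Longrightarrow> g \<in> carrier G"
  using F_carrier by auto

lemma perm_inj: "g \<in> carrier G \<Longrightarrow> \<pi> g v = \<pi> g w \<longleftrightarrow> v = w"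
  using permutes_inj[OF perm] by (auto dest: injD)

lemma base_coherent: "coherent v \<Longrightarrow> base v"
  by (simp add: coherent_def)

lemma base_V: "base v \<Longrightarrow> v \<in> V"
  by (simp add: base_def)

lemma base_translate: "coherent v \<Longrightarrow> g \<in> F \<Longrightarrow> base (\<pi> g v)"
  by (simp add: coherent_def)

lemma base_k_closed: "base v \<Longrightarrow> g \<in> carrier G \<Longrightarrow> k v g \<in> carrier H"
  by (auto simp: base_def)

lemma base_k_inj: "base v \<Longrightarrow> g \<in> carrier G \<Longrightarrow> g' \<in> carrier G \<Longrightarrow> k v g = k v g' \<Longrightarrow> g = g'"
  by (auto simp: base_def inj_on_def)

lemma base_k_one: "base v \<Longrightarrow> k v \<one>\<^bsub>G\<^esub> = \<one>\<^bsub>H\<^esub>"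
  by (simp add: base_def)

lemma base_l: "base v \<Longrightarrow> t \<in> carrier H \<Longrightarrow> l v t \<in> carrier G"
  by (auto simp: base_def)

lemma base_k_l: "base v \<Longrightarrow> t \<in> carrier H \<Longrightarrow> k v (l v t) = t"
  by (auto simp: base_def)

lemma base_l_F: "base v \<Longrightarrow> t \<in> R \<Longrightarrow> l v t \<in> F"
  by (auto simp: base_def)

lemma base_l_eq: "base v \<Longrightarrow> g \<in> carrier G \<Longrightarrow> l v (k v g) = g"
  using base_k_inj base_l base_k_l base_k_closed by metis

lemma coherent_k_mult:
  "coherent v \<Longrightarrow> g \<in> F \<Longrightarrow> g' \<in> F \<Longrightarrow> k (\<pi> g v) g' \<otimes>\<^bsub>H\<^esub> k v g = k v (g' \<otimes>\<^bsub>G\<^esub> g)"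
  by (simp add: coherent_def)

lemma coherent_mult:
  "coherent v \<Longrightarrow> g \<in> F \<Longrightarrow> g' \<in> F \<Longrightarrow> \<pi> g' (\<pi> g v) = \<pi> (g' \<otimes>\<^bsub>G\<^esub> g) v"
  by (simp add: coherent_def)

lemma coherent_distinct:
  "coherent v \<Longrightarrow> g \<in> F \<Longrightarrow> g' \<in> F \<Longrightarrow> \<pi> g v = \<pi> g' v \<Longrightarrow> g = g'"
  by (auto simp: coherent_def)

lemma coherent_one: "coherent v \<Longrightarrow> \<pi> \<one>\<^bsub>G\<^esub> v = v"
  using coherent_mult[OF _ F_one F_one] perm_inj[OF G.one_closed] by simp

lemma coherent_inv: "coherent v \<Longrightarrow> g \<in> F \<Longrightarrow> \<pi> (inv\<^bsub>G\<^esub> g) (\<pi> g v) = v"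
  by (simp add: coherent_mult F_inv coherent_one)

lemma coherent_k_inv:
  assumes "coherent v" "g \<in> F"
  shows "k (\<pi> g v) (inv\<^bsub>G\<^esub> g) = inv\<^bsub>H\<^esub> (k v g)"
proof -
  have "k (\<pi> g v) (inv\<^bsub>G\<^esub> g) \<otimes>\<^bsub>H\<^esub> k v g = \<one>\<^bsub>H\<^esub>"
    using assms by (simp add: coherent_k_mult F_inv base_k_one[OF base_coherent])
  then show ?thesis
    using assms base_k_closed[OF base_coherent] base_k_closed[OF base_translate]
    by (intro H.inv_equality[symmetric]) (auto simp: F_inv)
qed

lemma coherent_perm_cancel:
  assumes "coherent (\<pi> g w)" "g \<in> F" "w \<in> V"
  shows "\<pi> (inv\<^bsub>G\<^esub> g) (\<pi> g w) = w"
proof -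
  have "\<pi> g (\<pi> (inv\<^bsub>G\<^esub> g) (\<pi> g w)) = \<pi> g w"
    using coherent_mult[OF assms(1) F_inv[OF assms(2)] assms(2)] assms coherent_one by simp
  then show ?thesis using perm_inj assms(2) by simp
qed

lemma act_mult:
  assumes "coherent v" "t \<in> carrier H" "t \<in> R" "s \<in> carrier H" "s \<in> R"
  shows "act (act v t) s = act v (s \<otimes>\<^bsub>H\<^esub> t)"
proof -
  let ?a = "l v t" and ?b = "l (act v t) s"
  have b: "base v" using assms(1) by (rule base_coherent)
  have a: "?a \<in> F" using b assms by (simp add: base_l_F)
  have b': "base (act v t)" unfolding act_def using assms(1) a by (rule base_translate)
  have bF: "?b \<in> F" using b' assms by (simp add: base_l_F)
  have "k v (?b \<otimes>\<^bsub>G\<^esub> ?a) = s \<otimes>\<^bsub>H\<^esub> t"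
    using coherent_k_mult[OF assms(1) a bF] base_k_l[OF b'] base_k_l[OF b] assms
    by (simp add: act_def)
  then have "?b \<otimes>\<^bsub>G\<^esub> ?a = l v (s \<otimes>\<^bsub>H\<^esub> t)"
    using base_l_eq[OF b] a bF by (metis F_closed G.m_closed)
  then show ?thesis
    using coherent_mult[OF assms(1) a bF] by (simp add: act_def)
qed

lemma act_distinct:
  assumes "coherent v" "t \<in> carrier H" "t \<in> R" "s \<in> carrier H" "s \<in> R" "act v t = act v s"
  shows "t = s"
proof -
  have b: "base v" using assms(1) by (rule base_coherent)
  then have "l v t = l v s"
    using coherent_distinct[OF assms(1)] assms base_l_F by (simp add: act_def)
  then show ?thesis using base_k_l[OF b] assms by metis
qed

lemma act_inj:
  assumes "coherent v" "coherent w" "t \<in> carrier H" "t \<in> R" "act v t = act w t"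
  shows "v = w"
proof -
  have b: "base v" "base w" using assms by (auto simp: base_coherent)
  have F: "l v t \<in> F" "l w t \<in> F" using b assms by (auto simp: base_l_F)
  have "k (act v t) (inv\<^bsub>G\<^esub> l v t) = k (act v t) (inv\<^bsub>G\<^esub> l w t)"
    using coherent_k_inv[OF assms(1) F(1)] coherent_k_inv[OF assms(2) F(2)] assms b
    by (simp add: act_def base_k_l)
  moreover have "base (act v t)"
    unfolding act_def using assms(1) F(1) by (rule base_translate)
  ultimately have "inv\<^bsub>G\<^esub> l v t = inv\<^bsub>G\<^esub> l w t"
    using base_k_inj F by (metis F_closed G.inv_closed)
  then have "l v t = l w t" using F by (metis F_closed G.inv_inv)
  then show ?thesis using assms(5) perm_inj F(1) by (simp add: act_def)
qed

end

locale vertex_cocycle_pair =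
  K0: vertex_cocycle G H V \<pi> F R k0 l0 + K: vertex_cocycle G H V \<pi> F R k l
  for G :: "('g, 'r) monoid_scheme" and H :: "('h, 's) monoid_scheme"
    and V :: "'v set" and \<pi> F R k0 l0 k l +
  fixes W :: "'v set" and \<gamma> :: "'v \<Rightarrow> 'g" and \<omega> :: "'v \<Rightarrow> 'v"
    and S T \<Lambda> :: "'g set" and L :: "'h set"
  assumes W_V: "W \<subseteq> V" and S_F: "S \<subseteq> F" and T_F: "T \<subseteq> F" and \<Lambda>_F: "\<Lambda> \<subseteq> F"
    and L_R: "L \<subseteq> R" and R_carrier: "R \<subseteq> carrier H"
    and cover: "v \<in> V \<Longrightarrow> \<gamma> v \<in> S \<and> \<omega> v \<in> W \<and> \<pi> (\<gamma> v) (\<omega> v) = v"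
    and k_L: "K.base v \<Longrightarrow> g \<in> S \<Longrightarrow> k v g \<in> L"
    and l0_\<Lambda>: "K0.base v \<Longrightarrow> t \<in> R \<Longrightarrow> l0 v t \<in> \<Lambda>"
    and l_\<Lambda>: "K.base v \<Longrightarrow> t \<in> R \<Longrightarrow> l v t \<in> \<Lambda>"
    and T_quotient: "a \<in> \<Lambda> \<Longrightarrow> a' \<in> \<Lambda> \<Longrightarrow> inv\<^bsub>G\<^esub> a' \<otimes>\<^bsub>G\<^esub> a \<in> T"
    and T_conj: "g \<in> S \<Longrightarrow> g' \<in> S \<Longrightarrow> c \<in> \<Lambda> \<Longrightarrow> inv\<^bsub>G\<^esub> g' \<otimes>\<^bsub>G\<^esub> (c \<otimes>\<^bsub>G\<^esub> g) \<in> T"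
    and \<Lambda>_S: "g \<in> S \<Longrightarrow> c \<in> \<Lambda> \<Longrightarrow> c \<otimes>\<^bsub>G\<^esub> g \<in> F"
    and agree: "w \<in> W \<Longrightarrow> g \<in> T \<Longrightarrow> \<pi> g w \<in> W \<Longrightarrow> K0.coherent w \<Longrightarrow> K.coherent w \<Longrightarrow> k0 w g = k w g"
begin

definition coherents :: "'v set" where
  "coherents = {v \<in> V. K0.coherent v \<and> K.coherent v}"

definition core :: "'v set" where
  "core = {v \<in> coherents. \<forall>g\<in>F. \<pi> g v \<in> coherents}"

definition \<theta> :: "'v \<Rightarrow> 'v" where
  "\<theta> v = K0.act (\<omega> v) (k (\<omega> v) (\<gamma> v))"

lemma core_coherents: "core \<subseteq> coherents"
  by (auto simp: core_def)

lemma coherentsD: "v \<in> coherents \<Longrightarrow> K0.coherent v" "v \<in> coherents \<Longrightarrow> K.coherent v"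
  "v \<in> coherents \<Longrightarrow> v \<in> V"
  by (auto simp: coherents_def)

lemma core_translate: "v \<in> core \<Longrightarrow> g \<in> F \<Longrightarrow> \<pi> g v \<in> coherents"
  by (auto simp: core_def)

lemma \<omega>_coherent: assumes "v \<in> core" shows "\<omega> v \<in> coherents" "\<omega> v = \<pi> (inv\<^bsub>G\<^esub> \<gamma> v) v"
proof -
  have v: "v \<in> coherents" "v \<in> V" using assms by (auto simp: core_def coherents_def)
  have c: "\<gamma> v \<in> F" "\<omega> v \<in> V" "\<pi> (\<gamma> v) (\<omega> v) = v" using cover[OF v(2)] S_F W_V by auto
  show "\<omega> v = \<pi> (inv\<^bsub>G\<^esub> \<gamma> v) v"
    using K0.coherent_perm_cancel[of "\<gamma> v" "\<omega> v"] c coherentsD(1)[OF v(1)] by simp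
  then show "\<omega> v \<in> coherents"
    using core_translate[OF assms] c K0.F_inv by metis
qed

lemma recover:
  assumes v: "v \<in> core" and w: "w \<in> W" "w \<in> coherents" and t: "t \<in> L"
    and eq: "K0.act w t = \<theta> v"
  shows "v = \<pi> (l w t) w" "k v (inv\<^bsub>G\<^esub> l w t) = inv\<^bsub>H\<^esub> t"
proof -
  define w2 where "w2 = \<omega> v"
  define g where "g = \<gamma> v"
  define t2 where "t2 = k w2 g"
  have vV: "v \<in> V" using v by (auto simp: core_def coherents_def)
  have w2: "w2 \<in> coherents" "w2 \<in> W" "\<pi> g w2 = v" "g \<in> S"
    using \<omega>_coherent[OF v] cover[OF vV] by (auto simp: w2_def g_def)
  note cw = coherentsD[OF w(2)] and cw2 = coherentsD[OF w2(1)]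
  note bw = K0.base_coherent[OF cw(1)] K.base_coherent[OF cw(2)]
  note bw2 = K0.base_coherent[OF cw2(1)] K.base_coherent[OF cw2(2)]
  have g: "g \<in> F" using w2 S_F by auto
  have t2: "t2 \<in> L" "t2 \<in> R" "t2 \<in> carrier H"
    using k_L[OF bw2(2) w2(4)] L_R R_carrier by (auto simp: t2_def)
  have tR: "t \<in> R" "t \<in> carrier H" using t L_R R_carrier by auto
  define a where "a = l0 w2 t2"
  define a' where "a' = l0 w t"
  define b where "b = inv\<^bsub>G\<^esub> a' \<otimes>\<^bsub>G\<^esub> a"
  have \<Lambda>: "a \<in> \<Lambda>" "a' \<in> \<Lambda>"
    using l0_\<Lambda> bw bw2 t2 tR by (auto simp: a_def a'_def)
  then have F: "a \<in> F" "a' \<in> F" using \<Lambda>_F by auto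
  have bT: "b \<in> T" using T_quotient \<Lambda> by (simp add: b_def)
  then have bF: "b \<in> F" using T_F by auto
  have "\<pi> a w2 = \<pi> a' w"
    using eq by (simp add: \<theta>_def K0.act_def a_def a'_def w2_def t2_def g_def)
  then have "\<pi> (inv\<^bsub>G\<^esub> a') (\<pi> a w2) = w"
    using K0.coherent_inv[OF cw(1) F(2)] by simp
  then have bw: "\<pi> b w2 = w"
    using K0.coherent_mult[OF cw2(1) F(1) K0.F_inv[OF F(2)]] by (simp add: b_def)
  have ag: "k0 w2 b = k w2 b" using agree[OF w2(2) bT _ cw2(1,2)] bw w by simp
  have "k0 w a' \<otimes>\<^bsub>H\<^esub> k0 w2 b = k0 w2 (a' \<otimes>\<^bsub>G\<^esub> b)"
    using K0.coherent_k_mult[OF cw2(1) bF F(2)] bw by simp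
  also have "a' \<otimes>\<^bsub>G\<^esub> b = a"
    using F unfolding b_def by (metis K0.F_closed K0.G.inv_closed K0.G.inv_solve_left' K0.G.m_closed)
  finally have tb: "t \<otimes>\<^bsub>H\<^esub> k w2 b = t2"
    using K0.base_k_l[OF \<open>K0.base w\<close>] K0.base_k_l[OF bw2(1)] tR t2 ag by (simp add: a_def a'_def)
  define g' where "g' = l w t"
  have g': "g' \<in> \<Lambda>" "g' \<in> F" using l_\<Lambda>[OF \<open>K.base w\<close> tR(1)] \<Lambda>_F by (auto simp: g'_def)
  have kg': "k w g' = t" using K.base_k_l[OF \<open>K.base w\<close> tR(2)] by (simp add: g'_def)
  have "k w2 (g' \<otimes>\<^bsub>G\<^esub> b) = k w2 g"
    using K.coherent_k_mult[OF cw2(2) bF g'(2)] bw tb kg' by (simp add: t2_def)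
  then have "g' \<otimes>\<^bsub>G\<^esub> b = g"
    using K.base_k_inj[OF bw2(2)] g' bF g by simp
  then have "v = \<pi> g' w"
    using K.coherent_mult[OF cw2(2) bF g'(2)] bw w2 by simp
  then show v_eq: "v = \<pi> (l w t) w" by (simp add: g'_def)
  show "k v (inv\<^bsub>G\<^esub> l w t) = inv\<^bsub>H\<^esub> t"
    using K.coherent_k_inv[OF cw(2) g'(2)] kg' v_eq by (simp add: g'_def)
qed

lemma \<theta>_inj: "inj_on \<theta> core"
proof
  fix v v' assume v: "v \<in> core" "v' \<in> core" and eq: "\<theta> v = \<theta> v'"
  have v'V: "v' \<in> V" using v by (auto simp: core_def coherents_def)
  let ?w = "\<omega> v'" and ?t = "k (\<omega> v') (\<gamma> v')"
  have w: "?w \<in> W" "?w \<in> coherents" "\<gamma> v' \<in> S" "\<pi> (\<gamma> v') ?w = v'"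
    using \<omega>_coherent[OF v(2)] cover[OF v'V] by auto
  have b: "K.base ?w" using w by (simp add: coherentsD K.base_coherent)
  have "v = \<pi> (l ?w ?t) ?w"
    using recover(1)[OF v(1) w(1,2)] k_L[OF b] w eq by (simp add: \<theta>_def)
  also have "l ?w ?t = \<gamma> v'" using K.base_l_eq[OF b] w(3) S_F by (auto)
  finally show "v = v'" using w by simp
qed

lemma \<theta>_V: "v \<in> core \<Longrightarrow> \<theta> v \<in> V"
proof -
  assume v: "v \<in> core"
  then have vV: "v \<in> V" by (auto simp: core_def coherents_def)
  have w: "\<omega> v \<in> coherents" "\<gamma> v \<in> S" using \<omega>_coherent[OF v] cover[OF vV] by auto
  have "l0 (\<omega> v) (k (\<omega> v) (\<gamma> v)) \<in> F"
    using w k_L L_R by (meson K.base_coherent K0.base_coherent K0.base_l_F coherentsD subsetD)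
  then show ?thesis
    using K0.base_translate[OF coherentsD(1)[OF w(1)]] by (auto simp: \<theta>_def K0.act_def K0.base_V)
qed

lemma \<theta>_equivariant:
  assumes v: "v \<in> core" and s: "s \<in> R" and v1: "K.act v s \<in> core"
  shows "\<theta> (K.act v s) = K0.act (\<theta> v) s"
proof -
  have in_V: "v \<in> V" "K.act v s \<in> V" using v v1 by (auto simp: core_def coherents_def)
  define w g where "w = \<omega> v" and "g = \<gamma> v"
  define v1 where "v1 = K.act v s"
  define w1 g1 where "w1 = \<omega> v1" and "g1 = \<gamma> v1"
  define t t1 where "t = k w g" and "t1 = k w1 g1"
  define c where "c = l v s"
  have w: "w \<in> coherents" "w \<in> W" "\<pi> g w = v" "g \<in> S"
    using \<omega>_coherent[OF v] cover[OF in_V(1)] by (auto simp: w_def g_def)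
  have w1: "w1 \<in> coherents" "w1 \<in> W" "\<pi> g1 w1 = v1" "g1 \<in> S" "w1 = \<pi> (inv\<^bsub>G\<^esub> g1) v1"
    using \<omega>_coherent[OF \<open>K.act v s \<in> core\<close>] cover[OF in_V(2)] by (auto simp: w1_def g1_def v1_def)
  have vc: "v \<in> coherents" using v by (auto simp: core_def)
  note cv = coherentsD[OF vc] and cw = coherentsD[OF w(1)] and cw1 = coherentsD[OF w1(1)]
  note bv = K.base_coherent[OF cv(2)]
  note bw = K0.base_coherent[OF cw(1)] K.base_coherent[OF cw(2)]
  note bw1 = K0.base_coherent[OF cw1(1)] K.base_coherent[OF cw1(2)]
  have gF: "g \<in> F" "g1 \<in> F" using w w1 S_F by auto
  have sH: "s \<in> carrier H" using s R_carrier by auto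
  have c: "c \<in> \<Lambda>" "c \<in> F" "k v c = s"
    using l_\<Lambda>[OF bv s] \<Lambda>_F K.base_k_l[OF bv sH] by (auto simp: c_def)
  have t: "t \<in> L" "t \<in> R" "t \<in> carrier H" "t1 \<in> L" "t1 \<in> R" "t1 \<in> carrier H"
    using k_L[OF bw(2) w(4)] k_L[OF bw1(2) w1(4)] L_R R_carrier by (auto simp: t_def t1_def)
  have cgF: "c \<otimes>\<^bsub>G\<^esub> g \<in> F" using \<Lambda>_S w(4) c(1) by simp
  define b where "b = inv\<^bsub>G\<^esub> g1 \<otimes>\<^bsub>G\<^esub> (c \<otimes>\<^bsub>G\<^esub> g)"
  have bT: "b \<in> T" using T_conj[OF w(4) w1(4) c(1)] by (simp add: b_def)
  then have bF: "b \<in> F" using T_F by auto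
  have v1_eq: "v1 = \<pi> (c \<otimes>\<^bsub>G\<^esub> g) w"
    using K.coherent_mult[OF cw(2) gF(1) c(2)] w(3) by (simp add: v1_def K.act_def c_def)
  have pb: "\<pi> b w = w1"
    using K.coherent_mult[OF cw(2) cgF K.F_inv[OF gF(2)]] v1_eq w1(5) by (simp add: b_def)
  have ag: "k0 w b = k w b" using agree[OF w(2) bT _ cw(1,2)] pb w1 by simp
  have g1b: "g1 \<otimes>\<^bsub>G\<^esub> b = c \<otimes>\<^bsub>G\<^esub> g"
    using gF cgF unfolding b_def by (metis K0.F_closed K0.G.inv_closed K0.G.inv_solve_left' K0.G.m_closed)
  have "k w (c \<otimes>\<^bsub>G\<^esub> g) = s \<otimes>\<^bsub>H\<^esub> t"
    using K.coherent_k_mult[OF cw(2) gF(1) c(2)] w(3) c(3) by (simp add: t_def)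
  moreover have "k w (g1 \<otimes>\<^bsub>G\<^esub> b) = t1 \<otimes>\<^bsub>H\<^esub> k w b"
    using K.coherent_k_mult[OF cw(2) bF gF(2)] pb by (simp add: t1_def)
  ultimately have st: "t1 \<otimes>\<^bsub>H\<^esub> k w b = s \<otimes>\<^bsub>H\<^esub> t" using g1b by simp
  define a a1 where "a = l0 w t" and "a1 = l0 w1 t1"
  have a: "a \<in> F" "k0 w a = t" "a1 \<in> F" "k0 w1 a1 = t1"
    using K0.base_l_F[OF bw(1)] K0.base_l_F[OF bw1(1)] K0.base_k_l[OF bw(1)] K0.base_k_l[OF bw1(1)] t
    by (auto simp: a_def a1_def)
  have \<theta>v: "\<theta> v = \<pi> a w" "\<theta> v1 = \<pi> a1 w1"
    by (simp_all add: \<theta>_def K0.act_def a_def a1_def w_def w1_def t_def t1_def g_def g1_def)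
  have bu: "K0.base (\<pi> a w)" by (rule K0.base_translate[OF cw(1) a(1)])
  define c' where "c' = l0 (\<pi> a w) s"
  have c': "c' \<in> F" "k0 (\<pi> a w) c' = s"
    using K0.base_l_F[OF bu s] K0.base_k_l[OF bu sH] by (auto simp: c'_def)
  have "k0 w (c' \<otimes>\<^bsub>G\<^esub> a) = s \<otimes>\<^bsub>H\<^esub> t"
    using K0.coherent_k_mult[OF cw(1) a(1) c'(1)] c'(2) a(2) by simp
  also have "\<dots> = k0 w (a1 \<otimes>\<^bsub>G\<^esub> b)"
    using K0.coherent_k_mult[OF cw(1) bF a(3)] pb a(4) ag st by simp
  finally have "c' \<otimes>\<^bsub>G\<^esub> a = a1 \<otimes>\<^bsub>G\<^esub> b"
    using K0.base_k_inj[OF bw(1)] a c' bF by simp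
  then have "\<pi> c' (\<pi> a w) = \<pi> a1 (\<pi> b w)"
    using K0.coherent_mult[OF cw(1)] a c' bF by simp
  then show ?thesis
    using \<theta>v pb by (simp add: v1_def[symmetric] K0.act_def c'_def)
qed

end

lemma (in vertex_cocycle) path_word:
  fixes B :: "nat \<Rightarrow> 'g set"
  assumes B: "B 0 = {\<one>\<^bsub>G\<^esub>}" "\<And>i. B (Suc i) = (\<Union>j\<in>{1..n}. \<Union>h\<in>Ss j. (\<otimes>\<^bsub>G\<^esub>) h ` B i)"
    and SsF: "\<And>j. j \<in> {1..n} \<Longrightarrow> Ss j \<subseteq> F"
    and BF: "\<And>i. i \<le> m \<Longrightarrow> B i \<subseteq> F"
    and edges: "\<And>i. i \<in> {1..m} \<Longrightarrow> SC_edge \<pi> n Ss Vs (p (i - 1)) (p i)"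
    and k': "vertex_cocycle.coherent G H V \<pi> F R k' l' (p 0)" "vertex_cocycle G H V \<pi> F"
    and data: "\<And>j h v. j \<in> {1..n} \<Longrightarrow> h \<in> Ss j \<Longrightarrow> v \<in> Vs j \<Longrightarrow> k v h = k' v h"
    and coh: "coherent (p 0)" and "i \<le> m"
  shows "\<exists>g\<in>B i. p i = \<pi> g (p 0) \<and> k (p 0) g = k' (p 0) g"
  using \<open>i \<le> m\<close>
proof (induction i)
  interpret K': vertex_cocycle G H V \<pi> F R k' l' by fact
  case 0
  show ?case
    using B(1) coherent_one[OF coh] base_k_one[OF base_coherent[OF coh]]
      K'.base_k_one[OF K'.base_coherent[OF k'(1)]] by simp
next
  interpret K': vertex_cocycle G H V \<pi> F R k' l' by fact
  case (Suc i)
  then obtain g where g: "g \<in> B i" "p i = \<pi> g (p 0)" "k (p 0) g = k' (p 0) g" by auto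
  have "SC_edge \<pi> n Ss Vs (p i) (p (Suc i))" using edges[of "Suc i"] Suc by simp
  then obtain j h where h: "j \<in> {1..n}" "h \<in> Ss j" "p i \<in> Vs j" "p (Suc i) = \<pi> h (p i)"
    by (auto simp: SC_edge_def)
  have F: "g \<in> F" "h \<in> F" using g h SsF BF[of i] Suc by auto
  have "h \<otimes>\<^bsub>G\<^esub> g \<in> B (Suc i)" unfolding B(2) using h(1,2) g(1) by blast
  moreover have "p (Suc i) = \<pi> (h \<otimes>\<^bsub>G\<^esub> g) (p 0)"
    using coherent_mult[OF coh F] h g by simp
  moreover have "k (p 0) (h \<otimes>\<^bsub>G\<^esub> g) = k' (p 0) (h \<otimes>\<^bsub>G\<^esub> g)"
    using coherent_k_mult[OF coh F] K'.coherent_k_mult[OF k'(1) F] data[OF h(1,2,3)] g by simp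
  ultimately show ?case by blast
qed

section \<open>Approximate models and homomorphisms\<close>

locale pmp =
  fixes G :: "('g, 'r) monoid_scheme" and M :: "'x measure" and \<alpha> :: "'g \<Rightarrow> 'x \<Rightarrow> 'x"
  assumes group_G: "group G" and pmp: "pmp_action G M \<alpha>"
begin

sublocale prob_space M using pmp by (simp add: pmp_action_def)
sublocale G: group G by (rule group_G)

lemma action: "group_action G (space M) \<alpha>"
  using pmp by (simp add: pmp_action_def)

lemma act_closed: "g \<in> carrier G \<Longrightarrow> x \<in> space M \<Longrightarrow> \<alpha> g x \<in> space M"
  using group_action.element_image[OF action] by blast

lemma act_mult: "g \<in> carrier G \<Longrightarrow> h \<in> carrier G \<Longrightarrow> x \<in> space M \<Longrightarrow> \<alpha> (g \<otimes>\<^bsub>G\<^esub> h) x = \<alpha> g (\<alpha> h x)"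
  using group_action.composition_rule[OF action] by metis

lemma act_one: "x \<in> space M \<Longrightarrow> \<alpha> \<one>\<^bsub>G\<^esub> x = x"
  using group_action.id_eq_one[OF action] by (metis restrict_apply')

lemma act_inv: "g \<in> carrier G \<Longrightarrow> x \<in> space M \<Longrightarrow> \<alpha> (inv\<^bsub>G\<^esub> g) (\<alpha> g x) = x"
  using act_mult[of "inv\<^bsub>G\<^esub> g" g x] act_one by simp

lemma act_inv': "g \<in> carrier G \<Longrightarrow> x \<in> space M \<Longrightarrow> \<alpha> g (\<alpha> (inv\<^bsub>G\<^esub> g) x) = x"
  using act_mult[of g "inv\<^bsub>G\<^esub> g" x] act_one by simp

lemma act_inj_on: "g \<in> carrier G \<Longrightarrow> inj_on (\<alpha> g) (space M)"
  by (metis act_inv inj_onI)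

lemma act_image:
  assumes "g \<in> carrier G" "A \<subseteq> space M"
  shows "\<alpha> g ` A = \<alpha> (inv\<^bsub>G\<^esub> g) -` A \<inter> space M"
proof (intro equalityI subsetI)
  fix y assume "y \<in> \<alpha> g ` A"
  then obtain x where "x \<in> A" "y = \<alpha> g x" by auto
  then show "y \<in> \<alpha> (inv\<^bsub>G\<^esub> g) -` A \<inter> space M"
    using assms act_inv[of g x] act_closed[of g x] by auto
next
  fix y assume y: "y \<in> \<alpha> (inv\<^bsub>G\<^esub> g) -` A \<inter> space M"
  then have "y = \<alpha> g (\<alpha> (inv\<^bsub>G\<^esub> g) y)" using assms act_inv'[of g y] by auto
  then show "y \<in> \<alpha> g ` A" using y by blast
qed

lemma act_image_mem: "g \<in> carrier G \<Longrightarrow> A \<subseteq> space M \<Longrightarrow> x \<in> space M \<Longrightarrow> \<alpha> g x \<in> \<alpha> g ` A \<longleftrightarrow> x \<in> A"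
  using act_inj_on by (meson inj_on_image_mem_iff)

lemma act_measurable: "g \<in> carrier G \<Longrightarrow> \<alpha> g \<in> measurable M M"
  using pmp by (simp add: pmp_action_def)

lemma vimage_sets: "g \<in> carrier G \<Longrightarrow> A \<in> sets M \<Longrightarrow> \<alpha> g -` A \<inter> space M \<in> sets M"
  using act_measurable measurable_sets by blast

lemma image_sets: "g \<in> carrier G \<Longrightarrow> A \<in> sets M \<Longrightarrow> \<alpha> g ` A \<in> sets M"
  using vimage_sets[of "inv\<^bsub>G\<^esub> g" A] by (simp add: act_image sets.sets_into_space)

lemma measure_vimage: "g \<in> carrier G \<Longrightarrow> A \<in> sets M \<Longrightarrow> measure M (\<alpha> g -` A \<inter> space M) = measure M A"
  using measure_distr[OF act_measurable, of g A] pmp by (simp add: pmp_action_def)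

lemma image_partition:
  assumes "g \<in> carrier G" "partition_on (space M) C"
  shows "partition_on (space M) ((`) (\<alpha> g) ` C)"
proof (rule partition_onI)
  have "\<Union> ((`) (\<alpha> g) ` C) = \<alpha> g ` space M"
    using assms(2) by (auto simp: partition_on_def)
  also have "\<dots> = space M" using act_image[OF assms(1), of "space M"] act_closed assms(1) by auto
  finally show "\<Union> ((`) (\<alpha> g) ` C) = space M" .
next
  fix A B assume "A \<in> (`) (\<alpha> g) ` C" "B \<in> (`) (\<alpha> g) ` C" "A \<noteq> B"
  then obtain A' B' where *: "A = \<alpha> g ` A'" "B = \<alpha> g ` B'" "A' \<in> C" "B' \<in> C" "A' \<noteq> B'" by auto
  have "A' \<inter> B' = {}" "A' \<subseteq> space M" "B' \<subseteq> space M"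
    using assms(2) *(3-5) by (auto simp: partition_on_def disjoint_def)
  then show "disjnt A B"
    using act_inj_on[OF assms(1)] * by (simp add: disjnt_def inj_on_image_Int[symmetric])
qed (use assms(2) in \<open>auto simp: partition_on_def\<close>)

lemma translate_join:
  assumes "fin_borel_partition M C" "finite F" "F \<subseteq> carrier G" "F \<noteq> {}"
  shows "fin_borel_partition M (translate_join \<alpha> C F)"
    "\<And>g. g \<in> F \<Longrightarrow> refines (space M) (translate_join \<alpha> C F) ((`) (\<alpha> g) ` C)"
proof -
  have C: "finite C" "C \<subseteq> sets M" "partition_on (space M) C"
    using assms(1) by (auto simp: fin_borel_partition_def)
  have part: "partition_on (space M) P" if "P \<in> (\<lambda>s. (`) (\<alpha> s) ` C) ` F" for P
    using that assms(3) C(3) image_partition by auto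
  show "refines (space M) (translate_join \<alpha> C F) ((`) (\<alpha> g) ` C)" if "g \<in> F" for g
    unfolding translate_join_def using that part by (intro refines_common_refinement) auto
  have "finite (translate_join \<alpha> C F)"
    unfolding translate_join_def using assms C(1) by (intro finite_common_refinement) auto
  moreover have "translate_join \<alpha> C F \<subseteq> sets M"
  proof
    fix A assume "A \<in> translate_join \<alpha> C F"
    then obtain f where f: "f \<in> (\<Pi> P\<in>(\<lambda>s. (`) (\<alpha> s) ` C) ` F. P)" "A = \<Inter> (f ` (\<lambda>s. (`) (\<alpha> s) ` C) ` F)"
      by (auto simp: translate_join_def common_refinement)
    have "f ` (\<lambda>s. (`) (\<alpha> s) ` C) ` F \<subseteq> sets M"
    proof (rule image_subsetI)
      fix P assume P: "P \<in> (\<lambda>s. (`) (\<alpha> s) ` C) ` F"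
      then have fP: "f P \<in> P" using f(1) by auto
      obtain s where s: "s \<in> F" "P = (`) (\<alpha> s) ` C" using P by blast
      obtain D where D: "D \<in> C" "f P = \<alpha> s ` D" using fP unfolding s(2) by blast
      show "f P \<in> sets M" unfolding D(2) using s(1) D(1) C(2) assms(3) by (intro image_sets) auto
    qed
    then show "A \<in> sets M" using assms(2,4) f(2) by auto
  qed
  moreover have "partition_on (space M) (translate_join \<alpha> C F)"
    unfolding translate_join_def using part assms(4) by (intro partition_on_common_refinement) auto
  ultimately show "fin_borel_partition M (translate_join \<alpha> C F)"
    by (simp add: fin_borel_partition_def)
qed

end

lemma hull_partition_iff:
  assumes "finite Q" "partition_on X Q"
  shows "A \<in> algebra X hull Q \<longleftrightarrow> A \<subseteq> X \<and> (\<forall>D\<in>Q. D \<subseteq> A \<or> D \<inter> A = {})"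
proof
  have Q: "\<And>D. D \<in> Q \<Longrightarrow> D \<subseteq> X" "\<Union>Q = X" using assms(2) by (auto simp: partition_on_def)
  let ?U = "{A. A \<subseteq> X \<and> (\<forall>D\<in>Q. D \<subseteq> A \<or> D \<inter> A = {})}"
  have "algebra X ?U" unfolding algebra_iff_Un
    using Q(1) by (intro conjI ballI) (auto; blast)+
  moreover have "Q \<subseteq> ?U" using assms(2) by (auto simp: partition_on_def disjoint_def)
  ultimately have sub: "algebra X hull Q \<subseteq> ?U" by (intro hull_minimal)
  then show "A \<subseteq> X \<and> (\<forall>D\<in>Q. D \<subseteq> A \<or> D \<inter> A = {})" if "A \<in> algebra X hull Q"
    using that by auto
  assume A: "A \<subseteq> X \<and> (\<forall>D\<in>Q. D \<subseteq> A \<or> D \<inter> A = {})"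
  then have "A = \<Union>{D \<in> Q. D \<subseteq> A}" using Q(2) by blast
  moreover have "\<Union>{D \<in> Q. D \<subseteq> A} \<in> t" if "algebra X t" "Q \<subseteq> t" for t
  proof -
    interpret algebra X t by fact
    show ?thesis by (rule finite_Union) (use assms(1) that(2) in auto)
  qed
  ultimately show "A \<in> algebra X hull Q" unfolding hull_def by auto
qed

lemma boolean_hom_point_map:
  assumes Q: "finite Q" "partition_on X Q" and \<phi>: "\<phi> \<in> boolean_homs X (algebra X hull Q) V"
  obtains p where "p \<in> V \<rightarrow> X" "\<And>A. A \<in> algebra X hull Q \<Longrightarrow> \<phi> A = {v \<in> V. p v \<in> A}"
proof -
  let ?\<A> = "algebra X hull Q"
  have h: "\<phi> {} = {}" "\<phi> X = V" "\<And>A. A \<in> ?\<A> \<Longrightarrow> \<phi> (X - A) = V - \<phi> A"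
    "\<And>A B. A \<in> ?\<A> \<Longrightarrow> B \<in> ?\<A> \<Longrightarrow> \<phi> (A \<union> B) = \<phi> A \<union> \<phi> B" "\<And>A. A \<in> ?\<A> \<Longrightarrow> \<phi> A \<subseteq> V"
    using \<phi> by (auto simp: boolean_homs_def)
  have Q': "\<Union>Q = X" "{} \<notin> Q" "\<And>D E. D \<in> Q \<Longrightarrow> E \<in> Q \<Longrightarrow> D = E \<or> D \<inter> E = {}"
    using Q(2) by (auto simp: partition_on_def disjoint_def)
  have un: "\<Union>Q' \<in> ?\<A>" if "Q' \<subseteq> Q" for Q'
    unfolding hull_partition_iff[OF Q] using that Q' by blast
  have "\<phi> (\<Union>Q') = (\<Union>D\<in>Q'. \<phi> D)" if "finite Q'" "Q' \<subseteq> Q" for Q'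
    using that
  proof (induction Q')
    case (insert D Q')
    then show ?case using h(4)[of D "\<Union>Q'"] un[of "{D}"] un[of Q'] by simp
  qed (simp add: h(1))
  then have "V = (\<Union>D\<in>Q. \<phi> D)" using Q(1) Q' h(2) by auto
  then have "\<exists>x\<in>X. \<exists>D\<in>Q. x \<in> D \<and> v \<in> \<phi> D" if "v \<in> V" for v
    using that Q'(1,2) by (metis UN_E UnionI all_not_in_conv)
  then obtain p where p: "\<And>v. v \<in> V \<Longrightarrow> p v \<in> X \<and> (\<exists>D\<in>Q. p v \<in> D \<and> v \<in> \<phi> D)" by metis
  show thesis
  proof (rule that[of p])
    show "p \<in> V \<rightarrow> X" using p by auto
    fix A assume A: "A \<in> ?\<A>"
    then have A': "A \<subseteq> X" "\<forall>D\<in>Q. D \<subseteq> A \<or> D \<inter> A = {}" by (auto simp: hull_partition_iff[OF Q])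
    have "v \<in> \<phi> A \<longleftrightarrow> p v \<in> A" if v: "v \<in> V" for v
    proof -
      obtain D where D: "D \<in> Q" "p v \<in> D" "v \<in> \<phi> D" using p v by blast
      have DA: "D \<in> ?\<A>" "X - A \<in> ?\<A>" using un[of "{D}"] D(1) A' Q'(1) by (auto simp: hull_partition_iff[OF Q])
      show ?thesis
      proof (cases "p v \<in> A")
        case True
        then have "D \<subseteq> A" using A' D by blast
        then have "\<phi> A = \<phi> D \<union> \<phi> A" using h(4)[OF DA(1) A] by (simp add: Un_absorb1)
        then show ?thesis using True D by blast
      next
        case False
        then have "D \<subseteq> X - A" using A' D Q'(1) by blast
        then have "\<phi> (X - A) = \<phi> D \<union> \<phi> (X - A)" using h(4)[OF DA] by (simp add: Un_absorb1)
        then show ?thesis using False D h(3)[OF A] by blast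
      qed
    qed
    then show "\<phi> A = {v \<in> V. p v \<in> A}" using h(5)[OF A] by auto
  qed
qed

definition approx_model ::
  "'x measure \<Rightarrow> ('g \<Rightarrow> 'x \<Rightarrow> 'x) \<Rightarrow> 'x set set \<Rightarrow> 'g set \<Rightarrow> real \<Rightarrow> 'v set \<Rightarrow> ('g \<Rightarrow> 'v \<Rightarrow> 'v) \<Rightarrow>
   ('v \<Rightarrow> 'x) \<Rightarrow> bool" where
  "approx_model M \<alpha> \<A> F \<eta> V \<sigma> p \<longleftrightarrow> p \<in> V \<rightarrow> space M \<and>
     (\<forall>A\<in>\<A>. \<bar>real (card {v \<in> V. p v \<in> A}) / real (card V) - measure M A\<bar> \<le> \<eta> \<and>
        (\<forall>g\<in>F. real (card {v \<in> V. (p (\<sigma> g v) \<in> A) \<noteq> (\<alpha> g (p v) \<in> A)}) \<le> \<eta> * real (card V)))"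

definition labelling :: "'v set \<Rightarrow> 'x set set \<Rightarrow> ('v \<Rightarrow> 'x) \<Rightarrow> 'x set \<Rightarrow> 'v set" where
  "labelling V P p = restrict (\<lambda>A. {v \<in> V. p v \<in> A}) P"

abbreviation model_labels ::
  "'x set set \<Rightarrow> 'x measure \<Rightarrow> ('g \<Rightarrow> 'x \<Rightarrow> 'x) \<Rightarrow> 'x set set \<Rightarrow> 'g set \<Rightarrow> real \<Rightarrow> 'v set \<Rightarrow>
   ('g \<Rightarrow> 'v \<Rightarrow> 'v) \<Rightarrow> ('x set \<Rightarrow> 'v set) set" where
  "model_labels P M \<alpha> \<A> F \<eta> V \<sigma> \<equiv> labelling V P ` {p. approx_model M \<alpha> \<A> F \<eta> V \<sigma> p}"

lemma finite_labellings:
  assumes "finite V" "finite P" shows "finite (labelling V P ` Q)"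
proof (rule finite_subset)
  show "labelling V P ` Q \<subseteq> (\<Pi>\<^sub>E A\<in>P. Pow V)" by (auto simp: labelling_def)
  show "finite (\<Pi>\<^sub>E A\<in>P. Pow V)" using assms by (intro finite_PiE) auto
qed

lemma approx_model_mono:
  assumes "approx_model M \<alpha> \<A>' F' \<eta>' V \<sigma> p" "\<A> \<subseteq> \<A>'" "F \<subseteq> F'" "\<eta>' \<le> \<eta>"
  shows "approx_model M \<alpha> \<A> F \<eta> V \<sigma> p"
proof -
  have "\<eta>' * real (card V) \<le> \<eta> * real (card V)" using assms(4) by (intro mult_right_mono) auto
  with assms show ?thesis unfolding approx_model_def by (meson order_trans subsetD)
qed

definition atoms :: "'x set \<Rightarrow> 'x set set \<Rightarrow> 'x set set" where
  "atoms X \<A> = (\<lambda>x. {y \<in> X. \<forall>A\<in>\<A>. y \<in> A \<longleftrightarrow> x \<in> A}) ` X"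

lemma atoms_fin_borel_partition:
  assumes "finite \<A>" "\<A> \<subseteq> sets M"
  shows "fin_borel_partition M (atoms (space M) \<A>)"
  unfolding fin_borel_partition_def
proof (intro conjI)
  have "atoms (space M) \<A> \<subseteq> (\<lambda>\<B>. {y \<in> space M. \<forall>A\<in>\<A>. y \<in> A \<longleftrightarrow> A \<in> \<B>}) ` Pow \<A>"
  proof
    fix D assume "D \<in> atoms (space M) \<A>"
    then obtain x where "D = {y \<in> space M. \<forall>A\<in>\<A>. y \<in> A \<longleftrightarrow> A \<in> {A \<in> \<A>. x \<in> A}}"
      by (auto simp: atoms_def)
    then show "D \<in> (\<lambda>\<B>. {y \<in> space M. \<forall>A\<in>\<A>. y \<in> A \<longleftrightarrow> A \<in> \<B>}) ` Pow \<A>" by blast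
  qed
  then show "finite (atoms (space M) \<A>)" using assms(1) by (simp add: finite_subset)
  show "atoms (space M) \<A> \<subseteq> sets M"
  proof
    fix D assume "D \<in> atoms (space M) \<A>"
    then obtain x where D: "D = {y \<in> space M. \<forall>A\<in>\<A>. y \<in> A \<longleftrightarrow> x \<in> A}" by (auto simp: atoms_def)
    have "{y \<in> space M. y \<in> A \<longleftrightarrow> x \<in> A} \<in> sets M" if "A \<in> \<A>" for A
    proof -
      have "A \<in> sets M" using that assms by auto
      then show ?thesis by measurable
    qed
    then show "D \<in> sets M" unfolding D using assms(1) by (rule sets.sets_Collect_finite_All)
  qed
  show "partition_on (space M) (atoms (space M) \<A>)"
    by (rule partition_onI) (auto simp: atoms_def disjnt_def)
qed

lemma atoms_subset_or_disjoint:
  assumes "D \<in> atoms X \<A>" "A \<in> \<A>"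
  shows "D \<subseteq> A \<or> D \<inter> A = {}"
  using assms by (auto simp: atoms_def)

lemma atoms_refines:
  assumes "partition_on X P" "P \<subseteq> \<A>" "partition_on X (atoms X \<A>)"
  shows "refines X (atoms X \<A>) P"
  unfolding refines_def
proof (intro conjI ballI)
  fix D assume D: "D \<in> atoms X \<A>"
  then obtain x where x: "x \<in> X" "x \<in> D" by (auto simp: atoms_def)
  then obtain A where "A \<in> P" "x \<in> A" using assms(1) by (auto simp: partition_on_def)
  then show "\<exists>A\<in>P. D \<subseteq> A" using atoms_subset_or_disjoint[OF D] assms(2) x by blast
qed fact+

lemma refines_subset_or_disjoint:
  assumes "refines X C P" "D \<in> C" "A \<in> P"
  shows "D \<subseteq> A \<or> D \<inter> A = {}"
proof -
  obtain B where B: "B \<in> P" "D \<subseteq> B" using assms by (auto simp: refines_def)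
  have "A = B \<or> A \<inter> B = {}"
    using assms(1,3) B(1) unfolding refines_def partition_on_def disjoint_def by metis
  then show ?thesis using B(2) by blast
qed

lemma (in prob_space) frequency_deviation_le_sum:
  assumes Q: "fin_borel_partition M Q" and A: "A \<subseteq> space M" "\<And>D. D \<in> Q \<Longrightarrow> D \<subseteq> A \<or> D \<inter> A = {}"
    and V: "finite V"
  shows "\<bar>real (card {v \<in> V. p v \<in> A}) / real (card V) - measure M A\<bar>
     \<le> (\<Sum>D\<in>Q. \<bar>real (card {v \<in> V. p v \<in> D}) / real (card V) - measure M D\<bar>)"
proof -
  have Q': "finite Q" "Q \<subseteq> sets M" "\<Union>Q = space M" "\<And>D E. D \<in> Q \<Longrightarrow> E \<in> Q \<Longrightarrow> D \<noteq> E \<Longrightarrow> D \<inter> E = {}"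
    using Q by (auto simp: fin_borel_partition_def partition_on_def disjoint_def)
  let ?R = "{D \<in> Q. D \<subseteq> A}"
  have R: "finite ?R" "A = \<Union>?R"
  proof -
    show "finite ?R" using Q' by simp
    show "A = \<Union>?R"
    proof (intro equalityI subsetI)
      fix x assume x: "x \<in> A"
      then obtain D where "D \<in> Q" "x \<in> D" using Q'(3) A(1) by blast
      then show "x \<in> \<Union>?R" using A(2)[of D] x by blast
    qed auto
  qed
  have "measure M A = measure M (\<Union>D\<in>?R. D)" using R(2) by simp
  also have "\<dots> = (\<Sum>D\<in>?R. measure M D)"
    using R Q' by (intro finite_measure_finite_Union) (auto simp: disjoint_family_on_def)
  finally have m: "measure M A = (\<Sum>D\<in>?R. measure M D)" .
  have "{v \<in> V. p v \<in> A} = (\<Union>D\<in>?R. {v \<in> V. p v \<in> D})" using R(2) by blast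
  also have "card \<dots> = (\<Sum>D\<in>?R. card {v \<in> V. p v \<in> D})"
    using R(1) V Q'(4) by (intro card_UN_disjoint) fastforce+
  finally have "real (card {v \<in> V. p v \<in> A}) / real (card V) - measure M A
     = (\<Sum>D\<in>?R. real (card {v \<in> V. p v \<in> D}) / real (card V) - measure M D)"
    by (simp add: m sum_subtractf sum_divide_distrib)
  also have "\<bar>\<dots>\<bar> \<le> (\<Sum>D\<in>?R. \<bar>real (card {v \<in> V. p v \<in> D}) / real (card V) - measure M D\<bar>)"
    by (rule sum_abs)
  also have "\<dots> \<le> (\<Sum>D\<in>Q. \<bar>real (card {v \<in> V. p v \<in> D}) / real (card V) - measure M D\<bar>)"
    using Q'(1) by (intro sum_mono2) auto
  finally show ?thesis .
qed

context pmp
begin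

lemma card_sym_diff_translate:
  assumes "\<sigma> permutes V" "g \<in> carrier G" "p \<in> V \<rightarrow> space M" "A \<subseteq> space M"
  shows "card (sym_diff (\<sigma> ` {v \<in> V. p v \<in> A}) {v \<in> V. p v \<in> \<alpha> g ` A})
       = card {v \<in> V. (p (\<sigma> v) \<in> \<alpha> g ` A) \<noteq> (\<alpha> g (p v) \<in> \<alpha> g ` A)}"
proof -
  let ?S = "sym_diff (\<sigma> ` {v \<in> V. p v \<in> A}) {v \<in> V. p v \<in> \<alpha> g ` A}"
  have V: "\<sigma> v \<in> V" if "v \<in> V" for v using that permutes_in_image[OF assms(1)] by simp
  have "?S \<subseteq> V" using V by auto
  have mem: "\<sigma> v \<in> ?S \<longleftrightarrow> (p (\<sigma> v) \<in> \<alpha> g ` A) \<noteq> (\<alpha> g (p v) \<in> \<alpha> g ` A)" if v: "v \<in> V" for v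
  proof -
    have "p v \<in> space M" using v assms(3) by auto
    then have "\<alpha> g (p v) \<in> \<alpha> g ` A \<longleftrightarrow> p v \<in> A" using act_image_mem assms by blast
    moreover have "\<sigma> v \<in> \<sigma> ` {v \<in> V. p v \<in> A} \<longleftrightarrow> p v \<in> A"
      using v permutes_inj[OF assms(1)] by (auto dest: injD)
    ultimately show ?thesis using V[OF v] by auto
  qed
  have "card ?S = card (V \<inter> ?S)" using \<open>?S \<subseteq> V\<close> by (simp add: Int_absorb1)
  also have "\<dots> = card {v \<in> V. \<sigma> v \<in> ?S}" by (rule card_permutes_preimage[OF assms(1), symmetric])
  also have "{v \<in> V. \<sigma> v \<in> ?S} = {v \<in> V. (p (\<sigma> v) \<in> \<alpha> g ` A) \<noteq> (\<alpha> g (p v) \<in> \<alpha> g ` A)}"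
    using mem by blast
  finally show ?thesis .
qed

lemma translate_in_hull:
  assumes "fin_borel_partition M C" "finite F" "F \<subseteq> carrier G" "g \<in> F" "A \<in> C"
  shows "\<alpha> g ` A \<in> algebra (space M) hull translate_join \<alpha> C F"
proof -
  have tj: "fin_borel_partition M (translate_join \<alpha> C F)"
    "refines (space M) (translate_join \<alpha> C F) ((`) (\<alpha> g) ` C)"
    using translate_join[OF assms(1-3)] assms(4) by auto
  moreover have "\<alpha> g ` A \<subseteq> space M"
    using assms by (intro sets.sets_into_space image_sets) (auto simp: fin_borel_partition_def)
  ultimately show ?thesis
    using refines_subset_or_disjoint[OF tj(2)] assms(5)
    by (subst hull_partition_iff) (auto simp: fin_borel_partition_def)
qed

lemma refined_in_hull:
  assumes "fin_borel_partition M C" "finite F" "F \<subseteq> carrier G" "\<one>\<^bsub>G\<^esub> \<in> F"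
    "A \<subseteq> space M" "\<And>D. D \<in> C \<Longrightarrow> D \<subseteq> A \<or> D \<inter> A = {}"
  shows "A \<in> algebra (space M) hull translate_join \<alpha> C F"
    "\<And>D. D \<in> translate_join \<alpha> C F \<Longrightarrow> D \<subseteq> A \<or> D \<inter> A = {}"
proof -
  have tj: "fin_borel_partition M (translate_join \<alpha> C F)"
    "refines (space M) (translate_join \<alpha> C F) ((`) (\<alpha> \<one>\<^bsub>G\<^esub>) ` C)"
    using translate_join[OF assms(1-3)] assms(4) by auto
  have C: "B \<subseteq> space M" if "B \<in> C" for B
    using that assms(1) by (auto simp: fin_borel_partition_def partition_on_def)
  have "\<alpha> \<one>\<^bsub>G\<^esub> ` B = B" if "B \<in> C" for B
    using C[OF that] act_one by (auto simp: image_iff subset_iff)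
  then have "(`) (\<alpha> \<one>\<^bsub>G\<^esub>) ` C = C" by simp
  then have r: "refines (space M) (translate_join \<alpha> C F) C" using tj(2) by simp
  show *: "D \<subseteq> A \<or> D \<inter> A = {}" if D: "D \<in> translate_join \<alpha> C F" for D
  proof -
    obtain B where "B \<in> C" "D \<subseteq> B" using r D by (auto simp: refines_def)
    then show ?thesis using assms(6) by blast
  qed
  show "A \<in> algebra (space M) hull translate_join \<alpha> C F"
    using * tj(1) assms(5) by (subst hull_partition_iff) (auto simp: fin_borel_partition_def)
qed

end

lemma fin_borel_partition_cases:
  assumes "fin_borel_partition M C" "A \<in> C" "D \<in> C"
  shows "D \<subseteq> A \<or> D \<inter> A = {}"
  using assms unfolding fin_borel_partition_def partition_on_def disjoint_def by blast

context pmp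
begin

lemma labellings_of_homs:
  assumes P: "fin_borel_partition M P" and \<A>: "finite \<A>" "\<A> \<subseteq> sets M"
    and F: "finite F" "F \<subseteq> carrier G" and \<eta>: "0 < \<eta>"
  obtains C F' \<delta> where "fin_borel_partition M C" "refines (space M) C P"
    "finite F'" "F' \<subseteq> carrier G" "\<one>\<^bsub>G\<^esub> \<in> F'" "0 < \<delta>"
    "\<And>(V :: 'v set) \<sigma>. finite V \<Longrightarrow> V \<noteq> {} \<Longrightarrow> (\<And>g. g \<in> carrier G \<Longrightarrow> \<sigma> g permutes V) \<Longrightarrow>
       (\<lambda>\<phi>. restrict \<phi> P) ` Hom_mu M \<alpha> C F' \<delta> (V, \<sigma>)
         \<subseteq> model_labels P M \<alpha> \<A> F \<eta> V \<sigma>"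
proof -
  define pre where "pre g A = \<alpha> g -` A \<inter> space M" for g A
  define \<A>' where "\<A>' = P \<union> \<A> \<union> (\<Union>g\<in>F. pre g ` \<A>)"
  have P': "finite P" "P \<subseteq> sets M" "partition_on (space M) P" using P by (auto simp: fin_borel_partition_def)
  have \<A>': "finite \<A>'" "\<A>' \<subseteq> sets M"
    using P' \<A> F by (auto simp: \<A>'_def pre_def intro!: vimage_sets)
  define C where "C = atoms (space M) \<A>'"
  have C: "fin_borel_partition M C" unfolding C_def using \<A>' by (rule atoms_fin_borel_partition)
  have CP: "refines (space M) C P" unfolding C_def
    using P' C by (intro atoms_refines) (auto simp: \<A>'_def C_def fin_borel_partition_def)
  let ?F = "insert \<one>\<^bsub>G\<^esub> F"
  have F': "finite ?F" "?F \<subseteq> carrier G" "\<one>\<^bsub>G\<^esub> \<in> ?F" using F by auto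
  let ?Q = "translate_join \<alpha> C ?F"
  have Q: "fin_borel_partition M ?Q" using translate_join(1)[OF C F'(1,2)] by simp
  have in_sp: "A \<subseteq> space M" if "A \<in> \<A>'" for A using that \<A>' sets.sets_into_space by auto
  have dis: "D \<subseteq> A \<or> D \<inter> A = {}" if "D \<in> C" "A \<in> \<A>'" for D A
    using that unfolding C_def by (rule atoms_subset_or_disjoint)
  have hull: "A \<in> algebra (space M) hull ?Q" if "A \<in> \<A>'" for A
    by (rule refined_in_hull(1)[OF C F' in_sp[OF that] dis[OF _ that]])
  show thesis
  proof (rule that[OF C CP F' \<eta>], rule image_subsetI)
    fix V :: "'v set" and \<sigma> \<phi>
    assume V: "finite V" "V \<noteq> {}" and \<sigma>: "\<And>g. g \<in> carrier G \<Longrightarrow> \<sigma> g permutes V"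
      and \<phi>: "\<phi> \<in> Hom_mu M \<alpha> C ?F \<eta> (V, \<sigma>)"
    have n: "0 < real (card V)" using V by (simp add: card_gt_0_iff)
    from \<phi> have "\<phi> \<in> boolean_homs (space M) (algebra (space M) hull ?Q) V"
      by (simp add: Hom_mu_def)
    moreover have "finite ?Q" "partition_on (space M) ?Q" using Q by (auto simp: fin_borel_partition_def)
    ultimately obtain p where p: "p \<in> V \<rightarrow> space M"
      "\<And>A. A \<in> algebra (space M) hull ?Q \<Longrightarrow> \<phi> A = {v \<in> V. p v \<in> A}"
      using boolean_hom_point_map by blast
    have "approx_model M \<alpha> \<A> F \<eta> V \<sigma> p"
      unfolding approx_model_def
    proof (intro conjI ballI)
      show "p \<in> V \<rightarrow> space M" by (rule p(1))
    next
      fix A assume A: "A \<in> \<A>"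
      then have A': "A \<in> \<A>'" by (simp add: \<A>'_def)
      have "\<bar>real (card {v \<in> V. p v \<in> A}) / real (card V) - measure M A\<bar>
         \<le> (\<Sum>D\<in>?Q. \<bar>real (card {v \<in> V. p v \<in> D}) / real (card V) - measure M D\<bar>)"
      proof (rule frequency_deviation_le_sum[OF Q in_sp[OF A'] _ V(1)])
        fix D assume "D \<in> ?Q"
        show "D \<subseteq> A \<or> D \<inter> A = {}"
          by (rule refined_in_hull(2)[OF C F' in_sp[OF A'] dis[OF _ A'] \<open>D \<in> ?Q\<close>])
      qed
      also have "\<dots> = (\<Sum>D\<in>?Q. \<bar>measure (uniform_count_measure V) (\<phi> D) - measure M D\<bar>)"
      proof (intro sum.cong refl)
        fix D assume "D \<in> ?Q"
        then have "\<phi> D = {v \<in> V. p v \<in> D}" by (intro p(2) hull_inc)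
        then show "\<bar>real (card {v \<in> V. p v \<in> D}) / real (card V) - measure M D\<bar>
           = \<bar>measure (uniform_count_measure V) (\<phi> D) - measure M D\<bar>"
          using V(1) by (simp add: measure_uniform_count_measure)
      qed
      also have "\<dots> < \<eta>" using \<phi> by (simp add: Hom_mu_def)
      finally show "\<bar>real (card {v \<in> V. p v \<in> A}) / real (card V) - measure M A\<bar> \<le> \<eta>" by simp
    next
      fix A g assume A: "A \<in> \<A>" and g: "g \<in> F"
      let ?A0 = "pre g A"
      have gG: "g \<in> carrier G" using g F by auto
      have A0: "?A0 \<in> \<A>'" using A g by (auto simp: \<A>'_def)
      have sp: "A \<subseteq> space M" using A by (auto intro!: in_sp simp: \<A>'_def)
      have Asp: "D \<subseteq> space M" if "D \<in> C" for D
        using that C by (auto simp: fin_borel_partition_def partition_on_def)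
      let ?m = "\<lambda>D. {v \<in> V. (p (\<sigma> g v) \<in> \<alpha> g ` D) \<noteq> (\<alpha> g (p v) \<in> \<alpha> g ` D)}"
      have "{v \<in> V. (p (\<sigma> g v) \<in> A) \<noteq> (\<alpha> g (p v) \<in> A)} \<subseteq> (\<Union>D\<in>C. ?m D)"
      proof
        fix v assume "v \<in> {v \<in> V. (p (\<sigma> g v) \<in> A) \<noteq> (\<alpha> g (p v) \<in> A)}"
        then have v: "v \<in> V" "(p (\<sigma> g v) \<in> A) \<noteq> (\<alpha> g (p v) \<in> A)" by auto
        have pv: "p v \<in> space M" "p (\<sigma> g v) \<in> space M"
          using v(1) p(1) permutes_in_image[OF \<sigma>[OF gG]] by auto
        define y where "y = \<alpha> (inv\<^bsub>G\<^esub> g) (p (\<sigma> g v))"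
        have y: "y \<in> space M" "\<alpha> g y = p (\<sigma> g v)" using pv gG by (auto simp: y_def act_closed act_inv')
        have ne: "y \<in> ?A0 \<longleftrightarrow> p v \<notin> ?A0" using v(2) pv y by (auto simp: pre_def)
        obtain D where D: "D \<in> C" "p v \<in> D"
          using C pv(1) by (auto simp: fin_borel_partition_def partition_on_def)
        have "y \<notin> D" using dis[OF D(1) A0] D(2) ne by blast
        then have "p (\<sigma> g v) \<notin> \<alpha> g ` D" using y act_image_mem[OF gG Asp[OF D(1)]] by metis
        moreover have "\<alpha> g (p v) \<in> \<alpha> g ` D" using D by auto
        ultimately show "v \<in> (\<Union>D\<in>C. ?m D)" using D v by auto
      qed
      then have "card {v \<in> V. (p (\<sigma> g v) \<in> A) \<noteq> (\<alpha> g (p v) \<in> A)} \<le> card (\<Union>D\<in>C. ?m D)"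
        using V C by (intro card_mono) (auto simp: fin_borel_partition_def)
      also have "\<dots> \<le> (\<Sum>D\<in>C. card (?m D))"
        using C by (intro card_UN_le) (auto simp: fin_borel_partition_def)
      finally have "real (card {v \<in> V. (p (\<sigma> g v) \<in> A) \<noteq> (\<alpha> g (p v) \<in> A)})
           \<le> real (\<Sum>D\<in>C. card (?m D))" by (rule of_nat_mono)
      also have "\<dots> = (\<Sum>D\<in>C. real (card (?m D)))" by simp
      also have "\<dots> = (\<Sum>D\<in>C. real (card V) *
           measure (uniform_count_measure V) (sym_diff (\<sigma> g ` \<phi> D) (\<phi> (\<alpha> g ` D))))"
      proof (intro sum.cong refl)
        fix D assume D: "D \<in> C"
        have "D \<in> algebra (space M) hull ?Q"
          using D Asp fin_borel_partition_cases[OF C D] by (intro refined_in_hull(1)[OF C F'])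
        moreover have "\<alpha> g ` D \<in> algebra (space M) hull ?Q"
          using translate_in_hull[OF C F'(1,2)] g D by simp
        ultimately have eq: "\<phi> D = {v \<in> V. p v \<in> D}" "\<phi> (\<alpha> g ` D) = {v \<in> V. p v \<in> \<alpha> g ` D}"
          using p(2) by auto
        have "sym_diff (\<sigma> g ` \<phi> D) (\<phi> (\<alpha> g ` D)) \<subseteq> V"
          using eq permutes_in_image[OF \<sigma>[OF gG]] by auto
        then show "real (card (?m D)) = real (card V) *
            measure (uniform_count_measure V) (sym_diff (\<sigma> g ` \<phi> D) (\<phi> (\<alpha> g ` D)))"
          using V(1) n card_sym_diff_translate[OF \<sigma>[OF gG] gG p(1) Asp[OF D]]
          by (simp add: measure_uniform_count_measure eq)
      qed
      also have "\<dots> = real (card V) *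
          (\<Sum>D\<in>C. measure (uniform_count_measure V) (sym_diff (\<sigma> g ` \<phi> D) (\<phi> (\<alpha> g ` D))))"
        by (simp add: sum_distrib_left)
      also have "\<dots> \<le> real (card V) * \<eta>"
        using \<phi> g by (intro mult_left_mono) (auto simp: Hom_mu_def less_imp_le)
      finally show "real (card {v \<in> V. (p (\<sigma> g v) \<in> A) \<noteq> (\<alpha> g (p v) \<in> A)}) \<le> \<eta> * real (card V)"
        by (simp add: mult.commute)
    qed
    moreover have "restrict \<phi> P = labelling V P p"
      unfolding labelling_def by (intro restrict_ext p(2) hull) (auto simp: \<A>'_def)
    ultimately show "restrict \<phi> P \<in> model_labels P M \<alpha> \<A> F \<eta> V \<sigma>" by blast
  qed
qed

lemma homs_of_labellings:
  assumes C: "fin_borel_partition M C" "refines (space M) C P"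
    and F: "finite F" "F \<subseteq> carrier G" "\<one>\<^bsub>G\<^esub> \<in> F" and \<delta>: "0 < \<delta>"
  obtains \<A> \<eta> where "finite \<A>" "\<A> \<subseteq> sets M" "0 < \<eta>"
    "\<And>(V :: 'v set) \<sigma>. finite V \<Longrightarrow> V \<noteq> {} \<Longrightarrow> (\<And>g. g \<in> carrier G \<Longrightarrow> \<sigma> g permutes V) \<Longrightarrow>
       model_labels P M \<alpha> \<A> F \<eta> V \<sigma>
         \<subseteq> (\<lambda>\<phi>. restrict \<phi> P) ` Hom_mu M \<alpha> C F \<delta> (V, \<sigma>)"
proof -
  let ?Q = "translate_join \<alpha> C F"
  have Q: "fin_borel_partition M ?Q" using translate_join(1)[OF C(1) F(1,2)] F(3) by auto
  then have Q': "finite ?Q" "?Q \<subseteq> sets M" "partition_on (space M) ?Q" by (auto simp: fin_borel_partition_def)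
  have C': "finite C" "C \<subseteq> sets M" using C by (auto simp: fin_borel_partition_def)
  have Asp: "A \<subseteq> space M" if "A \<in> C" for A using that C' sets.sets_into_space by auto
  define \<A> where "\<A> = ?Q \<union> (\<Union>g\<in>F. (`) (\<alpha> g) ` C)"
  have \<A>: "finite \<A>" "\<A> \<subseteq> sets M" using Q' C' F by (auto simp: \<A>_def intro!: image_sets)
  define c where "c = 1 + real (card C) + real (card ?Q)"
  define \<eta> where "\<eta> = \<delta> / (2 * c)"
  have c: "0 < c" by (simp add: c_def add_pos_nonneg)
  have \<eta>: "0 < \<eta>" "c * \<eta> < \<delta>" using \<delta> c by (auto simp: \<eta>_def)
  have small: "real (card C) * \<eta> < \<delta>" "real (card ?Q) * \<eta> < \<delta>"
  proof -
    have "real (card C) * \<eta> \<le> c * \<eta>" "real (card ?Q) * \<eta> \<le> c * \<eta>"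
      using \<eta>(1) by (auto intro!: mult_right_mono simp: c_def)
    then show "real (card C) * \<eta> < \<delta>" "real (card ?Q) * \<eta> < \<delta>" using \<eta>(2) by auto
  qed
  show thesis
  proof (rule that[OF \<A> \<eta>(1)], rule image_subsetI)
    fix V :: "'v set" and \<sigma> p
    assume V: "finite V" "V \<noteq> {}" and \<sigma>: "\<And>g. g \<in> carrier G \<Longrightarrow> \<sigma> g permutes V"
      and "p \<in> {p. approx_model M \<alpha> \<A> F \<eta> V \<sigma> p}"
    then have am: "approx_model M \<alpha> \<A> F \<eta> V \<sigma> p" by simp
    have n: "0 < real (card V)" using V by (simp add: card_gt_0_iff)
    have p: "p \<in> V \<rightarrow> space M" using am by (simp add: approx_model_def)
    define \<phi> where "\<phi> = restrict (\<lambda>A. {v \<in> V. p v \<in> A}) (algebra (space M) hull ?Q)"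
    have hull_iff: "A \<in> algebra (space M) hull ?Q \<longleftrightarrow> A \<subseteq> space M \<and> (\<forall>D\<in>?Q. D \<subseteq> A \<or> D \<inter> A = {})" for A
      by (rule hull_partition_iff[OF Q'(1,3)])
    have "algebra (space M) (algebra (space M) hull ?Q)"
    proof (rule algebra_iff_Un[THEN iffD2], intro conjI ballI)
      fix A assume A: "A \<in> algebra (space M) hull ?Q"
      then show "space M - A \<in> algebra (space M) hull ?Q"
        using Q'(3) unfolding hull_iff partition_on_def by blast
      fix B assume "B \<in> algebra (space M) hull ?Q"
      with A show "A \<union> B \<in> algebra (space M) hull ?Q" unfolding hull_iff by blast
    qed (use hull_iff in auto)
    then interpret alg: algebra "space M" "algebra (space M) hull ?Q" .
    have hom: "\<phi> \<in> boolean_homs (space M) (algebra (space M) hull ?Q) V"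
      unfolding boolean_homs_def using p by (auto simp: \<phi>_def alg.Int)
    have \<phi>_eq: "\<phi> A = {v \<in> V. p v \<in> A}" if "A \<in> algebra (space M) hull ?Q" for A
      using that by (simp add: \<phi>_def)
    have 1: "(\<Sum>A\<in>C. measure (uniform_count_measure V) (sym_diff (\<sigma> g ` \<phi> A) (\<phi> (\<alpha> g ` A)))) < \<delta>"
      if g: "g \<in> F" for g
    proof -
      have gG: "g \<in> carrier G" using g F by auto
      have "measure (uniform_count_measure V) (sym_diff (\<sigma> g ` \<phi> A) (\<phi> (\<alpha> g ` A))) \<le> \<eta>" if A: "A \<in> C" for A
      proof -
        have "A \<in> algebra (space M) hull ?Q"
          using Asp[OF A] fin_borel_partition_cases[OF C(1) A] by (intro refined_in_hull(1)[OF C(1) F])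
        moreover have "\<alpha> g ` A \<in> algebra (space M) hull ?Q"
          using translate_in_hull[OF C(1) F(1,2) g A] .
        ultimately have eq: "\<phi> A = {v \<in> V. p v \<in> A}" "\<phi> (\<alpha> g ` A) = {v \<in> V. p v \<in> \<alpha> g ` A}"
          using \<phi>_eq by auto
        have sub: "sym_diff (\<sigma> g ` \<phi> A) (\<phi> (\<alpha> g ` A)) \<subseteq> V"
          using eq permutes_in_image[OF \<sigma>[OF gG]] by auto
        have "A \<subseteq> space M" using A C' sets.sets_into_space by auto
        moreover have "\<alpha> g ` A \<in> \<A>" using g A by (auto simp: \<A>_def)
        then have "real (card {v \<in> V. (p (\<sigma> g v) \<in> \<alpha> g ` A) \<noteq> (\<alpha> g (p v) \<in> \<alpha> g ` A)}) \<le> \<eta> * real (card V)"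
          using am g unfolding approx_model_def by blast
        ultimately have "real (card (sym_diff (\<sigma> g ` \<phi> A) (\<phi> (\<alpha> g ` A)))) \<le> \<eta> * real (card V)"
          using card_sym_diff_translate[OF \<sigma>[OF gG] gG p, of A] by (simp only: eq)
        then show ?thesis
          using V(1) sub n by (simp add: measure_uniform_count_measure divide_le_eq)
      qed
      then have "(\<Sum>A\<in>C. measure (uniform_count_measure V) (sym_diff (\<sigma> g ` \<phi> A) (\<phi> (\<alpha> g ` A)))) \<le> (\<Sum>A\<in>C. \<eta>)"
        by (intro sum_mono)
      then show ?thesis using small by simp
    qed
    have "(\<Sum>A\<in>?Q. \<bar>measure (uniform_count_measure V) (\<phi> A) - measure M A\<bar>) \<le> (\<Sum>A\<in>?Q. \<eta>)"
    proof (rule sum_mono)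
      fix A assume A: "A \<in> ?Q"
      then have "\<phi> A = {v \<in> V. p v \<in> A}" by (intro \<phi>_eq hull_inc)
      then show "\<bar>measure (uniform_count_measure V) (\<phi> A) - measure M A\<bar> \<le> \<eta>"
        using A am V(1) by (simp add: measure_uniform_count_measure approx_model_def \<A>_def)
    qed
    then have 2: "(\<Sum>A\<in>?Q. \<bar>measure (uniform_count_measure V) (\<phi> A) - measure M A\<bar>) < \<delta>"
      using small by simp
    have "\<phi> \<in> Hom_mu M \<alpha> C F \<delta> (V, \<sigma>)" using hom 1 2 by (simp add: Hom_mu_def)
    moreover have "labelling V P p = restrict \<phi> P"
      unfolding labelling_def
    proof (rule restrict_ext)
      fix A assume A: "A \<in> P"
      have "A \<in> algebra (space M) hull ?Q"
      proof (rule refined_in_hull(1)[OF C(1) F])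
        show "A \<subseteq> space M" using C(2) A by (auto simp: refines_def partition_on_def)
        show "D \<subseteq> A \<or> D \<inter> A = {}" if "D \<in> C" for D
          using refines_subset_or_disjoint[OF C(2) that A] .
      qed
      then show "{v \<in> V. p v \<in> A} = \<phi> A" by (simp add: \<phi>_eq)
    qed
    ultimately show "labelling V P p \<in> (\<lambda>\<phi>. restrict \<phi> P) ` Hom_mu M \<alpha> C F \<delta> (V, \<sigma>)" by blast
  qed
qed

end

section \<open>Passing to a countable family of events\<close>

lemma separable_metrizable_imp_second_countable:
  assumes "metrizable_space T" "separable_space T"
  shows "second_countable T"
proof -
  obtain S d where S: "Metric_space S d" "T = Metric_space.mtopology S d"
    using assms(1) unfolding metrizable_space_def by auto
  interpret Metric_space S d by fact
  obtain Q where Q: "countable Q" "Q \<subseteq> topspace T" "T closure_of Q = topspace T"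
    using assms(2) unfolding separable_space_def by auto
  have QS: "Q \<subseteq> S" and top: "topspace T = S" using Q S by auto
  define \<B> where "\<B> = (\<lambda>(x, n). mball x (1 / real (Suc n))) ` (Q \<times> (UNIV :: nat set))"
  show ?thesis unfolding second_countable_def
  proof (intro exI[of _ \<B>] conjI ballI allI impI)
    show "countable \<B>" using Q(1) by (auto simp: \<B>_def)
    show "openin T B" if "B \<in> \<B>" for B using that S(2) by (auto simp: \<B>_def)
    fix U x assume U: "openin T U \<and> x \<in> U"
    then have xS: "x \<in> S" using openin_subset top by blast
    obtain r where r: "0 < r" "mball x r \<subseteq> U" using U S(2) openin_mtopology by auto
    obtain n where n: "1 / real (Suc n) < r / 2" using r nat_approx_posE by (metis half_gt_zero)
    define e where "e = 1 / real (Suc n)"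
    have e: "0 < e" "e < r / 2" using n by (auto simp: e_def)
    have "x \<in> mtopology closure_of Q" using xS top Q(3) S(2) by simp
    then obtain y where y: "y \<in> Q" "y \<in> mball x e"
      using e unfolding metric_closure_of by blast
    then have yS: "y \<in> S" "d x y < e" by auto
    have "mball y e \<subseteq> mball x r"
    proof
      fix z assume z: "z \<in> mball y e"
      then have "d x z \<le> d x y + d y z" using triangle xS yS by auto
      then show "z \<in> mball x r" using z yS e xS by auto
    qed
    then show "\<exists>V\<in>\<B>. x \<in> V \<and> V \<subseteq> U"
      using r(2) y yS xS commute by (intro bexI[of _ "mball y e"]) (auto simp: \<B>_def e_def)
  qed
qed

lemma standard_borel_countably_generated:
  assumes "standard_borel M"
  obtains \<U> where "countable \<U>" "sets M = sigma_sets (space M) \<U>" "\<U> \<subseteq> sets M"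
proof -
  obtain T where T: "completely_metrizable_space T" "separable_space T" "topspace T = space M"
    "sets M = sigma_sets (space M) {U. openin T U}"
    using assms by (auto simp: standard_borel_def)
  have "second_countable T"
    using T by (intro separable_metrizable_imp_second_countable completely_metrizable_imp_metrizable_space)
  then obtain \<B> where B: "countable \<B>" "\<And>V. V \<in> \<B> \<Longrightarrow> openin T V"
    "\<And>U x. openin T U \<Longrightarrow> x \<in> U \<Longrightarrow> \<exists>V\<in>\<B>. x \<in> V \<and> V \<subseteq> U"
    unfolding second_countable_def by auto
  have sub: "\<B> \<subseteq> sets M" using B(2) T(4) by auto
  have "U \<in> sigma_sets (space M) \<B>" if U: "openin T U" for U
  proof -
    have "U = \<Union>{V \<in> \<B>. V \<subseteq> U}" using B(3)[OF U] by blast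
    moreover have "\<Union>{V \<in> \<B>. V \<subseteq> U} \<in> sigma_sets (space M) \<B>"
      using B(1) by (intro sigma_sets_UNION) (auto simp: countable_subset intro: sigma_sets.Basic)
    ultimately show ?thesis by simp
  qed
  then have "sets M \<subseteq> sigma_sets (space M) \<B>"
    unfolding T(4) by (intro sigma_sets_mono) auto
  moreover have "sigma_sets (space M) \<B> \<subseteq> sets M" using sub by (rule sets.sigma_sets_subset)
  ultimately show thesis using that B(1) sub by blast
qed

definition saturated :: "'x set \<Rightarrow> 'x set set \<Rightarrow> 'x set set" where
  "saturated X \<A> = {A. A \<subseteq> X \<and> (\<forall>x\<in>X. \<forall>y\<in>X. (\<forall>B\<in>\<A>. x \<in> B \<longleftrightarrow> y \<in> B) \<longrightarrow> (x \<in> A \<longleftrightarrow> y \<in> A))}"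

lemma saturatedD:
  assumes "A \<in> saturated X \<A>" "x \<in> X" "y \<in> X" "\<And>B. B \<in> \<A> \<Longrightarrow> x \<in> B \<longleftrightarrow> y \<in> B"
  shows "x \<in> A \<longleftrightarrow> y \<in> A"
proof -
  have "\<forall>x\<in>X. \<forall>y\<in>X. (\<forall>B\<in>\<A>. x \<in> B \<longleftrightarrow> y \<in> B) \<longrightarrow> (x \<in> A \<longleftrightarrow> y \<in> A)"
    using assms(1) unfolding saturated_def mem_Collect_eq by (rule conjunct2)
  moreover have "\<forall>B\<in>\<A>. x \<in> B \<longleftrightarrow> y \<in> B" using assms(4) by (rule ballI)
  ultimately show ?thesis using assms(2,3) by blast
qed

lemma saturatedI:
  assumes "A \<subseteq> X"
    "\<And>x y. x \<in> X \<Longrightarrow> y \<in> X \<Longrightarrow> (\<And>B. B \<in> \<A> \<Longrightarrow> x \<in> B \<longleftrightarrow> y \<in> B) \<Longrightarrow> x \<in> A \<Longrightarrow> y \<in> A"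
  shows "A \<in> saturated X \<A>"
  unfolding saturated_def
proof (intro CollectI conjI ballI impI)
  fix x y assume *: "x \<in> X" "y \<in> X" "\<forall>B\<in>\<A>. x \<in> B \<longleftrightarrow> y \<in> B"
  show "x \<in> A \<longleftrightarrow> y \<in> A"
  proof
    show "y \<in> A" if "x \<in> A" by (rule assms(2)[OF *(1,2) bspec[OF *(3)] that])
    show "x \<in> A" if "y \<in> A" by (rule assms(2)[OF *(2,1) bspec[OF *(3), symmetric] that])
  qed
qed (rule assms(1))

lemma saturated_subset: "A \<in> saturated X \<A> \<Longrightarrow> A \<subseteq> X"
  unfolding saturated_def mem_Collect_eq by (rule conjunct1)

lemma saturated_mono:
  assumes "\<A> \<subseteq> \<B>" shows "saturated X \<A> \<subseteq> saturated X \<B>"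
proof
  fix A assume A: "A \<in> saturated X \<A>"
  show "A \<in> saturated X \<B>"
  proof (rule saturatedI)
    show "A \<subseteq> X" by (rule saturated_subset[OF A])
    fix x y assume "x \<in> X" "y \<in> X" "\<And>B. B \<in> \<B> \<Longrightarrow> x \<in> B \<longleftrightarrow> y \<in> B" "x \<in> A"
    then show "y \<in> A" using saturatedD[OF A, of x y] assms by blast
  qed
qed

lemma saturated_idem:
  assumes "\<B> \<subseteq> saturated X \<A>" shows "saturated X \<B> \<subseteq> saturated X \<A>"
proof
  fix A assume A: "A \<in> saturated X \<B>"
  show "A \<in> saturated X \<A>"
  proof (rule saturatedI[OF saturated_subset[OF A]])
    fix x y assume xy: "x \<in> X" "y \<in> X" "\<And>B. B \<in> \<A> \<Longrightarrow> x \<in> B \<longleftrightarrow> y \<in> B" "x \<in> A"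
    have "x \<in> B \<longleftrightarrow> y \<in> B" if "B \<in> \<B>" for B
      using assms that by (intro saturatedD[of B X \<A>] xy(1-3)) auto
    then show "y \<in> A" using saturatedD[OF A xy(1,2)] xy(4) by blast
  qed
qed

lemma saturated_inc:
  assumes "A \<in> \<A>" "A \<subseteq> X" shows "A \<in> saturated X \<A>"
proof (rule saturatedI[OF assms(2)])
  fix x y assume "\<And>B. B \<in> \<A> \<Longrightarrow> x \<in> B \<longleftrightarrow> y \<in> B" "x \<in> A"
  from this(1)[OF assms(1)] this(2) show "y \<in> A" by (rule iffD1)
qed

lemma finite_saturated:
  assumes "finite \<A>" "\<A> \<subseteq> sets M"
  shows "finite (saturated (space M) \<A>)" "saturated (space M) \<A> \<subseteq> sets M"
proof -
  let ?t = "\<lambda>x. {B \<in> \<A>. x \<in> B}"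
  let ?f = "\<lambda>K. {x \<in> space M. ?t x \<in> K}"
  have rep: "A = ?f (?t ` A)" if "A \<in> saturated (space M) \<A>" for A
  proof (intro equalityI subsetI)
    fix x assume "x \<in> ?f (?t ` A)"
    then obtain y where y: "x \<in> space M" "y \<in> A" "?t x = ?t y" by auto
    then have "y \<in> B \<longleftrightarrow> x \<in> B" if "B \<in> \<A>" for B using that by blast
    then show "x \<in> A" using saturatedD[OF that _ y(1), of y] y(2) saturated_subset[OF that] by blast
  qed (use saturated_subset[OF that] in auto)
  have "saturated (space M) \<A> \<subseteq> ?f ` Pow (Pow \<A>)"
  proof
    fix A assume "A \<in> saturated (space M) \<A>"
    then have "A = ?f (?t ` A)" by (rule rep)
    moreover have "?t ` A \<in> Pow (Pow \<A>)" by auto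
    ultimately show "A \<in> ?f ` Pow (Pow \<A>)" by (rule image_eqI)
  qed
  then show "finite (saturated (space M) \<A>)" using assms(1) by (simp add: finite_subset)
  show "saturated (space M) \<A> \<subseteq> sets M"
  proof
    fix A assume A: "A \<in> saturated (space M) \<A>"
    let ?P = "{D \<in> atoms (space M) \<A>. D \<subseteq> A}"
    note at = atoms_fin_borel_partition[OF assms]
    have "A = \<Union>?P"
    proof (intro equalityI subsetI)
      fix x assume x: "x \<in> A"
      then have xs: "x \<in> space M" using saturated_subset[OF A] by auto
      let ?D = "{y \<in> space M. \<forall>A\<in>\<A>. y \<in> A \<longleftrightarrow> x \<in> A}"
      have "?D \<in> atoms (space M) \<A>" using xs by (auto simp: atoms_def)
      moreover have "?D \<subseteq> A"
      proof
        fix y assume "y \<in> ?D"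
        then show "y \<in> A" using saturatedD[OF A, of y x] x xs by auto
      qed
      moreover have "x \<in> ?D" using xs by simp
      ultimately show "x \<in> \<Union>?P" by blast
    qed auto
    moreover have "\<Union>?P \<in> sets M"
      using at by (intro sets.finite_Union) (auto simp: fin_borel_partition_def)
    ultimately show "A \<in> sets M" by simp
  qed
qed

lemma (in finite_measure) measure_sym_diff_approx:
  assumes \<D>: "\<And>A B. A \<in> \<D> \<Longrightarrow> B \<in> \<D> \<Longrightarrow> A \<union> B \<in> \<D>" "\<And>A. A \<in> \<D> \<Longrightarrow> space M - A \<in> \<D>" "{} \<in> \<D>"
    and sub: "\<D> \<subseteq> sets M" and \<U>: "\<U> \<subseteq> \<D>" and A: "A \<in> sigma_sets (space M) \<U>" and "0 < e"
  shows "\<exists>B\<in>\<D>. measure M (sym_diff A B) < e"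
  using A \<open>0 < e\<close>
proof (induction arbitrary: e)
  case (Basic A)
  then show ?case using \<U> by (intro bexI[of _ A]) auto
next
  case Empty
  then show ?case using \<D>(3) by (intro bexI[of _ "{}"]) auto
next
  case (Compl A)
  then obtain B where B: "B \<in> \<D>" "measure M (sym_diff A B) < e" by blast
  have "sigma_sets (space M) \<U> \<subseteq> sets M" using sub \<U> by (intro sets.sigma_sets_subset) auto
  then have "A \<in> sets M" "B \<in> sets M" using Compl(1) B(1) sub by auto
  then have "A \<subseteq> space M" "B \<subseteq> space M" by (auto dest: sets.sets_into_space)
  then have "sym_diff (space M - A) (space M - B) = sym_diff A B" by auto
  then show ?case using B \<D>(2) by (intro bexI[of _ "space M - B"]) auto
next
  case (Union A)
  have "sigma_sets (space M) \<U> \<subseteq> sets M" using sub \<U> by (intro sets.sigma_sets_subset) auto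
  then have As: "A i \<in> sets M" for i using Union(1) by auto
  have "(\<lambda>n. measure M (\<Union>i<n. A i)) \<longlonglongrightarrow> measure M (\<Union>n. \<Union>i<n. A i)"
    using As by (intro finite_Lim_measure_incseq) (auto simp: incseq_def, force)
  moreover have "(\<Union>n. \<Union>i<n. A i) = (\<Union>i. A i)" by auto
  ultimately have "(\<lambda>n. measure M (\<Union>i<n. A i)) \<longlonglongrightarrow> measure M (\<Union>i. A i)" by simp
  then obtain n where n: "\<bar>measure M (\<Union>i<n. A i) - measure M (\<Union>i. A i)\<bar> < e / 2"
    using Union(3) unfolding LIMSEQ_iff by (metis half_gt_zero order_refl real_norm_def)
  have "0 < e / (2 * real (Suc n))" using Union(3) by simp
  then have "\<forall>i. \<exists>B\<in>\<D>. measure M (sym_diff (A i) B) < e / (2 * real (Suc n))" using Union(2) by blast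
  then obtain B where B: "\<And>i. B i \<in> \<D>" "\<And>i. measure M (sym_diff (A i) (B i)) < e / (2 * real (Suc n))"
    by metis
  have BD: "(\<Union>i<m. B i) \<in> \<D>" for m by (induction m) (auto simp: lessThan_Suc \<D> B)
  have Bs: "B i \<in> sets M" for i using B sub by auto
  let ?R = "(\<Union>i. A i) - (\<Union>i<n. A i)"
  have "measure M ?R = measure M (\<Union>i. A i) - measure M (\<Union>i<n. A i)"
    using As by (intro finite_measure_Diff) auto
  then have R: "measure M ?R < e / 2" using n by linarith
  have "measure M (sym_diff (\<Union>i. A i) (\<Union>i<n. B i)) \<le> measure M (?R \<union> (\<Union>i<n. sym_diff (A i) (B i)))"
    using As Bs by (intro finite_measure_mono) auto
  also have "\<dots> \<le> measure M ?R + measure M (\<Union>i<n. sym_diff (A i) (B i))"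
    using As Bs by (intro measure_Un_le) auto
  also have "measure M (\<Union>i<n. sym_diff (A i) (B i)) \<le> (\<Sum>i<n. measure M (sym_diff (A i) (B i)))"
    using As Bs by (intro measure_UNION_le) auto
  also have "\<dots> \<le> (\<Sum>i<n. e / (2 * real (Suc n)))"
    using B(2) by (intro sum_mono) (simp add: less_imp_le)
  also have "\<dots> = e / 2 * (real n / real (Suc n))" by simp
  also have "\<dots> \<le> e / 2" using Union(3) by (intro mult_left_le) auto
  finally have "measure M (sym_diff (\<Union>i. A i) (\<Union>i<n. B i)) < e" using R by simp
  then show ?case using BD by blast
qed

lemma abs_card_diff_le:
  assumes "finite W" "finite S" "finite T" "sym_diff S T \<subseteq> W"
  shows "\<bar>real (card S) - real (card T)\<bar> \<le> real (card W)"
proof -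
  have "card S \<le> card (T \<union> W)" "card T \<le> card (S \<union> W)"
    using assms by (auto intro!: card_mono)
  then have "card S \<le> card T + card W" "card T \<le> card S + card W"
    using card_Un_le[of T W] card_Un_le[of S W] by linarith+
  then show ?thesis by linarith
qed

text \<open>A good model can be moved, cell by cell, off a small exceptional set outside of which the
  events of \<open>\<A>\<close> agree with approximating events from the countable family.\<close>

lemma (in pmp) countable_family_suffices:
  assumes cG: "countable (carrier G)" and P: "fin_borel_partition M P"
  obtains \<B> :: "nat \<Rightarrow> 'x set set" and F :: "nat \<Rightarrow> 'g set"
  where "\<And>m. finite (\<B> m)" "\<And>m. \<B> m \<subseteq> sets M" "\<And>m. finite (F m)" "\<And>m. F m \<subseteq> carrier G"
    "\<And>K. finite K \<Longrightarrow> K \<subseteq> carrier G \<Longrightarrow> \<exists>m0. \<forall>m\<ge>m0. K \<subseteq> F m"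
    "\<And>\<A> K \<eta>. finite \<A> \<Longrightarrow> \<A> \<subseteq> sets M \<Longrightarrow> finite K \<Longrightarrow> K \<subseteq> carrier G \<Longrightarrow> 0 < \<eta> \<Longrightarrow>
       \<exists>m0. \<forall>m\<ge>m0. \<forall>(V :: 'v set) \<sigma>. finite V \<longrightarrow> V \<noteq> {} \<longrightarrow> (\<forall>g\<in>carrier G. \<sigma> g permutes V) \<longrightarrow>
         model_labels P M \<alpha> (\<B> m) (F m) (1 / real (Suc m)) V \<sigma>
           \<subseteq> model_labels P M \<alpha> \<A> K \<eta> V \<sigma>"
proof -
  let ?X = "space M"
  have "standard_borel M" using pmp by (simp add: pmp_action_def)
  then obtain \<U> where \<U>: "countable \<U>" "sets M = sigma_sets ?X \<U>" "\<U> \<subseteq> sets M"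
    by (rule standard_borel_countably_generated)
  have P': "finite P" "P \<subseteq> sets M" using P by (auto simp: fin_borel_partition_def)
  define \<U>' where "\<U>' = insert {} (\<U> \<union> P)"
  have \<U>': "countable \<U>'" "\<U>' \<noteq> {}" "\<U>' \<subseteq> sets M"
    using \<U> P' by (auto simp: \<U>'_def countable_finite)
  define D where "D = from_nat_into \<U>'"
  have D: "D i \<in> \<U>'" "D i \<in> sets M" for i using \<U>' from_nat_into[OF \<U>'(2)] by (auto simp: D_def)
  have D_surj: "\<exists>i. D i = U" if "U \<in> \<U>'" for U
    using from_nat_into_surj[OF \<U>'(1) that] by (simp add: D_def)
  have neG: "carrier G \<noteq> {}" by auto
  define F where "F m = insert \<one>\<^bsub>G\<^esub> (from_nat_into (carrier G) ` {..<m})" for m :: nat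
  have F: "finite (F m)" "F m \<subseteq> carrier G" "\<one>\<^bsub>G\<^esub> \<in> F m" for m
    using from_nat_into[OF neG] by (auto simp: F_def)
  have F_exh: "\<exists>m0. \<forall>m\<ge>m0. K \<subseteq> F m" if "finite K" "K \<subseteq> carrier G" for K
    using that
  proof (induction K)
    case (insert g K)
    then obtain m0 where m0: "\<forall>m\<ge>m0. K \<subseteq> F m" by auto
    obtain i where i: "from_nat_into (carrier G) i = g"
      using from_nat_into_surj[OF cG, of g] insert by auto
    have "\<forall>m\<ge>max m0 (Suc i). insert g K \<subseteq> F m"
      using m0 i by (auto simp: F_def)
    then show ?case by blast
  qed simp
  define pre where "pre g A = \<alpha> g -` A \<inter> ?X" for g A
  have pre: "pre g A \<in> sets M" if "g \<in> carrier G" "A \<in> sets M" for g A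
    unfolding pre_def using that by (rule vimage_sets)
  define \<G> where "\<G> m = (\<lambda>(g, i). pre g (D i)) ` (F m \<times> {..<m})" for m
  have \<G>: "finite (\<G> m)" "\<G> m \<subseteq> sets M" for m
    using F[of m] D pre by (auto simp: \<G>_def)
  define \<B> where "\<B> m = saturated ?X (\<G> m)" for m
  have \<B>: "finite (\<B> m)" "\<B> m \<subseteq> sets M" for m
    unfolding \<B>_def using finite_saturated[OF \<G>] by auto
  define \<D> where "\<D> = (\<Union>m. saturated ?X (D ` {..<m}))"
  have D_fin: "finite (D ` {..<m})" "D ` {..<m} \<subseteq> sets M" for m using D by auto
  have sat_mono: "saturated ?X (D ` {..<m}) \<subseteq> saturated ?X (D ` {..<n})" if "m \<le> n" for m n
    using that by (intro saturated_mono image_mono) auto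
  have \<D>_sets: "\<D> \<subseteq> sets M" using finite_saturated(2)[OF D_fin] by (auto simp: \<D>_def)
  have \<D>_Un: "A \<union> B \<in> \<D>" if AB: "A \<in> \<D>" "B \<in> \<D>" for A B
  proof -
    obtain m n where "A \<in> saturated ?X (D ` {..<m})" "B \<in> saturated ?X (D ` {..<n})"
      using AB by (auto simp: \<D>_def)
    then have *: "A \<in> saturated ?X (D ` {..<max m n})" "B \<in> saturated ?X (D ` {..<max m n})"
      using sat_mono[of m "max m n"] sat_mono[of n "max m n"] by auto
    have "A \<union> B \<in> saturated ?X (D ` {..<max m n})"
    proof (rule saturatedI)
      show "A \<union> B \<subseteq> ?X" using saturated_subset[OF *(1)] saturated_subset[OF *(2)] by simp
      fix x y assume xy: "x \<in> ?X" "y \<in> ?X" "\<And>E. E \<in> D ` {..<max m n} \<Longrightarrow> x \<in> E \<longleftrightarrow> y \<in> E" "x \<in> A \<union> B"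
      show "y \<in> A \<union> B"
        using saturatedD[OF *(1) xy(1-3)] saturatedD[OF *(2) xy(1-3)] xy(4) by blast
    qed
    then show ?thesis by (auto simp: \<D>_def)
  qed
  have \<D>_Compl: "?X - A \<in> \<D>" if A: "A \<in> \<D>" for A
  proof -
    obtain m where *: "A \<in> saturated ?X (D ` {..<m})" using A by (auto simp: \<D>_def)
    have "?X - A \<in> saturated ?X (D ` {..<m})"
    proof (rule saturatedI)
      fix x y assume xy: "x \<in> ?X" "y \<in> ?X" "\<And>E. E \<in> D ` {..<m} \<Longrightarrow> x \<in> E \<longleftrightarrow> y \<in> E" "x \<in> ?X - A"
      show "y \<in> ?X - A" using saturatedD[OF * xy(1-3)] xy(2,4) by blast
    qed auto
    then show ?thesis by (auto simp: \<D>_def)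
  qed
  have \<U>'_\<D>: "\<U>' \<subseteq> \<D>"
  proof
    fix U assume U: "U \<in> \<U>'"
    then obtain i where "D i = U" using D_surj by auto
    then have "U \<in> saturated ?X (D ` {..<Suc i})"
      using D(2)[of i] sets.sets_into_space by (intro saturated_inc) auto
    then show "U \<in> \<D>" unfolding \<D>_def by blast
  qed
  have dense: "\<exists>B\<in>\<D>. measure M (sym_diff A B) < e" if "A \<in> sets M" "0 < e" for A e
  proof (rule measure_sym_diff_approx[OF \<D>_Un \<D>_Compl _ \<D>_sets])
    show "\<U> \<subseteq> \<D>" "{} \<in> \<D>" using \<U>'_\<D> by (auto simp: \<U>'_def)
    show "A \<in> sigma_sets ?X \<U>" "0 < e" using that \<U> by auto
  qed
  have pre_\<B>: "pre g A \<in> \<B> n" if A: "A \<in> saturated ?X (D ` {..<m})" "m \<le> n" and g: "g \<in> F n" for A m n g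
    unfolding \<B>_def
  proof (rule saturatedI)
    show "pre g A \<subseteq> ?X" by (auto simp: pre_def)
    fix x y assume xy: "x \<in> ?X" "y \<in> ?X" "\<And>E. E \<in> \<G> n \<Longrightarrow> x \<in> E \<longleftrightarrow> y \<in> E" "x \<in> pre g A"
    have sp: "\<alpha> g x \<in> ?X" "\<alpha> g y \<in> ?X" using xy(1,2) g F(2) by (auto intro!: act_closed)
    have "\<alpha> g x \<in> E \<longleftrightarrow> \<alpha> g y \<in> E" if "E \<in> D ` {..<m}" for E
    proof -
      obtain i where "i < m" "E = D i" using \<open>E \<in> D ` {..<m}\<close> by auto
      then have "pre g E \<in> \<G> n" using A(2) g by (auto simp: \<G>_def)
      then show ?thesis using xy(1,2) xy(3)[of "pre g E"] by (auto simp: pre_def)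
    qed
    then have "\<alpha> g x \<in> A \<longleftrightarrow> \<alpha> g y \<in> A" by (rule saturatedD[OF A(1) sp])
    then show "y \<in> pre g A" using xy(2,4) by (auto simp: pre_def)
  qed
  have \<D>_\<B>: "A \<in> \<B> n" if A: "A \<in> saturated ?X (D ` {..<m})" "m \<le> n" for A m n
  proof -
    have "pre \<one>\<^bsub>G\<^esub> A = A" using saturated_subset[OF A(1)] act_one by (auto simp: pre_def)
    then show ?thesis using pre_\<B>[OF A F(3)] by simp
  qed
  show thesis
  proof (rule that[of \<B> F, OF \<B> F(1,2) F_exh])
    fix \<A> K and \<eta> :: real
    assume \<A>: "finite \<A>" "\<A> \<subseteq> sets M" and K: "finite K" "K \<subseteq> carrier G" and \<eta>: "0 < \<eta>"
    define c where "c = 1 + real (card \<A>) * (1 + real (card K))"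
    have c: "1 \<le> c" by (simp add: c_def)
    define \<zeta> where "\<zeta> = \<eta> / (4 * c)"
    have \<zeta>: "0 < \<zeta>" "c * \<zeta> = \<eta> / 4" "\<zeta> \<le> \<eta> / 4"
    proof -
      show "0 < \<zeta>" "c * \<zeta> = \<eta> / 4" using c \<eta> by (auto simp: \<zeta>_def)
      then show "\<zeta> \<le> \<eta> / 4" using c by (metis less_imp_le mult_le_cancel_right1 not_less)
    qed
    have "\<forall>A\<in>\<A>. \<exists>B\<in>\<D>. measure M (sym_diff A B) < \<zeta>" using dense \<A> \<zeta> by auto
    then obtain ap where ap: "\<And>A. A \<in> \<A> \<Longrightarrow> ap A \<in> \<D>" "\<And>A. A \<in> \<A> \<Longrightarrow> measure M (sym_diff A (ap A)) < \<zeta>"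
      by metis
    have ap_sets: "ap A \<in> sets M" if "A \<in> \<A>" for A using ap(1)[OF that] \<D>_sets by auto
    have "\<exists>m1. ap ` \<A> \<union> P \<subseteq> saturated ?X (D ` {..<m1})"
    proof -
      have "\<exists>m1. \<Q> \<subseteq> saturated ?X (D ` {..<m1})" if "finite \<Q>" "\<Q> \<subseteq> \<D>" for \<Q>
        using that
      proof (induction \<Q>)
        case (insert A \<Q>)
        then obtain m n where "\<Q> \<subseteq> saturated ?X (D ` {..<m})" "A \<in> saturated ?X (D ` {..<n})"
          by (auto simp: \<D>_def)
        then have "insert A \<Q> \<subseteq> saturated ?X (D ` {..<max m n})"
          using sat_mono[of m "max m n"] sat_mono[of n "max m n"] by auto
        then show ?case by blast
      qed simp
      moreover have "ap ` \<A> \<union> P \<subseteq> \<D>" using ap(1) \<U>'_\<D> by (auto simp: \<U>'_def)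
      moreover have "finite (ap ` \<A> \<union> P)" using \<A>(1) P'(1) by simp
      ultimately show ?thesis by blast
    qed
    then obtain m1 where m1: "\<And>A. A \<in> \<A> \<Longrightarrow> ap A \<in> saturated ?X (D ` {..<m1})"
      "P \<subseteq> saturated ?X (D ` {..<m1})" by auto
    obtain m2 where m2: "\<forall>m\<ge>m2. K \<subseteq> F m" using F_exh[OF K] by auto
    obtain m3 where m3: "1 / real (Suc m3) < \<eta> / 12"
      using \<eta> nat_approx_posE[of "\<eta> / 12"] by (metis divide_pos_pos zero_less_numeral)
    define Ex where "Ex A = sym_diff A (ap A) \<union> (\<Union>g\<in>K. pre g (sym_diff A (ap A)))" for A
    define E where "E = (\<Union>A\<in>\<A>. Ex A)"
    have sd: "sym_diff A (ap A) \<in> sets M" if "A \<in> \<A>" for A using that \<A> ap_sets by auto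
    have Ex: "Ex A \<in> sets M" "measure M (Ex A) \<le> (1 + real (card K)) * \<zeta>" if A: "A \<in> \<A>" for A
    proof -
      have pr: "pre g (sym_diff A (ap A)) \<in> sets M" if "g \<in> K" for g
        using pre[OF _ sd[OF A]] that K by auto
      then show "Ex A \<in> sets M" using sd[OF A] K(1) by (auto simp: Ex_def)
      have "measure M (Ex A) \<le> measure M (sym_diff A (ap A)) + measure M (\<Union>g\<in>K. pre g (sym_diff A (ap A)))"
        unfolding Ex_def using sd[OF A] pr K(1) by (intro measure_Un_le) auto
      also have "measure M (\<Union>g\<in>K. pre g (sym_diff A (ap A))) \<le> (\<Sum>g\<in>K. measure M (pre g (sym_diff A (ap A))))"
        using pr K(1) by (intro measure_UNION_le) auto
      also have "\<dots> = (\<Sum>g\<in>K. measure M (sym_diff A (ap A)))"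
      proof (rule sum.cong[OF refl])
        fix g assume "g \<in> K"
        then have "g \<in> carrier G" using K(2) by auto
        then show "measure M (pre g (sym_diff A (ap A))) = measure M (sym_diff A (ap A))"
          unfolding pre_def by (rule measure_vimage[OF _ sd[OF A]])
      qed
      also have "\<dots> \<le> (\<Sum>g\<in>K. \<zeta>)" using ap(2)[OF A] by (intro sum_mono) simp
      finally show "measure M (Ex A) \<le> (1 + real (card K)) * \<zeta>"
        using ap(2)[OF A] by (simp add: algebra_simps)
    qed
    have E: "E \<in> sets M" "measure M E \<le> \<eta> / 4"
    proof -
      show "E \<in> sets M" using Ex(1) \<A>(1) by (auto simp: E_def)
      have "measure M E \<le> (\<Sum>A\<in>\<A>. measure M (Ex A))"
        unfolding E_def using Ex(1) \<A>(1) by (intro measure_UNION_le) auto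
      also have "\<dots> \<le> (\<Sum>A\<in>\<A>. (1 + real (card K)) * \<zeta>)" using Ex(2) by (intro sum_mono)
      also have "\<dots> \<le> c * \<zeta>" using \<zeta>(1) by (simp add: c_def algebra_simps)
      finally show "measure M E \<le> \<eta> / 4" using \<zeta>(2) by simp
    qed
    define \<B>0 where "\<B>0 = ap ` \<A> \<union> (\<Union>g\<in>K. (\<lambda>A. pre g (ap A)) ` \<A>) \<union> P"
    define cell where "cell x = {y \<in> ?X. \<forall>B\<in>\<B>0. y \<in> B \<longleftrightarrow> x \<in> B}" for x
    define Z where "Z = {x \<in> ?X. cell x \<subseteq> E}"
    have Z_sat: "Z \<in> saturated ?X \<B>0"
    proof (rule saturatedI)
      fix x y assume xy: "x \<in> ?X" "y \<in> ?X" "\<And>B. B \<in> \<B>0 \<Longrightarrow> x \<in> B \<longleftrightarrow> y \<in> B" "x \<in> Z"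
      have "cell y = cell x" using xy(3) by (simp add: cell_def)
      then show "y \<in> Z" using xy(2,4) by (simp add: Z_def)
    qed (auto simp: Z_def)
    have Z_E: "Z \<subseteq> E" by (auto simp: Z_def cell_def)
    show "\<exists>m0. \<forall>m\<ge>m0. \<forall>(V :: 'v set) \<sigma>. finite V \<longrightarrow> V \<noteq> {} \<longrightarrow> (\<forall>g\<in>carrier G. \<sigma> g permutes V) \<longrightarrow>
         model_labels P M \<alpha> (\<B> m) (F m) (1 / real (Suc m)) V \<sigma>
           \<subseteq> model_labels P M \<alpha> \<A> K \<eta> V \<sigma>"
    proof (intro exI[of _ "max m1 (max m2 m3)"] allI impI, rule image_subsetI)
      fix m and V :: "'v set" and \<sigma> q
      assume m: "max m1 (max m2 m3) \<le> m" and V: "finite V" "V \<noteq> {}"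
        and \<sigma>: "\<forall>g\<in>carrier G. \<sigma> g permutes V"
        and "q \<in> {p. approx_model M \<alpha> (\<B> m) (F m) (1 / real (Suc m)) V \<sigma> p}"
      then have q: "approx_model M \<alpha> (\<B> m) (F m) (1 / real (Suc m)) V \<sigma> q" by simp
      have n: "0 < real (card V)" using V by (simp add: card_gt_0_iff)
      define \<xi> where "\<xi> = 1 / real (Suc m)"
      have \<xi>: "\<xi> < \<eta> / 12"
      proof -
        have "\<xi> \<le> 1 / real (Suc m3)" unfolding \<xi>_def using m by (intro divide_left_mono) auto
        then show ?thesis using m3 by simp
      qed
      have KF: "K \<subseteq> F m" using m2 m by auto
      have \<B>0: "\<B>0 \<subseteq> \<B> m"
      proof -
        have "ap A \<in> \<B> m" "pre g (ap A) \<in> \<B> m" if "A \<in> \<A>" "g \<in> K" for A g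
          using \<D>_\<B>[OF m1(1)[OF that(1)]] pre_\<B>[OF m1(1)[OF that(1)]] m KF that by auto
        moreover have "ap A \<in> \<B> m" if "A \<in> \<A>" for A using \<D>_\<B>[OF m1(1)[OF that]] m by auto
        moreover have "A \<in> \<B> m" if "A \<in> P" for A using \<D>_\<B>[of A m1 m] m1(2) m that by auto
        ultimately show ?thesis by (auto simp: \<B>0_def)
      qed
      have "Z \<in> \<B> m" using saturated_idem[of \<B>0 ?X "\<G> m"] \<B>0 Z_sat by (auto simp: \<B>_def)
      then have Z: "Z \<in> sets M" "\<bar>real (card {v \<in> V. q v \<in> Z}) / real (card V) - measure M Z\<bar> \<le> \<xi>"
        using \<B>(2) q by (auto simp: approx_model_def \<xi>_def)
      have "measure M Z \<le> \<eta> / 4" using finite_measure_mono[OF Z_E E(1)] E(2) by simp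
      then have "real (card {v \<in> V. q v \<in> Z}) / real (card V) \<le> \<eta> / 4 + \<xi>" using Z(2) by linarith
      then have Z_card: "real (card {v \<in> V. q v \<in> Z}) \<le> (\<eta> / 4 + \<xi>) * real (card V)"
        using n by (simp add: divide_le_eq)
      have qV: "q v \<in> ?X" if "v \<in> V" for v using q that by (auto simp: approx_model_def)
      define q' where "q' v = (if cell (q v) \<subseteq> E then q v else SOME y. y \<in> cell (q v) - E)" for v
      have q'1: "q' v \<in> cell (q v)" if "v \<in> V" for v
      proof (cases "cell (q v) \<subseteq> E")
        case True
        then show ?thesis using qV[OF that] by (simp add: q'_def cell_def)
      next
        case False
        then have "\<exists>y. y \<in> cell (q v) - E" by auto
        then have "(SOME y. y \<in> cell (q v) - E) \<in> cell (q v) - E" by (rule someI_ex)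
        then show ?thesis using False by (simp add: q'_def)
      qed
      have q'2: "q' v \<notin> E" if "v \<in> V" "q v \<notin> Z" for v
      proof -
        have False: "\<not> cell (q v) \<subseteq> E" using that qV by (auto simp: Z_def)
        then have "\<exists>y. y \<in> cell (q v) - E" by auto
        then have "(SOME y. y \<in> cell (q v) - E) \<in> cell (q v) - E" by (rule someI_ex)
        then show ?thesis using False by (simp add: q'_def)
      qed
      have q'X: "q' v \<in> ?X" if "v \<in> V" for v using q'1[OF that] by (simp add: cell_def)
      have q'B: "q' v \<in> B \<longleftrightarrow> q v \<in> B" if "v \<in> V" "B \<in> \<B>0" for v B
        using q'1[OF that(1)] that(2) by (simp add: cell_def)
      have off: "q' v \<in> A \<longleftrightarrow> q v \<in> ap A" if v: "v \<in> V" "q v \<notin> Z" and A: "A \<in> \<A>" for v A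
      proof -
        have "q' v \<notin> sym_diff A (ap A)" using q'2[OF v] A by (auto simp: E_def Ex_def)
        then have "q' v \<in> A \<longleftrightarrow> q' v \<in> ap A" by blast
        also have "\<dots> \<longleftrightarrow> q v \<in> ap A" using v(1) A by (intro q'B) (auto simp: \<B>0_def)
        finally show ?thesis .
      qed
      have "approx_model M \<alpha> \<A> K \<eta> V \<sigma> q'"
        unfolding approx_model_def
      proof (intro conjI ballI)
        show "q' \<in> V \<rightarrow> ?X" using q'X by auto
      next
        fix A assume A: "A \<in> \<A>"
        have "\<bar>real (card {v \<in> V. q' v \<in> A}) - real (card {v \<in> V. q v \<in> ap A})\<bar> \<le> real (card {v \<in> V. q v \<in> Z})"
          using V(1) off[OF _ _ A] by (intro abs_card_diff_le) auto
        then have "\<bar>real (card {v \<in> V. q' v \<in> A}) / real (card V) - real (card {v \<in> V. q v \<in> ap A}) / real (card V)\<bar>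
            \<le> real (card {v \<in> V. q v \<in> Z}) / real (card V)"
          using n by (simp add: divide_right_mono flip: diff_divide_distrib)
        also have "\<dots> \<le> \<eta> / 4 + \<xi>" using Z_card n by (simp add: divide_le_eq)
        finally have 1: "\<bar>real (card {v \<in> V. q' v \<in> A}) / real (card V) - real (card {v \<in> V. q v \<in> ap A}) / real (card V)\<bar>
            \<le> \<eta> / 4 + \<xi>" .
        have "ap A \<in> \<B> m" using \<B>0 A by (auto simp: \<B>0_def)
        then have 2: "\<bar>real (card {v \<in> V. q v \<in> ap A}) / real (card V) - measure M (ap A)\<bar> \<le> \<xi>"
          using q by (auto simp: approx_model_def \<xi>_def)
        have As: "A \<in> sets M" using A \<A> by auto
        have "measure M (ap A) \<le> measure M (A \<union> sym_diff A (ap A))"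
          using As sd[OF A] by (intro finite_measure_mono) auto
        also have "\<dots> \<le> measure M A + measure M (sym_diff A (ap A))"
          using As sd[OF A] by (intro measure_Un_le)
        finally have 3: "measure M (ap A) \<le> measure M A + \<zeta>" using ap(2)[OF A] by simp
        have "measure M A \<le> measure M (ap A \<union> sym_diff A (ap A))"
          using ap_sets[OF A] sd[OF A] by (intro finite_measure_mono) auto
        also have "\<dots> \<le> measure M (ap A) + measure M (sym_diff A (ap A))"
          using ap_sets[OF A] sd[OF A] by (intro measure_Un_le)
        finally have 4: "measure M A \<le> measure M (ap A) + \<zeta>" using ap(2)[OF A] by simp
        show "\<bar>real (card {v \<in> V. q' v \<in> A}) / real (card V) - measure M A\<bar> \<le> \<eta>"
          using 1 2 3 4 \<xi> \<zeta>(3) \<eta> by linarith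
      next
        fix A g assume A: "A \<in> \<A>" and g: "g \<in> K"
        have gG: "g \<in> carrier G" using g K by auto
        have perm: "\<sigma> g permutes V" using \<sigma> gG by auto
        let ?M = "{v \<in> V. (q (\<sigma> g v) \<in> ap A) \<noteq> (\<alpha> g (q v) \<in> ap A)}"
        let ?Z = "{v \<in> V. q v \<in> Z}" and ?Z' = "{v \<in> V. \<sigma> g v \<in> {v. q v \<in> Z}}"
        have "{v \<in> V. (q' (\<sigma> g v) \<in> A) \<noteq> (\<alpha> g (q' v) \<in> A)} \<subseteq> ?M \<union> (?Z \<union> ?Z')"
        proof (rule subsetI, rule ccontr)
          fix v assume v: "v \<in> {v \<in> V. (q' (\<sigma> g v) \<in> A) \<noteq> (\<alpha> g (q' v) \<in> A)}"
            and nv: "v \<notin> ?M \<union> (?Z \<union> ?Z')"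
          have vV: "v \<in> V" "\<sigma> g v \<in> V" using v permutes_in_image[OF perm] by auto
          have nz: "q v \<notin> Z" "q (\<sigma> g v) \<notin> Z" using nv vV by auto
          have "q' (\<sigma> g v) \<in> A \<longleftrightarrow> q (\<sigma> g v) \<in> ap A" by (rule off[OF vV(2) nz(2) A])
          also have "\<dots> \<longleftrightarrow> \<alpha> g (q v) \<in> ap A" using nv vV by auto
          also have "\<dots> \<longleftrightarrow> q v \<in> pre g (ap A)" using qV[OF vV(1)] by (simp add: pre_def)
          also have "\<dots> \<longleftrightarrow> q' v \<in> pre g (ap A)"
            using A g by (intro q'B[symmetric] vV) (auto simp: \<B>0_def)
          also have "\<dots> \<longleftrightarrow> \<alpha> g (q' v) \<in> ap A" using q'X[OF vV(1)] by (simp add: pre_def)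
          also have "\<dots> \<longleftrightarrow> \<alpha> g (q' v) \<in> A"
          proof -
            have "q' v \<notin> pre g (sym_diff A (ap A))"
              using q'2[OF vV(1) nz(1)] A g by (auto simp: E_def Ex_def)
            then show ?thesis using q'X[OF vV(1)] by (auto simp: pre_def)
          qed
          finally show False using v by auto
        qed
        then have "card {v \<in> V. (q' (\<sigma> g v) \<in> A) \<noteq> (\<alpha> g (q' v) \<in> A)} \<le> card (?M \<union> (?Z \<union> ?Z'))"
          using V(1) by (intro card_mono) auto
        also have "\<dots> \<le> card ?M + (card ?Z + card ?Z')"
          using card_Un_le[of ?M "?Z \<union> ?Z'"] card_Un_le[of ?Z ?Z'] by linarith
        also have "card ?Z' = card ?Z"
          using card_permutes_preimage[OF perm, of "{v. q v \<in> Z}"] by (simp add: Int_def)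
        finally have "real (card {v \<in> V. (q' (\<sigma> g v) \<in> A) \<noteq> (\<alpha> g (q' v) \<in> A)})
            \<le> real (card ?M) + 2 * real (card ?Z)" by linarith
        moreover have "real (card ?M) \<le> \<xi> * real (card V)"
        proof -
          have "ap A \<in> \<B> m" "g \<in> F m" using \<B>0 A g KF by (auto simp: \<B>0_def)
          then show ?thesis using q unfolding approx_model_def \<xi>_def by blast
        qed
        moreover have "\<xi> * real (card V) + 2 * ((\<eta> / 4 + \<xi>) * real (card V)) = (\<eta> / 2 + 3 * \<xi>) * real (card V)"
          by (simp add: algebra_simps)
        moreover have "(\<eta> / 2 + 3 * \<xi>) * real (card V) \<le> \<eta> * real (card V)"
          using \<xi> \<eta> by (intro mult_right_mono) auto
        ultimately show "real (card {v \<in> V. (q' (\<sigma> g v) \<in> A) \<noteq> (\<alpha> g (q' v) \<in> A)}) \<le> \<eta> * real (card V)"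
          using Z_card by linarith
      qed
      moreover have "labelling V P q = labelling V P q'"
        unfolding labelling_def
      proof (rule restrict_ext)
        fix A assume "A \<in> P"
        then show "{v \<in> V. q v \<in> A} = {v \<in> V. q' v \<in> A}" using q'B[of _ A] by (auto simp: \<B>0_def)
      qed
      ultimately show "labelling V P q \<in> model_labels P M \<alpha> \<A> K \<eta> V \<sigma>" by blast
    qed
  qed
qed

section \<open>Bounded orbit equivalences\<close>

locale bounded_oe = A: pmp G M \<alpha> + B: pmp H N \<beta>
  for G :: "('g, 'r) monoid_scheme" and M :: "'x measure" and \<alpha>
    and H :: "('h, 's) monoid_scheme" and N :: "'y measure" and \<beta> +
  fixes X0 :: "'x set" and Y0 :: "'y set" and \<Psi> :: "'x \<Rightarrow> 'y" and \<kappa> :: "'g \<Rightarrow> 'x \<Rightarrow> 'h"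
    and lam :: "'h \<Rightarrow> 'y \<Rightarrow> 'g"
  assumes free_G: "free_action G M \<alpha>" and free_H: "free_action H N \<beta>"
    and oe: "orbit_equivalence G M \<alpha> H N \<beta> X0 Y0 \<Psi>"
    and \<kappa>: "orbit_cocycle G M \<alpha> H \<beta> X0 \<Psi> \<kappa>"
    and lam: "orbit_cocycle H N \<beta> G \<alpha> Y0 (inv_into X0 \<Psi>) lam"
    and fin_\<kappa>: "g \<in> carrier G \<Longrightarrow> finite (\<kappa> g ` X0)"
    and fin_lam: "t \<in> carrier H \<Longrightarrow> finite (lam t ` Y0)"
begin

lemma X0_sets [measurable]: "X0 \<in> sets M" and Y0_sets [measurable]: "Y0 \<in> sets N"
  using oe by (auto simp: orbit_equivalence_def invariant_conull_def)

lemma X0_conull: "AE x in M. x \<in> X0" and Y0_conull: "AE y in N. y \<in> Y0"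
  using oe by (auto simp: orbit_equivalence_def invariant_conull_def)

lemma X0_space: "X0 \<subseteq> space M" and Y0_space: "Y0 \<subseteq> space N"
  using sets.sets_into_space[OF X0_sets] sets.sets_into_space[OF Y0_sets] .

lemma X0_act: "g \<in> carrier G \<Longrightarrow> x \<in> X0 \<Longrightarrow> \<alpha> g x \<in> X0"
  and Y0_act: "t \<in> carrier H \<Longrightarrow> y \<in> Y0 \<Longrightarrow> \<beta> t y \<in> Y0"
  using oe unfolding orbit_equivalence_def invariant_conull_def by (simp_all add: image_subset_iff)

lemma space_X0: "space (restrict_space M X0) = X0" and space_Y0: "space (restrict_space N Y0) = Y0"
  using X0_space Y0_space by (auto simp: space_restrict_space)

lemma iso: "measure_isomorphism (restrict_space M X0) (restrict_space N Y0) \<Psi>"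
  using oe by (simp add: orbit_equivalence_def)

lemma \<Psi>_bij: "bij_betw \<Psi> X0 Y0"
  using iso by (simp add: measure_isomorphism_def space_X0 space_Y0)

lemma \<Psi>_Y0: "x \<in> X0 \<Longrightarrow> \<Psi> x \<in> Y0"
  using \<Psi>_bij by (auto simp: bij_betw_def)

lemma \<Psi>_inj: "x \<in> X0 \<Longrightarrow> x' \<in> X0 \<Longrightarrow> \<Psi> x = \<Psi> x' \<Longrightarrow> x = x'"
  using \<Psi>_bij by (auto simp: bij_betw_def inj_on_def)

lemma inv_\<Psi>: "x \<in> X0 \<Longrightarrow> inv_into X0 \<Psi> (\<Psi> x) = x"
  using \<Psi>_bij by (auto simp: bij_betw_def)

lemma \<Psi>_measurable: "\<Psi> \<in> measurable (restrict_space M X0) (restrict_space N Y0)"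
  and inv_measurable: "inv_into X0 \<Psi> \<in> measurable (restrict_space N Y0) (restrict_space M X0)"
  and \<Psi>_distr: "distr (restrict_space M X0) (restrict_space N Y0) \<Psi> = restrict_space N Y0"
  using iso by (auto simp: measure_isomorphism_def space_X0)

lemma sets_X0_iff: "A \<in> sets (restrict_space M X0) \<longleftrightarrow> A \<subseteq> X0 \<and> A \<in> sets M"
  by (rule sets_restrict_space_iff) (use X0_space in \<open>simp add: Int_absorb2\<close>)

lemma sets_Y0_iff: "A \<in> sets (restrict_space N Y0) \<longleftrightarrow> A \<subseteq> Y0 \<and> A \<in> sets N"
  by (rule sets_restrict_space_iff) (use Y0_space in \<open>simp add: Int_absorb2\<close>)

lemma \<kappa>_closed: "g \<in> carrier G \<Longrightarrow> x \<in> X0 \<Longrightarrow> \<kappa> g x \<in> carrier H"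
  using \<kappa> measurable_space[of "\<kappa> g" "restrict_space M X0" "count_space (carrier H)"]
  by (auto simp: orbit_cocycle_def space_X0)

lemma lam_closed: "t \<in> carrier H \<Longrightarrow> y \<in> Y0 \<Longrightarrow> lam t y \<in> carrier G"
  using lam measurable_space[of "lam t" "restrict_space N Y0" "count_space (carrier G)"]
  by (auto simp: orbit_cocycle_def space_Y0)

lemma \<kappa>_eq: "g \<in> carrier G \<Longrightarrow> x \<in> X0 \<Longrightarrow> \<Psi> (\<alpha> g x) = \<beta> (\<kappa> g x) (\<Psi> x)"
  using \<kappa> by (simp add: orbit_cocycle_def)

lemma lam_eq: "t \<in> carrier H \<Longrightarrow> y \<in> Y0 \<Longrightarrow>
    inv_into X0 \<Psi> (\<beta> t y) = \<alpha> (lam t y) (inv_into X0 \<Psi> y)"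
  using lam by (simp add: orbit_cocycle_def)

lemma \<kappa>_level_sets: "g \<in> carrier G \<Longrightarrow> h \<in> carrier H \<Longrightarrow> {x \<in> X0. \<kappa> g x = h} \<in> sets M"
proof -
  assume g: "g \<in> carrier G" and h: "h \<in> carrier H"
  have "\<kappa> g -` {h} \<inter> space (restrict_space M X0) \<in> sets (restrict_space M X0)"
    using \<kappa> g h by (intro measurable_sets[of _ _ "count_space (carrier H)"]) (auto simp: orbit_cocycle_def)
  moreover have "\<kappa> g -` {h} \<inter> space (restrict_space M X0) = {x \<in> X0. \<kappa> g x = h}"
    using space_X0 by auto
  ultimately show ?thesis by (simp add: sets_X0_iff)
qed

lemma transported_sets:
  assumes "A \<in> sets M"
  shows "{y \<in> Y0. inv_into X0 \<Psi> y \<in> A} \<in> sets N"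
proof -
  have "A \<inter> X0 \<in> sets (restrict_space M X0)" using assms by (simp add: sets_X0_iff)
  from measurable_sets[OF inv_measurable this]
  have "inv_into X0 \<Psi> -` (A \<inter> X0) \<inter> Y0 \<in> sets N" by (simp add: space_Y0 sets_Y0_iff)
  also have "inv_into X0 \<Psi> -` (A \<inter> X0) \<inter> Y0 = {y \<in> Y0. inv_into X0 \<Psi> y \<in> A}"
    using \<Psi>_bij by (auto simp: bij_betw_def inv_into_into)
  finally show ?thesis .
qed

lemma Y0_nonempty: "Y0 \<noteq> {}"
proof
  assume "Y0 = {}"
  then have "AE y in N. False" using Y0_conull by simp
  then show False by (simp add: B.AE_False)
qed

definition \<Phi> :: "'x \<Rightarrow> 'y" where
  "\<Phi> x = (if x \<in> X0 then \<Psi> x else (SOME y. y \<in> Y0))"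

definition \<kappa>' :: "'g \<Rightarrow> 'x \<Rightarrow> 'h" where
  "\<kappa>' g x = (if x \<in> X0 then \<kappa> g x else \<one>\<^bsub>H\<^esub>)"

lemma \<Phi>_Y0: "\<Phi> x \<in> Y0"
  using \<Psi>_Y0 Y0_nonempty by (auto simp: \<Phi>_def some_in_eq)

lemma \<kappa>'_closed: "g \<in> carrier G \<Longrightarrow> \<kappa>' g x \<in> carrier H"
  using \<kappa>_closed by (simp add: \<kappa>'_def)

lemma fin_\<kappa>': "g \<in> carrier G \<Longrightarrow> finite (range (\<kappa>' g))"
proof (rule finite_subset)
  show "range (\<kappa>' g) \<subseteq> insert \<one>\<^bsub>H\<^esub> (\<kappa> g ` X0)" by (auto simp: \<kappa>'_def)
  show "g \<in> carrier G \<Longrightarrow> finite (insert \<one>\<^bsub>H\<^esub> (\<kappa> g ` X0))" using fin_\<kappa> by simp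
qed

lemma \<Phi>_vimage:
  assumes "C \<in> sets N"
  shows "\<Phi> -` C \<inter> space M \<in> sets M" "measure M (\<Phi> -` C \<inter> space M) = measure N C"
proof -
  have C: "C \<inter> Y0 \<in> sets (restrict_space N Y0)" using assms by (simp add: sets_Y0_iff)
  from measurable_sets[OF \<Psi>_measurable this]
  have S: "\<Psi> -` (C \<inter> Y0) \<inter> X0 \<in> sets (restrict_space M X0)" by (simp add: space_X0)
  then have S': "\<Psi> -` (C \<inter> Y0) \<inter> X0 \<in> sets M" by (simp add: sets_X0_iff)
  have eq: "\<Phi> -` C \<inter> space M = (\<Psi> -` (C \<inter> Y0) \<inter> X0) \<union> (if (SOME y. y \<in> Y0) \<in> C then space M - X0 else {})"
    using X0_space \<Psi>_Y0 by (auto simp: \<Phi>_def split: if_splits)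
  show sets: "\<Phi> -` C \<inter> space M \<in> sets M" unfolding eq using S' by auto
  have "measure N C = measure N (C \<inter> Y0)"
    using assms Y0_conull by (intro measure_eq_AE) auto
  also have "\<dots> = measure (restrict_space N Y0) (C \<inter> Y0)"
    using Y0_space by (intro measure_restrict_space[symmetric]) auto
  also have "\<dots> = measure (distr (restrict_space M X0) (restrict_space N Y0) \<Psi>) (C \<inter> Y0)"
    by (simp add: \<Psi>_distr)
  also have "\<dots> = measure (restrict_space M X0) (\<Psi> -` (C \<inter> Y0) \<inter> X0)"
    using measure_distr[OF \<Psi>_measurable C] by (simp add: space_X0)
  also have "\<dots> = measure M (\<Psi> -` (C \<inter> Y0) \<inter> X0)"
    using X0_space by (intro measure_restrict_space) auto
  also have "\<dots> = measure M (\<Phi> -` C \<inter> space M)"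
  proof (rule measure_eq_AE[OF _ S' sets])
    show "AE x in M. x \<in> \<Psi> -` (C \<inter> Y0) \<inter> X0 \<longleftrightarrow> x \<in> \<Phi> -` C \<inter> space M"
      using X0_conull by eventually_elim (use X0_space \<Psi>_Y0 in \<open>auto simp: \<Phi>_def split: if_splits\<close>)
  qed
  finally show "measure M (\<Phi> -` C \<inter> space M) = measure N C" ..
qed

abbreviation label_events :: "'x set set \<Rightarrow> 'g set \<Rightarrow> 'h set \<Rightarrow> 'y set set" where
  "label_events P S L \<equiv> (\<lambda>A. {y \<in> Y0. inv_into X0 \<Psi> y \<in> A}) ` P \<union>
     (\<lambda>(g, h). {y \<in> Y0. \<kappa> g (inv_into X0 \<Psi> y) = h}) ` (S \<times> L)"

definition free_at :: "'x \<Rightarrow> bool" where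
  "free_at x \<longleftrightarrow> x \<in> X0 \<and> (\<forall>s\<in>carrier G - {\<one>\<^bsub>G\<^esub>}. \<alpha> s x \<noteq> x) \<and> (\<forall>t\<in>carrier H - {\<one>\<^bsub>H\<^esub>}. \<beta> t (\<Psi> x) \<noteq> \<Psi> x)"

lemma free_at_conull:
  obtains X1 where "X1 \<in> sets M" "measure M X1 = 1" "\<And>x. x \<in> X1 \<Longrightarrow> free_at x"
proof -
  obtain N1 where N1: "{x \<in> space M. \<not> (\<forall>s\<in>carrier G - {\<one>\<^bsub>G\<^esub>}. \<alpha> s x \<noteq> x)} \<subseteq> N1" "N1 \<in> sets M" "emeasure M N1 = 0"
    using free_G unfolding free_action_def by (rule AE_E)
  obtain N2 where N2: "{y \<in> space N. \<not> (\<forall>t\<in>carrier H - {\<one>\<^bsub>H\<^esub>}. \<beta> t y \<noteq> y)} \<subseteq> N2" "N2 \<in> sets N" "emeasure N N2 = 0"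
    using free_H unfolding free_action_def by (rule AE_E)
  define N3 where "N3 = \<Phi> -` N2 \<inter> space M"
  have N3: "N3 \<in> sets M" "measure M N3 = 0"
    using \<Phi>_vimage[OF N2(2)] N2(3) by (auto simp: N3_def measure_def)
  have "AE x in M. x \<notin> N1" using N1 by (intro AE_not_in) (auto simp: null_sets_def)
  moreover have "AE x in M. x \<notin> N3"
    using N3 by (intro AE_not_in) (auto simp: null_sets_def A.emeasure_eq_measure)
  ultimately have ae: "AE x in M. x \<in> X0 - N1 - N3" using X0_conull by eventually_elim auto
  show thesis
  proof (rule that[of "X0 - N1 - N3"])
    show s: "X0 - N1 - N3 \<in> sets M" using N1 N3 by auto
    show "measure M (X0 - N1 - N3) = 1" using ae s by (simp add: A.prob_eq_1)
    fix x assume x: "x \<in> X0 - N1 - N3"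
    then have "x \<in> X0" "x \<in> space M" using X0_space by auto
    moreover have "\<Psi> x \<notin> N2" "\<Psi> x \<in> space N"
      using x X0_space \<Psi>_Y0 Y0_space by (auto simp: N3_def \<Phi>_def)
    ultimately show "free_at x" using x N1(1) N2(1) unfolding free_at_def by blast
  qed
qed

lemma free_X0: "free_at x \<Longrightarrow> x \<in> X0"
  by (simp add: free_at_def)

lemma free_act_eq:
  assumes "free_at x" "g \<in> carrier G" "h \<in> carrier G" "\<alpha> g x = \<alpha> h x"
  shows "g = h"
proof -
  have x: "x \<in> space M" using assms(1) X0_space free_X0 by auto
  have "\<alpha> (inv\<^bsub>G\<^esub> h \<otimes>\<^bsub>G\<^esub> g) x = x" using assms x by (simp add: A.act_mult A.act_inv)
  then have "inv\<^bsub>G\<^esub> h \<otimes>\<^bsub>G\<^esub> g = \<one>\<^bsub>G\<^esub>"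
    using assms by (auto simp: free_at_def)
  then show ?thesis using assms A.G.inv_equality A.G.inv_inv A.G.inv_closed by metis
qed

lemma free_act_eq':
  assumes "free_at x" "s \<in> carrier H" "t \<in> carrier H" "\<beta> s (\<Psi> x) = \<beta> t (\<Psi> x)"
  shows "s = t"
proof -
  have x: "\<Psi> x \<in> space N" using assms(1) \<Psi>_Y0 Y0_space free_X0 by blast
  have "\<beta> (inv\<^bsub>H\<^esub> t \<otimes>\<^bsub>H\<^esub> s) (\<Psi> x) = \<Psi> x" using assms x by (simp add: B.act_mult B.act_inv)
  then have "inv\<^bsub>H\<^esub> t \<otimes>\<^bsub>H\<^esub> s = \<one>\<^bsub>H\<^esub>"
    using assms by (auto simp: free_at_def)
  then show ?thesis using assms B.G.inv_equality B.G.inv_inv B.G.inv_closed by metis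
qed

lemma \<kappa>_inj:
  assumes "free_at x" "g \<in> carrier G" "h \<in> carrier G" "\<kappa> g x = \<kappa> h x"
  shows "g = h"
proof -
  have x: "x \<in> X0" using assms(1) by (rule free_X0)
  have "\<Psi> (\<alpha> g x) = \<Psi> (\<alpha> h x)" using assms x by (simp add: \<kappa>_eq)
  then have "\<alpha> g x = \<alpha> h x" using x assms by (intro \<Psi>_inj X0_act)
  then show ?thesis using assms free_act_eq by blast
qed

lemma \<kappa>_mult:
  assumes "free_at x" "g \<in> carrier G" "h \<in> carrier G"
  shows "\<kappa> (g \<otimes>\<^bsub>G\<^esub> h) x = \<kappa> g (\<alpha> h x) \<otimes>\<^bsub>H\<^esub> \<kappa> h x"
proof (rule free_act_eq'[OF assms(1)])
  have x: "x \<in> X0" "\<alpha> h x \<in> X0" "x \<in> space M" "\<Psi> x \<in> space N"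
    using assms free_X0 X0_act X0_space \<Psi>_Y0 Y0_space by blast+
  show "\<kappa> (g \<otimes>\<^bsub>G\<^esub> h) x \<in> carrier H" "\<kappa> g (\<alpha> h x) \<otimes>\<^bsub>H\<^esub> \<kappa> h x \<in> carrier H"
    using assms x by (auto simp: \<kappa>_closed)
  have "\<beta> (\<kappa> (g \<otimes>\<^bsub>G\<^esub> h) x) (\<Psi> x) = \<Psi> (\<alpha> g (\<alpha> h x))"
    using assms x by (simp add: A.act_mult flip: \<kappa>_eq)
  also have "\<dots> = \<beta> (\<kappa> g (\<alpha> h x)) (\<beta> (\<kappa> h x) (\<Psi> x))" using assms x by (simp add: \<kappa>_eq)
  also have "\<dots> = \<beta> (\<kappa> g (\<alpha> h x) \<otimes>\<^bsub>H\<^esub> \<kappa> h x) (\<Psi> x)"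
    using assms x by (simp add: B.act_mult \<kappa>_closed)
  finally show "\<beta> (\<kappa> (g \<otimes>\<^bsub>G\<^esub> h) x) (\<Psi> x) = \<beta> (\<kappa> g (\<alpha> h x) \<otimes>\<^bsub>H\<^esub> \<kappa> h x) (\<Psi> x)" .
qed

lemma \<kappa>_one: "free_at x \<Longrightarrow> \<kappa> \<one>\<^bsub>G\<^esub> x = \<one>\<^bsub>H\<^esub>"
proof (rule free_act_eq')
  assume f: "free_at x"
  then have x: "x \<in> X0" "x \<in> space M" "\<Psi> x \<in> space N" using free_X0 X0_space \<Psi>_Y0 Y0_space by blast+
  show "\<kappa> \<one>\<^bsub>G\<^esub> x \<in> carrier H" using x by (simp add: \<kappa>_closed)
  show "\<beta> (\<kappa> \<one>\<^bsub>G\<^esub> x) (\<Psi> x) = \<beta> \<one>\<^bsub>H\<^esub> (\<Psi> x)"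
    using x by (simp add: B.act_one A.act_one flip: \<kappa>_eq)
qed auto

lemma \<kappa>_lam:
  assumes "free_at x" "t \<in> carrier H"
  shows "\<kappa> (lam t (\<Psi> x)) x = t"
proof (rule free_act_eq'[OF assms(1)])
  have x: "x \<in> X0" "\<Psi> x \<in> Y0" using assms free_X0 \<Psi>_Y0 by blast+
  have l: "lam t (\<Psi> x) \<in> carrier G" using assms x by (simp add: lam_closed)
  show "\<kappa> (lam t (\<Psi> x)) x \<in> carrier H" "t \<in> carrier H" using assms x l by (auto simp: \<kappa>_closed)
  have "inv_into X0 \<Psi> (\<beta> t (\<Psi> x)) = \<alpha> (lam t (\<Psi> x)) x"
    using lam_eq[OF assms(2) x(2)] by (simp add: inv_\<Psi> x)
  then have "\<Psi> (\<alpha> (lam t (\<Psi> x)) x) = \<beta> t (\<Psi> x)"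
    using \<Psi>_bij Y0_act[OF assms(2) x(2)] by (metis bij_betw_inv_into_right)
  then show "\<beta> (\<kappa> (lam t (\<Psi> x)) x) (\<Psi> x) = \<beta> t (\<Psi> x)"
    using \<kappa>_eq[OF l x(1)] by simp
qed

end

section \<open>Transporting models\<close>

context vertex_cocycle_pair
begin

lemma card_core:
  assumes V: "finite V" "finite F"
    and c: "real (card {v \<in> V. \<not> K0.coherent v}) \<le> c" "real (card {v \<in> V. \<not> K.coherent v}) \<le> c"
  shows "real (card (V - core)) \<le> (1 + real (card F)) * (2 * c)"
proof -
  let ?B = "{v \<in> V. \<not> K0.coherent v} \<union> {v \<in> V. \<not> K.coherent v}"
  have "card ?B \<le> card {v \<in> V. \<not> K0.coherent v} + card {v \<in> V. \<not> K.coherent v}" by (rule card_Un_le)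
  then have B: "real (card ?B) \<le> 2 * c" using c by linarith
  let ?U = "\<Union>g\<in>F. {v \<in> V. \<pi> g v \<in> ?B}"
  have "V - core \<subseteq> ?B \<union> ?U"
  proof
    fix v assume v: "v \<in> V - core"
    show "v \<in> ?B \<union> ?U"
    proof (cases "v \<in> coherents")
      case True
      then obtain g where g: "g \<in> F" "\<pi> g v \<notin> coherents" using v by (auto simp: core_def)
      then have "\<pi> g v \<in> V" using v permutes_in_image[OF K.perm[of g]] by auto
      then show ?thesis using g v by (auto simp: coherents_def)
    qed (use v in \<open>auto simp: coherents_def\<close>)
  qed
  then have "card (V - core) \<le> card (?B \<union> ?U)" using V by (intro card_mono) auto
  also have "\<dots> \<le> card ?B + card ?U" by (rule card_Un_le)
  finally have "real (card (V - core)) \<le> real (card ?B) + real (card ?U)" by linarith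
  also have "real (card ?U) \<le> real (card F) * (2 * c)"
  proof (rule card_UN_le_bound[OF V(2)])
    fix g assume "g \<in> F"
    then have "card {v \<in> V. \<pi> g v \<in> ?B} = card (V \<inter> ?B)" by (intro card_permutes_preimage K.perm) simp
    also have "V \<inter> ?B = ?B" by auto
    finally show "real (card {v \<in> V. \<pi> g v \<in> ?B}) \<le> 2 * c" using B by simp
  qed
  finally show ?thesis using B by (simp add: algebra_simps)
qed

lemma \<theta>_determines:
  assumes "vertex_cocycle_pair G H V \<pi> F R k0 l0 k2 l2 W \<gamma> \<omega> S T \<Lambda> L"
    and v: "v \<in> core" and v2: "v2 \<in> vertex_cocycle_pair.core G H V \<pi> F R k0 l0 k2 l2"
    and eq: "vertex_cocycle_pair.\<theta> \<pi> l0 k2 \<gamma> \<omega> v2 = \<theta> v"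
    and core: "\<theta> v \<in> vertex_cocycle_pair.core G H V \<pi> F R k0 l0 k2 l2"
    and label: "k2 v2 (inv\<^bsub>G\<^esub> \<gamma> v) = k v (inv\<^bsub>G\<^esub> \<gamma> v)"
  shows "v2 = v"
proof -
  interpret P2: vertex_cocycle_pair G H V \<pi> F R k0 l0 k2 l2 W \<gamma> \<omega> S T \<Lambda> L by fact
  let ?w = "\<omega> v" and ?t = "k (\<omega> v) (\<gamma> v)"
  have vV: "v \<in> V" using v by (auto simp: core_def coherents_def)
  have w: "?w \<in> coherents" "?w \<in> W" "\<gamma> v \<in> S" "\<pi> (\<gamma> v) ?w = v"
    using \<omega>_coherent[OF v] cover[OF vV] by auto
  note cw = coherentsD[OF w(1)]
  have g: "\<gamma> v \<in> F" using w S_F by auto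
  have t: "?t \<in> L" using k_L[OF K.base_coherent[OF cw(2)] w(3)] .
  have \<theta>v: "\<theta> v = K0.act ?w ?t" by (simp add: \<theta>_def)
  let ?a = "l0 ?w ?t"
  have a: "?a \<in> F" using K0.base_l_F[OF K0.base_coherent[OF cw(1)]] t L_R by auto
  have "\<pi> (inv\<^bsub>G\<^esub> ?a) (\<theta> v) = ?w"
    using K0.coherent_inv[OF cw(1) a] by (simp add: \<theta>v K0.act_def)
  then have w2: "?w \<in> P2.coherents" using P2.core_translate[OF core K.F_inv[OF a]] by simp
  have "v2 = \<pi> (l2 ?w ?t) ?w" "k2 v2 (inv\<^bsub>G\<^esub> l2 ?w ?t) = inv\<^bsub>H\<^esub> ?t"
    using P2.recover[OF v2 w(2) w2 t] eq \<theta>v by auto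
  moreover have "k v (inv\<^bsub>G\<^esub> \<gamma> v) = inv\<^bsub>H\<^esub> ?t"
    using K.coherent_k_inv[OF cw(2) g] w(4) by simp
  ultimately have keq: "k2 v2 (inv\<^bsub>G\<^esub> l2 ?w ?t) = k2 v2 (inv\<^bsub>G\<^esub> \<gamma> v)" using label by simp
  have b2: "P2.K.base v2"
    using v2 P2.core_coherents P2.coherentsD(2) P2.K.base_coherent by blast
  have l2: "l2 ?w ?t \<in> F"
    using P2.K.base_l_F[OF P2.K.base_coherent[OF P2.coherentsD(2)[OF w2]]] t L_R by auto
  have "inv\<^bsub>G\<^esub> l2 ?w ?t = inv\<^bsub>G\<^esub> \<gamma> v"
    using P2.K.base_k_inj[OF b2 _ _ keq] l2 g by simp
  then have "l2 ?w ?t = \<gamma> v" using l2 g by (metis K.F_closed K0.G.inv_inv)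
  then show "v2 = v" using \<open>v2 = \<pi> (l2 ?w ?t) ?w\<close> w(4) by simp
qed

end

definition incoherence_bound :: "'g set \<Rightarrow> 'x set set \<Rightarrow> real" where
  "incoherence_bound F \<A> = 1 + real (card F) + real (card (F \<times> \<A>)) + 2 * real (card (F \<times> F))"

definition core_bound :: "'g set \<Rightarrow> 'x set set \<Rightarrow> real" where
  "core_bound F \<A> = (1 + real (card F)) * (2 * incoherence_bound F \<A>)"

definition transport_bound :: "'g set \<Rightarrow> 'x set set \<Rightarrow> real" where
  "transport_bound F \<A> = 1 + (core_bound F \<A> + (real (card F) * core_bound F \<A> +
     (incoherence_bound F \<A> + (1 + real (card F)))))"

lemma bounds_nonneg: "0 \<le> incoherence_bound F \<A>" "0 \<le> core_bound F \<A>" "0 \<le> transport_bound F \<A>"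
  by (auto simp: incoherence_bound_def core_bound_def transport_bound_def)

locale oe_models = bounded_oe G M \<alpha> H N \<beta> X0 Y0 \<Psi> \<kappa> lam
  for G :: "('g, 'r) monoid_scheme" and M :: "'x measure" and \<alpha>
    and H :: "('h, 's) monoid_scheme" and N :: "'y measure" and \<beta> X0 Y0 \<Psi> \<kappa> lam +
  fixes X1 :: "'x set" and \<A> :: "'x set set" and \<B> :: "'y set set" and F S T \<Lambda> :: "'g set"
    and L R K :: "'h set" and V :: "'v set" and \<pi> :: "'g \<Rightarrow> 'v \<Rightarrow> 'v" and \<zeta> :: real
    and W :: "'v set" and C n :: nat and Ss :: "nat \<Rightarrow> 'g set" and Vs :: "nat \<Rightarrow> 'v set"
    and words :: "nat \<Rightarrow> 'g set"
  assumes X1: "X1 \<in> \<A>" "measure M X1 = 1" "\<And>x. x \<in> X1 \<Longrightarrow> free_at x"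
    and fin_\<A>: "finite \<A>"
    and levels: "\<And>g h. g \<in> F \<Longrightarrow> h \<in> \<kappa> g ` X0 \<Longrightarrow> {x \<in> X0. \<kappa> g x = h} \<in> \<A>"
    and vimages: "\<And>B. B \<in> \<B> \<Longrightarrow> \<Phi> -` B \<inter> space M \<in> \<A>"
    and \<B>_sets: "\<B> \<subseteq> sets N"
    and fin_F: "finite F" and F_carrier: "F \<subseteq> carrier G" and F_one: "\<one>\<^bsub>G\<^esub> \<in> F"
    and F_inv: "\<And>g. g \<in> F \<Longrightarrow> inv\<^bsub>G\<^esub> g \<in> F"
    and S_F: "S \<subseteq> F" and T_F: "T \<subseteq> F" and \<Lambda>_F: "\<Lambda> \<subseteq> F"
    and S_inv: "\<And>g. g \<in> S \<Longrightarrow> inv\<^bsub>G\<^esub> g \<in> S"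
    and L_R: "L \<subseteq> R" and R_carrier: "R \<subseteq> carrier H"
    and K_R: "K \<subseteq> R" and KK_R: "\<And>s t. s \<in> K \<Longrightarrow> t \<in> K \<Longrightarrow> s \<otimes>\<^bsub>H\<^esub> t \<in> R"
    and \<kappa>_L: "\<And>g x. g \<in> S \<Longrightarrow> \<kappa>' g x \<in> L"
    and lam_\<Lambda>: "\<And>t y. t \<in> R \<Longrightarrow> y \<in> Y0 \<Longrightarrow> lam t y \<in> \<Lambda>"
    and T_quotient: "\<And>a a'. a \<in> \<Lambda> \<Longrightarrow> a' \<in> \<Lambda> \<Longrightarrow> inv\<^bsub>G\<^esub> a' \<otimes>\<^bsub>G\<^esub> a \<in> T"
    and T_conj: "\<And>g g' c. g \<in> S \<Longrightarrow> g' \<in> S \<Longrightarrow> c \<in> \<Lambda> \<Longrightarrow> inv\<^bsub>G\<^esub> g' \<otimes>\<^bsub>G\<^esub> (c \<otimes>\<^bsub>G\<^esub> g) \<in> T"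
    and \<Lambda>_S: "\<And>g c. g \<in> S \<Longrightarrow> c \<in> \<Lambda> \<Longrightarrow> c \<otimes>\<^bsub>G\<^esub> g \<in> F"
    and words: "words 0 = {\<one>\<^bsub>G\<^esub>}"
      "\<And>i. words (Suc i) = (\<Union>j\<in>{1..n}. \<Union>h\<in>Ss j. (\<otimes>\<^bsub>G\<^esub>) h ` words i)"
      "\<And>i. i \<le> C \<Longrightarrow> words i \<subseteq> F"
    and Ss_F: "\<And>j. j \<in> {1..n} \<Longrightarrow> Ss j \<subseteq> F"
    and V: "finite V" "V \<noteq> {}" and perm: "\<And>g. g \<in> carrier G \<Longrightarrow> \<pi> g permutes V"
    and sofic: "good_approximation G F \<zeta> (V, \<pi>)" and \<zeta>: "0 < \<zeta>"
    and W_V: "W \<subseteq> V" and W_cover: "(\<Union>g\<in>S. \<pi> g ` W) = V"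
    and W_paths: "\<And>w1 w2 g. w1 \<in> W \<Longrightarrow> w2 \<in> W \<Longrightarrow> g \<in> T \<Longrightarrow> \<pi> g w1 = w2 \<Longrightarrow>
       \<exists>l p. 1 \<le> l \<and> l \<le> C \<and> p 0 = w1 \<and> p l = w2 \<and> (\<forall>i\<in>{1..l}. SC_edge \<pi> n Ss Vs (p (i - 1)) (p i))"
begin

definition model :: "('v \<Rightarrow> 'x) \<Rightarrow> bool" where
  "model p \<longleftrightarrow> approx_model M \<alpha> \<A> F \<zeta> V \<pi> p"

definition k :: "('v \<Rightarrow> 'x) \<Rightarrow> 'v \<Rightarrow> 'g \<Rightarrow> 'h" where "k p v g = \<kappa>' g (p v)"

definition l :: "('v \<Rightarrow> 'x) \<Rightarrow> 'v \<Rightarrow> 'h \<Rightarrow> 'g" where "l p v t = lam t (\<Phi> (p v))"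

definition same_edges :: "('v \<Rightarrow> 'x) \<Rightarrow> ('v \<Rightarrow> 'x) \<Rightarrow> bool" where
  "same_edges p p' \<longleftrightarrow> (\<forall>j\<in>{1..n}. \<forall>h\<in>Ss j. \<forall>v\<in>Vs j. k p v h = k p' v h)"

lemma vertex_cocycle: "vertex_cocycle G H V \<pi> F"
  by (unfold_locales) (use perm F_carrier F_one F_inv in auto)

abbreviation coherent :: "('v \<Rightarrow> 'x) \<Rightarrow> 'v \<Rightarrow> bool" where
  "coherent p \<equiv> vertex_cocycle.coherent G H V \<pi> F R (k p) (l p)"

lemma card_V: "0 < real (card V)"
  using V by (simp add: card_gt_0_iff)

lemma base:
  assumes "v \<in> V" "p v \<in> X1"
  shows "vertex_cocycle.base G H V F R (k p) (l p) v"
proof -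
  interpret vc: vertex_cocycle G H V \<pi> F R "k p" "l p" by (rule vertex_cocycle)
  have f: "free_at (p v)" and x: "p v \<in> X0" using X1(3) assms free_X0 by auto
  have y: "\<Psi> (p v) \<in> Y0" using x \<Psi>_Y0 by simp
  show ?thesis unfolding vc.base_def
  proof (intro conjI ballI)
    show "v \<in> V" by fact
    show "k p v \<in> carrier G \<rightarrow> carrier H" by (auto simp: k_def \<kappa>'_closed)
    show "inj_on (k p v) (carrier G)" using \<kappa>_inj[OF f] x by (auto intro!: inj_onI simp: k_def \<kappa>'_def)
    show "k p v \<one>\<^bsub>G\<^esub> = \<one>\<^bsub>H\<^esub>" using \<kappa>_one[OF f] by (simp add: k_def \<kappa>'_def)
    show "l p v t \<in> carrier G" "k p v (l p v t) = t" if "t \<in> carrier H" for t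
      using that x y \<kappa>_lam[OF f that] by (auto simp: k_def l_def \<kappa>'_def \<Phi>_def lam_closed)
    show "l p v t \<in> F" if "t \<in> R" for t
      using lam_\<Lambda>[OF that \<Phi>_Y0] \<Lambda>_F by (auto simp: l_def)
  qed
qed

lemma card_off_X1:
  assumes "model p" shows "real (card {v \<in> V. p v \<notin> X1}) \<le> \<zeta> * real (card V)"
proof -
  have "\<bar>real (card {v \<in> V. p v \<in> X1}) / real (card V) - 1\<bar> \<le> \<zeta>"
    using assms X1 by (auto simp: model_def approx_model_def)
  then have "1 - \<zeta> \<le> real (card {v \<in> V. p v \<in> X1}) / real (card V)" by linarith
  then have "(1 - \<zeta>) * real (card V) \<le> real (card {v \<in> V. p v \<in> X1})"
    using card_V by (simp add: le_divide_eq)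
  moreover have "card V = card {v \<in> V. p v \<in> X1} + card {v \<in> V. p v \<notin> X1}"
    using V(1) by (subst card_Un_disjoint[symmetric]) (auto intro: arg_cong[of _ _ card])
  ultimately show ?thesis by (simp add: algebra_simps)
qed

abbreviation c1 :: real where "c1 \<equiv> incoherence_bound F \<A>"

lemma card_incoherent:
  assumes p: "model p"
  shows "real (card {v \<in> V. \<not> coherent p v}) \<le> c1 * (\<zeta> * real (card V))"
proof -
  interpret vc: vertex_cocycle G H V \<pi> F R "k p" "l p" by (rule vertex_cocycle)
  let ?e = "\<zeta> * real (card V)"
  have e: "0 \<le> ?e" using \<zeta> by simp
  let ?U1 = "{v \<in> V. p v \<notin> X1}"
  let ?U2 = "\<Union>g\<in>F. {v \<in> V. \<pi> g v \<in> ?U1}"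
  let ?U3 = "\<Union>(g, A)\<in>F \<times> \<A>. {v \<in> V. (p (\<pi> g v) \<in> A) \<noteq> (\<alpha> g (p v) \<in> A)}"
  let ?U4 = "\<Union>(g, g')\<in>F \<times> F. {v \<in> V. \<pi> (g' \<otimes>\<^bsub>G\<^esub> g) v \<noteq> (\<pi> g' \<circ> \<pi> g) v}"
  let ?U5 = "\<Union>(g, g')\<in>F \<times> F. if g = g' then {} else {v \<in> V. \<pi> g v = \<pi> g' v}"
  have pV: "p \<in> V \<rightarrow> space M" using p by (simp add: model_def approx_model_def)
  have "{v \<in> V. \<not> coherent p v} \<subseteq> ?U1 \<union> (?U2 \<union> (?U3 \<union> (?U4 \<union> ?U5)))"
  proof (rule subsetI, rule ccontr)
    fix v assume "v \<in> {v \<in> V. \<not> coherent p v}" and nU: "v \<notin> ?U1 \<union> (?U2 \<union> (?U3 \<union> (?U4 \<union> ?U5)))"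
    then have v: "v \<in> V" "\<not> coherent p v" by auto
    have x1: "p v \<in> X1" using nU v(1) by auto
    have gV: "\<pi> g v \<in> V" if "g \<in> F" for g
      using v(1) permutes_in_image[OF perm[of g]] F_carrier that by auto
    have x1g: "p (\<pi> g v) \<in> X1" if "g \<in> F" for g using nU v(1) gV that by auto
    have agree: "p (\<pi> g v) \<in> A \<longleftrightarrow> \<alpha> g (p v) \<in> A" if "g \<in> F" "A \<in> \<A>" for g A
      using nU v(1) that by blast
    have f: "free_at (p v)" "p v \<in> X0" using X1(3)[OF x1] free_X0 by auto
    have "coherent p v" unfolding vc.coherent_def
    proof (intro conjI ballI)
      show "vc.base v" using base v(1) x1 by blast
      fix g assume g: "g \<in> F"
      show "vc.base (\<pi> g v)" using base gV[OF g] x1g[OF g] by blast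
      fix g' assume g': "g' \<in> F"
      have gG: "g \<in> carrier G" "g' \<in> carrier G" using g g' F_carrier by auto
      have y: "\<alpha> g (p v) \<in> X0" using X0_act gG f by simp
      define h where "h = \<kappa> g' (\<alpha> g (p v))"
      have "{x \<in> X0. \<kappa> g' x = h} \<in> \<A>" using levels[OF g'] y by (auto simp: h_def)
      from agree[OF g this] have "\<kappa> g' (p (\<pi> g v)) = h" "p (\<pi> g v) \<in> X0" using y by (auto simp: h_def)
      then show "k p (\<pi> g v) g' \<otimes>\<^bsub>H\<^esub> k p v g = k p v (g' \<otimes>\<^bsub>G\<^esub> g)"
        using \<kappa>_mult[OF f(1) gG(2,1)] f(2) by (simp add: k_def \<kappa>'_def h_def)
      show "\<pi> (g' \<otimes>\<^bsub>G\<^esub> g) v = \<pi> g' (\<pi> g v)" using nU v(1) g g' by auto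
      have "v \<notin> (if g = g' then {} else {v \<in> V. \<pi> g v = \<pi> g' v})" using nU g g' by auto
      then show "g \<noteq> g' \<longrightarrow> \<pi> g v \<noteq> \<pi> g' v" using v(1) by (auto split: if_splits)
    qed
    then show False using v by simp
  qed
  moreover have "finite (?U1 \<union> (?U2 \<union> (?U3 \<union> (?U4 \<union> ?U5))))"
    using V(1) by (rule finite_subset[rotated]) (auto split: if_splits)
  ultimately have "card {v \<in> V. \<not> coherent p v} \<le> card (?U1 \<union> (?U2 \<union> (?U3 \<union> (?U4 \<union> ?U5))))"
    by (intro card_mono)
  also have "\<dots> \<le> card ?U1 + (card ?U2 + (card ?U3 + (card ?U4 + card ?U5)))"
    by (intro order_trans[OF card_Un_le] add_left_mono card_Un_le)
  finally have "real (card {v \<in> V. \<not> coherent p v})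
      \<le> real (card ?U1) + (real (card ?U2) + (real (card ?U3) + (real (card ?U4) + real (card ?U5))))"
    by linarith
  moreover have 1: "real (card ?U1) \<le> ?e" by (rule card_off_X1[OF p])
  moreover have "real (card ?U2) \<le> real (card F) * ?e"
  proof (rule card_UN_le_bound[OF fin_F])
    fix g assume "g \<in> F"
    then have "card {v \<in> V. \<pi> g v \<in> ?U1} = card (V \<inter> ?U1)"
      using F_carrier by (intro card_permutes_preimage perm) auto
    also have "V \<inter> ?U1 = ?U1" by auto
    finally show "real (card {v \<in> V. \<pi> g v \<in> ?U1}) \<le> ?e" using 1 by simp
  qed
  moreover have "real (card ?U3) \<le> real (card (F \<times> \<A>)) * ?e"
    using p fin_F fin_\<A> by (intro card_UN_le_bound) (auto simp: model_def approx_model_def)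
  moreover have "real (card ?U4) \<le> real (card (F \<times> F)) * ?e"
  proof (rule card_UN_le_bound)
    fix i assume "i \<in> F \<times> F"
    then obtain g g' where i: "i = (g, g')" "g \<in> F" "g' \<in> F" by auto
    then have "hamming V (\<pi> (g' \<otimes>\<^bsub>G\<^esub> g)) (\<pi> g' \<circ> \<pi> g) \<le> \<zeta>" using sofic by (auto simp: good_approximation_def)
    then show "real (card (case i of (g, g') \<Rightarrow> {v \<in> V. \<pi> (g' \<otimes>\<^bsub>G\<^esub> g) v \<noteq> (\<pi> g' \<circ> \<pi> g) v})) \<le> ?e"
      using card_V by (simp add: i hamming_def divide_le_eq)
  qed (use fin_F in auto)
  moreover have "real (card ?U5) \<le> real (card (F \<times> F)) * ?e"
  proof (rule card_UN_le_bound)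
    fix i assume "i \<in> F \<times> F"
    then obtain g g' where i: "i = (g, g')" "g \<in> F" "g' \<in> F" by auto
    show "real (card (case i of (g, g') \<Rightarrow> if g = g' then {} else {v \<in> V. \<pi> g v = \<pi> g' v})) \<le> ?e"
    proof (cases "g = g'")
      case False
      then have "hamming V (\<pi> g) (\<pi> g') \<ge> 1 - \<zeta>" using sofic i by (auto simp: good_approximation_def)
      then have "(1 - \<zeta>) * real (card V) \<le> real (card {v \<in> V. \<pi> g v \<noteq> \<pi> g' v})"
        using card_V by (simp add: hamming_def le_divide_eq)
      moreover have "card V = card {v \<in> V. \<pi> g v \<noteq> \<pi> g' v} + card {v \<in> V. \<pi> g v = \<pi> g' v}"
        using V(1) by (subst card_Un_disjoint[symmetric]) (auto intro: arg_cong[of _ _ card])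
      ultimately show ?thesis using False by (simp add: i algebra_simps)
    qed (use e i in auto)
  qed (use fin_F in auto)
  ultimately show ?thesis unfolding incoherence_bound_def distrib_right by linarith
qed

definition \<gamma>\<omega> :: "'v \<Rightarrow> 'g \<times> 'v" where
  "\<gamma>\<omega> v = (SOME gw. fst gw \<in> S \<and> snd gw \<in> W \<and> \<pi> (fst gw) (snd gw) = v)"

lemma \<gamma>\<omega>: "v \<in> V \<Longrightarrow> fst (\<gamma>\<omega> v) \<in> S \<and> snd (\<gamma>\<omega> v) \<in> W \<and> \<pi> (fst (\<gamma>\<omega> v)) (snd (\<gamma>\<omega> v)) = v"
  unfolding \<gamma>\<omega>_def
proof (rule someI_ex)
  assume "v \<in> V"
  then obtain g w where "g \<in> S" "w \<in> W" "\<pi> g w = v" using W_cover by blast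
  then show "\<exists>gw. fst gw \<in> S \<and> snd gw \<in> W \<and> \<pi> (fst gw) (snd gw) = v" by (intro exI[of _ "(g, w)"]) auto
qed

abbreviation pair :: "('v \<Rightarrow> 'x) \<Rightarrow> ('v \<Rightarrow> 'x) \<Rightarrow> bool" where
  "pair p0 p \<equiv> vertex_cocycle_pair G H V \<pi> F R (k p0) (l p0) (k p) (l p) W
     (\<lambda>v. fst (\<gamma>\<omega> v)) (\<lambda>v. snd (\<gamma>\<omega> v)) S T \<Lambda> L"

text \<open>Paths through the sparse edges determine the cocycle of a model between points of \<open>W\<close>.\<close>

lemma pair:
  assumes "same_edges p0 p"
  shows "pair p0 p"
proof -
  interpret K0: vertex_cocycle G H V \<pi> F R "k p0" "l p0" by (rule vertex_cocycle)
  interpret K: vertex_cocycle G H V \<pi> F R "k p" "l p" by (rule vertex_cocycle)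
  show ?thesis
  proof (unfold_locales, goal_cases)
    case (14 w g)
    obtain m r where m: "m \<le> C" "r 0 = w" "r m = \<pi> g w"
      "\<And>i. i \<in> {1..m} \<Longrightarrow> SC_edge \<pi> n Ss Vs (r (i - 1)) (r i)"
      using W_paths[OF 14(1,3,2) refl] by blast
    have "\<exists>g'\<in>words m. r m = \<pi> g' (r 0) \<and> k p0 (r 0) g' = k p (r 0) g'"
    proof (rule K0.path_word[where B = words and m = m and i = m])
      show "k p0 v h = k p v h" if "j \<in> {1..n}" "h \<in> Ss j" "v \<in> Vs j" for j h v
        using assms that by (auto simp: same_edges_def)
    qed (use words m 14 Ss_F vertex_cocycle in auto)
    then obtain g' where g': "g' \<in> words m" "\<pi> g w = \<pi> g' w" "k p0 w g' = k p w g'" using m by auto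
    then have "g = g'" using K0.coherent_distinct[OF 14(4)] words(3)[OF m(1)] 14(2) T_F by auto
    then show ?case using g' by simp
  qed (use W_V S_F T_F \<Lambda>_F L_R R_carrier \<gamma>\<omega> \<kappa>_L lam_\<Lambda> \<Phi>_Y0 T_quotient T_conj \<Lambda>_S in \<open>auto simp: k_def l_def\<close>)
qed


definition \<sigma> :: "('v \<Rightarrow> 'x) \<Rightarrow> 'h \<Rightarrow> 'v \<Rightarrow> 'v" where
  "\<sigma> p t = (if t \<in> R then SOME s. s permutes V \<and> (\<forall>v\<in>V. coherent p v \<longrightarrow> s v = \<pi> (l p v t) v) else id)"

lemma \<sigma>:
  shows \<sigma>_perm: "\<sigma> p t permutes V"
    and \<sigma>_eq: "t \<in> R \<Longrightarrow> v \<in> V \<Longrightarrow> coherent p v \<Longrightarrow> \<sigma> p t v = \<pi> (l p v t) v"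
proof -
  interpret vc: vertex_cocycle G H V \<pi> F R "k p" "l p" by (rule vertex_cocycle)
  have ex: "\<exists>s. s permutes V \<and> (\<forall>v\<in>V. coherent p v \<longrightarrow> s v = \<pi> (l p v t) v)" if t: "t \<in> R"
  proof -
    let ?D = "{v \<in> V. coherent p v}"
    have tH: "t \<in> carrier H" using t R_carrier by auto
    have inj: "inj_on (\<lambda>v. \<pi> (l p v t) v) ?D"
      using vc.act_inj[OF _ _ tH t] by (auto intro!: inj_onI simp: vc.act_def)
    have "\<pi> (l p v t) v \<in> V" if "v \<in> ?D" for v
      using that t vc.base_V[OF vc.base_translate] vc.base_l_F[OF vc.base_coherent] by auto
    then obtain s where "s permutes V" "\<And>v. v \<in> ?D \<Longrightarrow> s v = \<pi> (l p v t) v"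
      using permutation_extending[OF V(1) _ inj] by blast
    then show ?thesis by auto
  qed
  show "\<sigma> p t permutes V"
  proof (cases "t \<in> R")
    case True
    from someI_ex[OF ex[OF this]] show ?thesis using True by (simp add: \<sigma>_def)
  qed (simp add: \<sigma>_def permutes_id)
  show "\<sigma> p t v = \<pi> (l p v t) v" if "t \<in> R" "v \<in> V" "coherent p v"
    using someI_ex[OF ex[OF that(1)]] that by (simp add: \<sigma>_def)
qed

lemma \<sigma>_sofic:
  assumes p: "model p" and \<eta>: "2 * c1 * \<zeta> \<le> \<eta>"
  shows "good_approximation H K \<eta> (V, \<sigma> p)"
proof -
  interpret vc: vertex_cocycle G H V \<pi> F R "k p" "l p" by (rule vertex_cocycle)
  let ?B = "{v \<in> V. \<not> coherent p v}"
  have B: "real (card ?B) \<le> c1 * \<zeta> * real (card V)"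
    using card_incoherent[OF p] by (simp add: mult.assoc)
  have c1: "0 \<le> c1 * \<zeta>" using \<zeta> by (simp add: bounds_nonneg)
  have "hamming V (\<sigma> p (s \<otimes>\<^bsub>H\<^esub> t)) (\<sigma> p s \<circ> \<sigma> p t) \<le> \<eta>" if st: "s \<in> K" "t \<in> K" for s t
  proof -
    have R: "s \<in> R" "t \<in> R" "s \<otimes>\<^bsub>H\<^esub> t \<in> R" "s \<in> carrier H" "t \<in> carrier H"
      using st K_R KK_R R_carrier by auto
    let ?M = "{v \<in> V. \<sigma> p (s \<otimes>\<^bsub>H\<^esub> t) v \<noteq> (\<sigma> p s \<circ> \<sigma> p t) v}"
    have "?M \<subseteq> ?B \<union> {v \<in> V. \<sigma> p t v \<in> ?B}"
    proof (rule subsetI, rule ccontr)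
      fix v assume v: "v \<in> ?M" "v \<notin> ?B \<union> {v \<in> V. \<sigma> p t v \<in> ?B}"
      then have vV: "v \<in> V" "coherent p v" "\<sigma> p t v \<in> V"
        using permutes_in_image[OF \<sigma>_perm] by auto
      then have c: "coherent p (\<sigma> p t v)" using v by auto
      have "\<sigma> p s (\<sigma> p t v) = vc.act (vc.act v t) s"
        using \<sigma>_eq[OF R(2) vV(1,2)] \<sigma>_eq[OF R(1) vV(3) c] by (simp add: vc.act_def)
      also have "\<dots> = vc.act v (s \<otimes>\<^bsub>H\<^esub> t)" by (rule vc.act_mult[OF vV(2) R(5,2,4,1)])
      also have "\<dots> = \<sigma> p (s \<otimes>\<^bsub>H\<^esub> t) v" using \<sigma>_eq[OF R(3) vV(1,2)] by (simp add: vc.act_def)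
      finally show False using v by simp
    qed
    then have "card ?M \<le> card (?B \<union> {v \<in> V. \<sigma> p t v \<in> ?B})" using V by (intro card_mono) auto
    also have "\<dots> \<le> card ?B + card {v \<in> V. \<sigma> p t v \<in> ?B}" by (rule card_Un_le)
    also have "card {v \<in> V. \<sigma> p t v \<in> ?B} = card (V \<inter> ?B)" by (rule card_permutes_preimage[OF \<sigma>_perm])
    also have "V \<inter> ?B = ?B" by auto
    finally have "real (card ?M) \<le> 2 * c1 * \<zeta> * real (card V)" using B by linarith
    also have "\<dots> \<le> \<eta> * real (card V)" using \<eta> by (intro mult_right_mono) auto
    finally show ?thesis using card_V by (simp add: hamming_def divide_le_eq)
  qed
  moreover have "hamming V (\<sigma> p s) (\<sigma> p t) \<ge> 1 - \<eta>" if st: "s \<in> K" "t \<in> K" "s \<noteq> t" for s t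
  proof -
    have R: "s \<in> R" "t \<in> R" "s \<in> carrier H" "t \<in> carrier H"
      using st K_R R_carrier by auto
    let ?M = "{v \<in> V. \<sigma> p s v \<noteq> \<sigma> p t v}"
    have "V - ?M \<subseteq> ?B"
    proof (rule subsetI, rule ccontr)
      fix v assume v: "v \<in> V - ?M" "v \<notin> ?B"
      then have "coherent p v" "vc.act v s = vc.act v t"
        using \<sigma>_eq[OF R(1), of v p] \<sigma>_eq[OF R(2), of v p] by (auto simp: vc.act_def)
      then show False using vc.act_distinct[of v s t] R st by blast
    qed
    then have "card (V - ?M) \<le> card ?B" using V by (intro card_mono) auto
    moreover have "card V = card ?M + card (V - ?M)"
      using V by (subst card_Un_disjoint[symmetric]) (auto intro: arg_cong[of _ _ card])
    ultimately have "real (card V) - c1 * \<zeta> * real (card V) \<le> real (card ?M)" using B by linarith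
    moreover have "c1 * \<zeta> * real (card V) \<le> \<eta> * real (card V)"
      using \<eta> c1 by (intro mult_right_mono) auto
    ultimately have "(1 - \<eta>) * real (card V) \<le> real (card ?M)" by (simp add: algebra_simps)
    then show ?thesis using card_V by (simp add: hamming_def le_divide_eq)
  qed
  ultimately show ?thesis by (auto simp: good_approximation_def)
qed

abbreviation core :: "('v \<Rightarrow> 'x) \<Rightarrow> ('v \<Rightarrow> 'x) \<Rightarrow> 'v set" where
  "core p0 p \<equiv> vertex_cocycle_pair.core G H V \<pi> F R (k p0) (l p0) (k p) (l p)"

abbreviation \<theta> :: "('v \<Rightarrow> 'x) \<Rightarrow> ('v \<Rightarrow> 'x) \<Rightarrow> 'v \<Rightarrow> 'v" where
  "\<theta> p0 p \<equiv> vertex_cocycle_pair.\<theta> \<pi> (l p0) (k p) (\<lambda>v. fst (\<gamma>\<omega> v)) (\<lambda>v. snd (\<gamma>\<omega> v))"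

abbreviation c2 :: real where "c2 \<equiv> core_bound F \<A>"

lemma card_off_core:
  assumes "model p0" "model p" "same_edges p0 p"
  shows "real (card (V - core p0 p)) \<le> c2 * \<zeta> * real (card V)"
proof -
  interpret P: vertex_cocycle_pair G H V \<pi> F R "k p0" "l p0" "k p" "l p" W
     "\<lambda>v. fst (\<gamma>\<omega> v)" "\<lambda>v. snd (\<gamma>\<omega> v)" S T \<Lambda> L using assms(3) by (rule pair)
  show ?thesis
    using P.card_core[OF V(1) fin_F card_incoherent[OF assms(1)] card_incoherent[OF assms(2)]]
    by (simp add: core_bound_def mult.assoc)
qed

definition \<Theta> :: "('v \<Rightarrow> 'x) \<Rightarrow> ('v \<Rightarrow> 'x) \<Rightarrow> 'v \<Rightarrow> 'v" where
  "\<Theta> p0 p = (SOME s. s permutes V \<and> (\<forall>v\<in>core p0 p. s v = \<theta> p0 p v))"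

lemma \<Theta>:
  assumes "same_edges p0 p"
  shows \<Theta>_perm: "\<Theta> p0 p permutes V" and \<Theta>_eq: "v \<in> core p0 p \<Longrightarrow> \<Theta> p0 p v = \<theta> p0 p v"
proof -
  interpret P: vertex_cocycle_pair G H V \<pi> F R "k p0" "l p0" "k p" "l p" W
     "\<lambda>v. fst (\<gamma>\<omega> v)" "\<lambda>v. snd (\<gamma>\<omega> v)" S T \<Lambda> L using assms by (rule pair)
  have "core p0 p \<subseteq> V" using P.core_coherents P.coherentsD(3) by blast
  moreover have "\<theta> p0 p ` core p0 p \<subseteq> V" using P.\<theta>_V by auto
  ultimately have "\<exists>s. s permutes V \<and> (\<forall>v\<in>core p0 p. s v = \<theta> p0 p v)"
    using permutation_extending[OF V(1) _ P.\<theta>_inj] by metis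
  from someI_ex[OF this] show "\<Theta> p0 p permutes V" "v \<in> core p0 p \<Longrightarrow> \<Theta> p0 p v = \<theta> p0 p v"
    by (auto simp: \<Theta>_def)
qed

definition transported :: "('v \<Rightarrow> 'x) \<Rightarrow> ('v \<Rightarrow> 'x) \<Rightarrow> 'v \<Rightarrow> 'y" where
  "transported p0 p u = \<Phi> (p (inv_into UNIV (\<Theta> p0 p) u))"

lemma transported_\<Theta>:
  assumes "same_edges p0 p" shows "transported p0 p (\<Theta> p0 p v) = \<Phi> (p v)"
  using permutes_inverses(2)[OF \<Theta>_perm[OF assms]] by (simp add: transported_def)

lemma card_\<Theta>:
  assumes "same_edges p0 p" "B \<subseteq> V" shows "card {v \<in> V. \<Theta> p0 p v \<in> B} = card B"
  using card_permutes_preimage[OF \<Theta>_perm[OF assms(1)], of B] assms(2) by (simp add: Int_absorb1)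

abbreviation c3 :: real where "c3 \<equiv> transport_bound F \<A>"

lemma transported_model:
  assumes p: "model p0" "model p" "same_edges p0 p" and \<eta>: "c3 * \<zeta> \<le> \<eta>"
  shows "approx_model N \<beta> \<B> K \<eta> V (\<sigma> p0) (transported p0 p)"
  unfolding approx_model_def
proof (intro conjI ballI)
  interpret P: vertex_cocycle_pair G H V \<pi> F R "k p0" "l p0" "k p" "l p" W
     "\<lambda>v. fst (\<gamma>\<omega> v)" "\<lambda>v. snd (\<gamma>\<omega> v)" S T \<Lambda> L using assms(3) by (rule pair)
  have pV: "p v \<in> space M" if "v \<in> V" for v using p(2) that by (auto simp: model_def approx_model_def)
  have \<zeta>\<eta>: "\<zeta> \<le> \<eta>"
  proof -
    have "1 * \<zeta> \<le> c3 * \<zeta>" using \<zeta> by (intro mult_right_mono) (auto simp: transport_bound_def bounds_nonneg)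
    then show ?thesis using \<eta> by simp
  qed
  show "transported p0 p \<in> V \<rightarrow> space N" using \<Phi>_Y0 Y0_space by (auto simp: transported_def)
  fix B assume B: "B \<in> \<B>"
  define A where "A = \<Phi> -` B \<inter> space M"
  have A: "A \<in> \<A>" using vimages[OF B] by (simp add: A_def)
  have BN: "B \<in> sets N" using B \<B>_sets by auto
  have memA: "\<Phi> (p v) \<in> B \<longleftrightarrow> p v \<in> A" if "v \<in> V" for v using pV[OF that] by (auto simp: A_def)
  have "card {u \<in> V. transported p0 p u \<in> B} = card {v \<in> V. \<Theta> p0 p v \<in> {u \<in> V. transported p0 p u \<in> B}}"
    by (rule card_\<Theta>[OF p(3), symmetric]) auto
  also have "{v \<in> V. \<Theta> p0 p v \<in> {u \<in> V. transported p0 p u \<in> B}} = {v \<in> V. p v \<in> A}"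
    using permutes_in_image[OF \<Theta>_perm[OF p(3)]] memA by (auto simp: transported_\<Theta>[OF p(3)])
  finally have "card {u \<in> V. transported p0 p u \<in> B} = card {v \<in> V. p v \<in> A}" .
  moreover have "measure N B = measure M A" using \<Phi>_vimage(2)[OF BN] by (simp add: A_def)
  moreover have "\<bar>real (card {v \<in> V. p v \<in> A}) / real (card V) - measure M A\<bar> \<le> \<zeta>"
    using p(2) A by (auto simp: model_def approx_model_def)
  ultimately show "\<bar>real (card {u \<in> V. transported p0 p u \<in> B}) / real (card V) - measure N B\<bar> \<le> \<eta>"
    using \<zeta>\<eta> by simp
  fix s assume s: "s \<in> K"
  then have sR: "s \<in> R" "s \<in> carrier H" using K_R R_carrier by auto
  let ?M = "{u \<in> V. (transported p0 p (\<sigma> p0 s u) \<in> B) \<noteq> (\<beta> s (transported p0 p u) \<in> B)}"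
  let ?C = "V - core p0 p" and ?I = "{v \<in> V. \<not> coherent p0 v}"
  let ?U1 = "\<Union>g\<in>F. {v \<in> V. \<pi> g v \<in> ?C}"
  let ?U2 = "{v \<in> V. \<Theta> p0 p v \<in> ?I}"
  let ?U3 = "{v \<in> V. p v \<notin> X1}"
  let ?U4 = "\<Union>g\<in>F. {v \<in> V. (p (\<pi> g v) \<in> A) \<noteq> (\<alpha> g (p v) \<in> A)}"
  have sub: "{v \<in> V. \<Theta> p0 p v \<in> ?M} \<subseteq> ?C \<union> (?U1 \<union> (?U2 \<union> (?U3 \<union> ?U4)))"
  proof (rule subsetI, rule ccontr)
    fix v assume v: "v \<in> {v \<in> V. \<Theta> p0 p v \<in> ?M}" and nU: "v \<notin> ?C \<union> (?U1 \<union> (?U2 \<union> (?U3 \<union> ?U4)))"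
    have vV: "v \<in> V" using v by simp
    have core: "v \<in> core p0 p" using nU vV by auto
    have coh: "coherent p v" using core P.core_coherents P.coherentsD(2) by blast
    define c where "c = l p v s"
    have b: "P.K.base v" using coh by (rule P.K.base_coherent)
    have c: "c \<in> F" "k p v c = s" using P.K.base_l_F[OF b sR(1)] P.K.base_k_l[OF b sR(2)] by (auto simp: c_def)
    have cG: "c \<in> carrier G" using c F_carrier by auto
    have pcV: "\<pi> c v \<in> V" using vV permutes_in_image[OF perm[OF cG]] by simp
    have core': "P.K.act v s \<in> core p0 p"
      using nU vV c(1) pcV by (auto simp: P.K.act_def c_def)
    have \<Theta>V: "\<Theta> p0 p v \<in> V" using vV permutes_in_image[OF \<Theta>_perm[OF p(3)]] by simp
    then have coh0: "coherent p0 (\<Theta> p0 p v)" using nU vV by auto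
    have "\<sigma> p0 s (\<Theta> p0 p v) = P.K0.act (\<theta> p0 p v) s"
      using \<sigma>_eq[OF sR(1) \<Theta>V coh0] \<Theta>_eq[OF p(3) core] by (simp add: P.K0.act_def)
    also have "\<dots> = \<theta> p0 p (P.K.act v s)" by (rule P.\<theta>_equivariant[OF core sR(1) core', symmetric])
    also have "\<dots> = \<Theta> p0 p (\<pi> c v)" using \<Theta>_eq[OF p(3) core'] by (simp add: P.K.act_def c_def)
    finally have "transported p0 p (\<sigma> p0 s (\<Theta> p0 p v)) = \<Phi> (p (\<pi> c v))"
      by (simp add: transported_\<Theta>[OF p(3)])
    moreover have "\<Phi> (p (\<pi> c v)) \<in> B \<longleftrightarrow> p (\<pi> c v) \<in> A" by (rule memA[OF pcV])
    moreover have "p (\<pi> c v) \<in> A \<longleftrightarrow> \<alpha> c (p v) \<in> A" using nU vV c(1) by blast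
    moreover have "\<alpha> c (p v) \<in> A \<longleftrightarrow> \<Phi> (\<alpha> c (p v)) \<in> B"
      using A.act_closed[OF cG pV[OF vV]] by (auto simp: A_def)
    moreover have "\<Phi> (\<alpha> c (p v)) = \<beta> s (\<Phi> (p v))"
    proof -
      have "p v \<in> X0" using nU vV X1(3) free_X0 by auto
      then show ?thesis using X0_act[OF cG] \<kappa>_eq[OF cG] c(2) by (simp add: \<Phi>_def k_def \<kappa>'_def)
    qed
    ultimately show False using v by (simp add: transported_\<Theta>[OF p(3)])
  qed
  let ?e = "\<zeta> * real (card V)"
  have C: "real (card ?C) \<le> c2 * ?e" using card_off_core[OF p] by (simp add: mult.assoc)
  have "card ?M = card {v \<in> V. \<Theta> p0 p v \<in> ?M}" by (rule card_\<Theta>[OF p(3), symmetric]) auto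
  also have "\<dots> \<le> card (?C \<union> (?U1 \<union> (?U2 \<union> (?U3 \<union> ?U4))))"
    using sub V(1) fin_F by (intro card_mono) auto
  also have "\<dots> \<le> card ?C + (card ?U1 + (card ?U2 + (card ?U3 + card ?U4)))"
    by (intro order_trans[OF card_Un_le] add_left_mono card_Un_le)
  finally have "real (card ?M) \<le> real (card ?C) + (real (card ?U1) + (real (card ?U2) + (real (card ?U3) + real (card ?U4))))"
    by linarith
  moreover have "real (card ?U1) \<le> real (card F) * (c2 * ?e)"
  proof (rule card_UN_le_bound[OF fin_F])
    fix g assume "g \<in> F"
    then have "card {v \<in> V. \<pi> g v \<in> ?C} = card (V \<inter> ?C)"
      using F_carrier by (intro card_permutes_preimage perm) auto
    also have "V \<inter> ?C = ?C" by auto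
    finally show "real (card {v \<in> V. \<pi> g v \<in> ?C}) \<le> c2 * ?e" using C by simp
  qed
  moreover have "real (card ?U2) \<le> c1 * ?e"
    using card_\<Theta>[OF p(3), of ?I] card_incoherent[OF p(1)] by simp
  moreover have "real (card ?U3) \<le> ?e" by (rule card_off_X1[OF p(2)])
  moreover have "real (card ?U4) \<le> real (card F) * ?e"
    using p(2) A fin_F by (intro card_UN_le_bound) (auto simp: model_def approx_model_def)
  ultimately have "real (card ?M) \<le> c2 * ?e + (real (card F) * (c2 * ?e) + (c1 * ?e + (?e + real (card F) * ?e)))"
    using C by linarith
  also have "\<dots> \<le> c3 * ?e" using \<zeta> by (simp add: transport_bound_def algebra_simps)
  also have "\<dots> \<le> \<eta> * real (card V)" using mult_right_mono[OF \<eta>, of "real (card V)"] by (simp add: mult.assoc)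
  finally show "real (card ?M) \<le> \<eta> * real (card V)" .
qed

text \<open>The pair of the transported label and the cocycle values on \<open>S\<close> determines where a vertex
  came from, so that little is lost in passing from \<open>p\<close> to the transported model.\<close>

lemma transported_determines:
  assumes p: "model p0" "model p" "same_edges p0 p" "model p2" "same_edges p0 p2"
    and labels: "\<And>u B. u \<in> V \<Longrightarrow> B \<in> label_events P S L \<Longrightarrow>
         transported p0 p u \<in> B \<longleftrightarrow> transported p0 p2 u \<in> B"
  shows "real (card {v \<in> V. \<exists>A\<in>P. (p v \<in> A) \<noteq> (p2 v \<in> A)}) \<le> (3 * c2 + 2) * \<zeta> * real (card V)"
proof -
  interpret P: vertex_cocycle_pair G H V \<pi> F R "k p0" "l p0" "k p" "l p" W
     "\<lambda>v. fst (\<gamma>\<omega> v)" "\<lambda>v. snd (\<gamma>\<omega> v)" S T \<Lambda> L using p(3) by (rule pair)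
  interpret P2: vertex_cocycle_pair G H V \<pi> F R "k p0" "l p0" "k p2" "l p2" W
     "\<lambda>v. fst (\<gamma>\<omega> v)" "\<lambda>v. snd (\<gamma>\<omega> v)" S T \<Lambda> L using p(5) by (rule pair)
  note perm1 = \<Theta>_perm[OF p(3)] and perm2 = \<Theta>_perm[OF p(5)]
  define \<tau> where "\<tau> = inv_into UNIV (\<Theta> p0 p2) \<circ> \<Theta> p0 p"
  have \<tau>: "\<tau> permutes V" unfolding \<tau>_def using perm1 perm2 by (intro permutes_compose permutes_inv)
  have \<Theta>\<tau>: "\<Theta> p0 p2 (\<tau> v) = \<Theta> p0 p v" for v
    using permutes_inverses(1)[OF perm2] by (simp add: \<tau>_def)
  let ?C = "V - core p0 p" and ?C2 = "V - core p0 p2"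
  let ?X = "{v \<in> V. p v \<notin> X1}" and ?X2 = "{v \<in> V. p2 v \<notin> X1}"
  let ?U1 = "{v \<in> V. \<Theta> p0 p v \<in> ?C2}" and ?U2 = "{v \<in> V. \<tau> v \<in> ?C2}" and ?U3 = "{v \<in> V. \<tau> v \<in> ?X2}"
  have "{v \<in> V. \<exists>A\<in>P. (p v \<in> A) \<noteq> (p2 v \<in> A)} \<subseteq> ?C \<union> (?U1 \<union> (?U2 \<union> (?X \<union> ?U3)))"
  proof (rule subsetI, rule ccontr)
    fix v assume v: "v \<in> {v \<in> V. \<exists>A\<in>P. (p v \<in> A) \<noteq> (p2 v \<in> A)}" and nU: "v \<notin> ?C \<union> (?U1 \<union> (?U2 \<union> (?X \<union> ?U3)))"
    have vV: "v \<in> V" "\<tau> v \<in> V" "\<Theta> p0 p v \<in> V"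
      using v permutes_in_image[OF \<tau>] permutes_in_image[OF perm1] by auto
    have core: "v \<in> core p0 p" "\<tau> v \<in> core p0 p2" "\<Theta> p0 p v \<in> core p0 p2" using nU vV by auto
    have X: "p v \<in> X0" "p2 (\<tau> v) \<in> X0" using nU vV X1(3) free_X0 by auto
    have t: "transported p0 p (\<Theta> p0 p v) = \<Psi> (p v)" "transported p0 p2 (\<Theta> p0 p v) = \<Psi> (p2 (\<tau> v))"
      using transported_\<Theta>[OF p(3)] transported_\<Theta>[OF p(5), of "\<tau> v"] X by (auto simp: \<Theta>\<tau> \<Phi>_def)
    have pA: "p v \<in> A \<longleftrightarrow> p2 (\<tau> v) \<in> A" if "A \<in> P" for A
      using labels[OF vV(3), of "{y \<in> Y0. inv_into X0 \<Psi> y \<in> A}"] that t X \<Psi>_Y0 by (auto simp: inv_\<Psi>)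
    let ?g = "inv\<^bsub>G\<^esub> fst (\<gamma>\<omega> v)"
    have gS: "?g \<in> S" using \<gamma>\<omega>[OF vV(1)] S_inv by auto
    define h where "h = \<kappa> ?g (p v)"
    have hL: "h \<in> L" using \<kappa>_L[OF gS, of "p v"] X by (simp add: h_def \<kappa>'_def)
    have "{y \<in> Y0. \<kappa> ?g (inv_into X0 \<Psi> y) = h}
        \<in> (\<lambda>(g, h). {y \<in> Y0. \<kappa> g (inv_into X0 \<Psi> y) = h}) ` (S \<times> L)"
      using gS hL by (intro image_eqI[of _ _ "(?g, h)"]) auto
    from labels[OF vV(3) UnI2[OF this]] have "\<kappa> ?g (p2 (\<tau> v)) = h"
      using t X \<Psi>_Y0 by (simp add: inv_\<Psi> h_def)
    then have "k p2 (\<tau> v) ?g = k p v ?g" using X by (simp add: k_def \<kappa>'_def h_def)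
    moreover have "\<theta> p0 p2 (\<tau> v) = \<theta> p0 p v"
      using \<Theta>_eq[OF p(3) core(1)] \<Theta>_eq[OF p(5) core(2)] \<Theta>\<tau> by simp
    moreover have "\<theta> p0 p v \<in> core p0 p2" using \<Theta>_eq[OF p(3) core(1)] core(3) by simp
    ultimately have "\<tau> v = v"
      using P.\<theta>_determines[OF pair[OF p(5)] core(1,2)] by simp
    then show False using pA v by auto
  qed
  then have "card {v \<in> V. \<exists>A\<in>P. (p v \<in> A) \<noteq> (p2 v \<in> A)} \<le> card (?C \<union> (?U1 \<union> (?U2 \<union> (?X \<union> ?U3))))"
    using V(1) by (intro card_mono) auto
  also have "\<dots> \<le> card ?C + (card ?U1 + (card ?U2 + (card ?X + card ?U3)))"
    by (intro order_trans[OF card_Un_le] add_left_mono card_Un_le)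
  also have "card ?U1 = card ?C2" by (rule card_\<Theta>[OF p(3)]) auto
  also have "card ?U2 = card ?C2"
    using card_permutes_preimage[OF \<tau>, of ?C2] by (simp add: Int_absorb1)
  also have "card ?U3 = card ?X2"
    using card_permutes_preimage[OF \<tau>, of ?X2] by (simp add: Int_absorb1)
  finally have "real (card {v \<in> V. \<exists>A\<in>P. (p v \<in> A) \<noteq> (p2 v \<in> A)})
      \<le> real (card ?C) + 2 * real (card ?C2) + (real (card ?X) + real (card ?X2))" by linarith
  also have "\<dots> \<le> (3 * c2 + 2) * \<zeta> * real (card V)"
    using card_off_core[OF p(1,2,3)] card_off_core[OF p(1,4,5)] card_off_X1[OF p(2)] card_off_X1[OF p(4)]
    by (simp add: algebra_simps)
  finally show ?thesis .
qed

end

section \<open>Counting models\<close>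

lemma prod_card_edges:
  fixes R :: "nat \<Rightarrow> real"
  assumes "\<And>j. j \<in> {1..n} \<Longrightarrow> finite (E j)" "\<And>j. j \<in> {1..n} \<Longrightarrow> finite (U j)"
    and "\<And>j. j \<in> {1..n} \<Longrightarrow> E j \<noteq> {} \<Longrightarrow> 0 < R j"
  shows "(\<Prod>i\<in>(SIGMA j:{1..n::nat}. E j \<times> U j). R (fst i))
       = exp (\<Sum>j=1..n. real (card (E j)) * real (card (U j)) * ln (R j))"
proof -
  let ?I = "SIGMA j:{1..n::nat}. E j \<times> U j"
  have fin: "finite ?I" using assms by (intro finite_SigmaI) auto
  have "(\<Prod>i\<in>?I. R (fst i)) = (\<Prod>i\<in>?I. exp (ln (R (fst i))))"
    using assms(3) by (intro prod.cong refl) fastforce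
  also have "\<dots> = exp (\<Sum>i\<in>?I. ln (R (fst i)))" using fin by (rule exp_sum[symmetric])
  also have "(\<Sum>i\<in>?I. ln (R (fst i))) = (\<Sum>j=1..n. \<Sum>i\<in>E j \<times> U j. ln (R j))"
    using assms by (subst sum.Sigma) (auto intro!: sum.cong)
  also have "\<dots> = (\<Sum>j=1..n. real (card (E j)) * real (card (U j)) * ln (R j))"
    by (simp add: card_cartesian_product)
  finally show ?thesis .
qed

definition (in bounded_oe) edge_cost :: "real \<Rightarrow> 'g set \<Rightarrow> real" where
  "edge_cost \<epsilon> E = 2 / \<epsilon> * (real (card E) * ln (real (card (\<Union>h\<in>E. range (\<kappa>' h)))))"

context oe_models
begin

lemma labellings_le:
  assumes P: "fin_borel_partition M P" and P': "fin_borel_partition N P'"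
    and sep: "\<And>B D. B \<in> label_events P S L \<Longrightarrow> D \<in> P' \<Longrightarrow> D \<subseteq> B \<or> D \<inter> B = {}"
    and \<epsilon>: "0 < \<epsilon>"
    and ball: "\<And>f0. (\<And>v. v \<in> V \<Longrightarrow> f0 v \<in> P) \<Longrightarrow>
       real (card {f \<in> (\<Pi>\<^sub>E v\<in>V. P). real (card {v \<in> V. f v \<noteq> f0 v}) \<le> \<eta>' * real (card V)})
         \<le> exp (\<epsilon> / 2 * real (card V))"
    and \<eta>': "(3 * core_bound F \<A> + 2) * \<zeta> \<le> \<eta>'"
    and \<eta>: "transport_bound F \<A> * \<zeta> \<le> \<eta>"
    and Vs: "\<And>j. j \<in> {1..n} \<Longrightarrow> Vs j \<subseteq> V"
    and cost: "(\<Sum>j=1..n. edge_cost \<epsilon> (Ss j) * measure (uniform_count_measure V) (Vs j)) \<le> 1"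
    and ne: "\<exists>p. model p"
  obtains p0 where "model p0"
    "real (card (labelling V P ` Collect model))
       \<le> exp (\<epsilon> * real (card V)) * real (card (model_labels P' N \<beta> \<B> K \<eta> V (\<sigma> p0)))"
proof -
  let ?n = "real (card V)"
  define I where "I = (SIGMA j:{1..n}. Ss j \<times> Vs j)"
  define R' where "R' E = (\<Union>h\<in>E. range (\<kappa>' h))" for E
  define data where "data p = restrict (\<lambda>(j, h, v). k p v h) I" for p
  have finSs: "finite (Ss j)" "Ss j \<subseteq> carrier G" if "j \<in> {1..n}" for j
    using Ss_F[OF that] fin_F F_carrier by (auto intro: finite_subset)
  have finVs: "finite (Vs j)" if "j \<in> {1..n}" for j
    using Vs[OF that] V(1) by (rule finite_subset)
  have finR: "finite (R' (Ss j))" if "j \<in> {1..n}" for j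
    using finSs[OF that] fin_\<kappa>' by (auto simp: R'_def)
  have finI: "finite I" unfolding I_def using finSs finVs by (intro finite_SigmaI) auto
  have data_sub: "data ` Collect model \<subseteq> (\<Pi>\<^sub>E i\<in>I. R' (Ss (fst i)))"
  proof (intro image_subsetI PiE_I)
    fix p i assume "i \<in> I"
    then obtain j h v where i: "i = (j, h, v)" "h \<in> Ss j" unfolding I_def by blast
    then have "data p i = \<kappa>' h (p v)" using \<open>i \<in> I\<close> by (simp add: data_def k_def)
    then show "data p i \<in> R' (Ss (fst i))" using i unfolding R'_def by auto
  qed (simp add: data_def)
  have finPi: "finite (\<Pi>\<^sub>E i\<in>I. R' (Ss (fst i)))"
    using finI finR by (intro finite_PiE) (auto simp: I_def)
  have fin_data: "finite (data ` Collect model)" using data_sub finPi by (rule finite_subset)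
  have "real (card (data ` Collect model)) \<le> real (card (\<Pi>\<^sub>E i\<in>I. R' (Ss (fst i))))"
    using data_sub finPi by (simp add: card_mono)
  also have "\<dots> = (\<Prod>i\<in>I. real (card (R' (Ss (fst i)))))"
    using finI by (simp add: card_PiE)
  also have "\<dots> = exp (\<Sum>j=1..n. real (card (Ss j)) * real (card (Vs j)) * ln (real (card (R' (Ss j)))))"
    unfolding I_def using finR finSs(1) finVs
    by (intro prod_card_edges[where R = "\<lambda>j. real (card (R' (Ss j)))"]) (auto simp: card_gt_0_iff R'_def)
  also have "(\<Sum>j=1..n. real (card (Ss j)) * real (card (Vs j)) * ln (real (card (R' (Ss j)))))
      = (\<epsilon> / 2 * ?n) * (\<Sum>j=1..n. edge_cost \<epsilon> (Ss j) * measure (uniform_count_measure V) (Vs j))"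
    unfolding sum_distrib_left
  proof (rule sum.cong[OF refl])
    fix j assume j: "j \<in> {1..n}"
    show "real (card (Ss j)) * real (card (Vs j)) * ln (real (card (R' (Ss j))))
      = \<epsilon> / 2 * ?n * (edge_cost \<epsilon> (Ss j) * measure (uniform_count_measure V) (Vs j))"
      using measure_uniform_count_measure[OF V(1) Vs[OF j]] \<epsilon> card_V
      by (simp add: edge_cost_def R'_def field_simps)
  qed
  also have "exp \<dots> \<le> exp (\<epsilon> / 2 * ?n)"
    using cost \<epsilon> by (intro exp_le_cancel_iff[THEN iffD2] mult_left_le) auto
  finally have data_le: "real (card (data ` Collect model)) \<le> exp (\<epsilon> / 2 * ?n)" .
  have P_fin: "finite P" "partition_on (space M) P" and P'_fin: "finite P'" "partition_on (space N) P'"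
    using P P' by (auto simp: fin_borel_partition_def)
  have fin_lab: "finite (labelling V P ` Q)" for Q using finite_labellings[OF V(1) P_fin(1)] .
  have "Collect model \<noteq> {}" using ne by auto
  from fin_data this fin_lab obtain p0 where "p0 \<in> Collect model" and ph: "card (labelling V P ` Collect model)
      \<le> card (data ` Collect model) * card (labelling V P ` {p \<in> Collect model. data p = data p0})"
    by (rule pigeonhole_fibre)
  then have p0: "model p0" by simp
  define Q where "Q = {p \<in> Collect model. data p = data p0}"
  have Q: "model p" "same_edges p0 p" if "p \<in> Q" for p
  proof -
    show "model p" using that by (simp add: Q_def)
    have "k p0 v h = k p v h" if jhv: "j \<in> {1..n}" "h \<in> Ss j" "v \<in> Vs j" for j h v
    proof -
      have "(j, h, v) \<in> I" using jhv by (simp add: I_def)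
      moreover have "data p (j, h, v) = data p0 (j, h, v)" using that \<open>p \<in> Q\<close> by (simp add: Q_def)
      ultimately show ?thesis by (simp add: data_def)
    qed
    then show "same_edges p0 p" by (simp add: same_edges_def)
  qed
  define lab' where "lab' p = labelling V P' (transported p0 p)" for p
  have lab'_sub: "lab' ` Q \<subseteq> model_labels P' N \<beta> \<B> K \<eta> V (\<sigma> p0)"
    using transported_model[OF p0 _ _ \<eta>] Q by (auto simp: lab'_def)
  have fin_lab': "finite (labelling V P' ` Q')" for Q' using finite_labellings[OF V(1) P'_fin(1)] .
  have fibre: "real (card (labelling V P ` {b \<in> Q. lab' b = lab' a})) \<le> exp (\<epsilon> / 2 * ?n)" if a: "a \<in> Q" for a
  proof -
    have cell: "\<exists>!A. A \<in> P \<and> b v \<in> A" if "b \<in> Q" "v \<in> V" for b v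
    proof -
      have "b v \<in> space M" using Q(1)[OF that(1)] that(2) by (auto simp: model_def approx_model_def)
      then show ?thesis using P_fin(2) unfolding partition_on_def disjoint_def by (metis Union_iff disjoint_iff)
    qed
    define cellf where "cellf b = restrict (\<lambda>v. THE A. A \<in> P \<and> b v \<in> A) V" for b
    have cellf: "cellf b v \<in> P" "b v \<in> cellf b v" if "b \<in> Q" "v \<in> V" for b v
      using theI'[OF cell[OF that]] that by (auto simp: cellf_def)
    have cellf_eq: "cellf b v = A" if "b \<in> Q" "v \<in> V" "A \<in> P" "b v \<in> A" for b v A
      using cell[OF that(1,2)] cellf[OF that(1,2)] that(3,4) by blast
    define h where "h f = restrict (\<lambda>A. {v \<in> V. f v = A}) P" for f :: "'v \<Rightarrow> 'x set"
    have lab_h: "labelling V P b = h (cellf b)" if "b \<in> Q" for b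
      unfolding labelling_def h_def using cellf_eq[OF that] cellf[OF that] by (intro restrict_ext) blast
    let ?ball = "{f \<in> (\<Pi>\<^sub>E v\<in>V. P). real (card {v \<in> V. f v \<noteq> cellf a v}) \<le> \<eta>' * ?n}"
    have "finite (\<Pi>\<^sub>E v\<in>V. P)" using V(1) P_fin(1) by (intro finite_PiE)
    then have finball: "finite ?ball" by simp
    have sub: "cellf ` {b \<in> Q. lab' b = lab' a} \<subseteq> ?ball"
    proof (rule image_subsetI)
      fix b assume "b \<in> {b \<in> Q. lab' b = lab' a}"
      then have b: "b \<in> Q" "lab' b = lab' a" by auto
      have same: "transported p0 a u \<in> B \<longleftrightarrow> transported p0 b u \<in> B"
        if u: "u \<in> V" and B: "B \<in> label_events P S L" for u B
      proof -
        have "transported p0 a u \<in> space N" using \<Phi>_Y0 Y0_space by (auto simp: transported_def)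
        then obtain D where D: "D \<in> P'" "transported p0 a u \<in> D" using P'_fin(2) by (auto simp: partition_on_def)
        have "lab' b D = lab' a D" using b(2) by simp
        then have "transported p0 b u \<in> D" using D u by (auto simp: lab'_def labelling_def)
        then show ?thesis using sep[OF B D(1)] D(2) by blast
      qed
      have "{v \<in> V. cellf b v \<noteq> cellf a v} \<subseteq> {v \<in> V. \<exists>A\<in>P. (a v \<in> A) \<noteq> (b v \<in> A)}"
      proof (intro subsetI CollectI conjI)
        fix v assume "v \<in> {v \<in> V. cellf b v \<noteq> cellf a v}"
        then have v: "v \<in> V" "cellf b v \<noteq> cellf a v" by auto
        then have "b v \<notin> cellf a v" using cellf_eq[OF b(1) v(1) cellf(1)[OF a v(1)]] by auto
        then show "\<exists>A\<in>P. (a v \<in> A) \<noteq> (b v \<in> A)" using cellf[OF a v(1)] by blast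
        show "v \<in> V" by fact
      qed
      then have "card {v \<in> V. cellf b v \<noteq> cellf a v} \<le> card {v \<in> V. \<exists>A\<in>P. (a v \<in> A) \<noteq> (b v \<in> A)}"
        using V(1) by (intro card_mono) auto
      also have "real \<dots> \<le> (3 * core_bound F \<A> + 2) * \<zeta> * ?n"
        by (rule transported_determines[OF p0 Q[OF a] Q[OF b(1)] same])
      also have "\<dots> \<le> \<eta>' * ?n" using \<eta>' by (intro mult_right_mono) auto
      finally show "cellf b \<in> ?ball" using cellf[OF b(1)] by (auto simp: cellf_def)
    qed
    have "labelling V P ` {b \<in> Q. lab' b = lab' a} = h ` cellf ` {b \<in> Q. lab' b = lab' a}"
      unfolding image_image by (rule image_cong) (auto simp: lab_h)
    then have "card (labelling V P ` {b \<in> Q. lab' b = lab' a}) \<le> card (cellf ` {b \<in> Q. lab' b = lab' a})"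
      using card_image_le[OF finite_subset[OF sub finball], of h] by (simp only:)
    also have "\<dots> \<le> card ?ball" using sub finball by (intro card_mono)
    finally have "real (card (labelling V P ` {b \<in> Q. lab' b = lab' a})) \<le> real (card ?ball)" by simp
    also have "\<dots> \<le> exp (\<epsilon> / 2 * ?n)" using cellf(1)[OF a] by (rule ball)
    finally show ?thesis .
  qed
  define c where "c = nat \<lfloor>exp (\<epsilon> / 2 * ?n)\<rfloor>"
  have c: "real c \<le> exp (\<epsilon> / 2 * ?n)" unfolding c_def by (simp add: of_nat_floor)
  have "card (labelling V P ` Q) \<le> card (lab' ` Q) * c"
  proof (rule card_image_Union_fibres)
    show "finite (lab' ` Q)" using lab'_sub fin_lab' by (rule finite_subset)
    show "card (labelling V P ` {b \<in> Q. lab' b = lab' a}) \<le> c" if "a \<in> Q" for a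
      using fibre[OF that] unfolding c_def by (rule le_nat_floor)
    show "finite (labelling V P ` {b \<in> Q. lab' b = lab' a})" for a by (rule fin_lab)
  qed
  then have "real (card (labelling V P ` Q)) \<le> real (card (lab' ` Q)) * real c"
    using of_nat_mono[of _ "card (lab' ` Q) * c", where 'a = real] by simp
  also have "\<dots> \<le> real (card (model_labels P' N \<beta> \<B> K \<eta> V (\<sigma> p0))) * exp (\<epsilon> / 2 * ?n)"
    using card_mono[OF fin_lab' lab'_sub] c by (intro mult_mono) auto
  finally have Q_le: "real (card (labelling V P ` Q)) \<le>
     real (card (model_labels P' N \<beta> \<B> K \<eta> V (\<sigma> p0))) * exp (\<epsilon> / 2 * ?n)" .
  show thesis
  proof (rule that[OF p0])
    have "real (card (labelling V P ` Collect model))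
        \<le> real (card (data ` Collect model)) * real (card (labelling V P ` Q))"
      using of_nat_mono[OF ph, where 'a = real] unfolding Q_def by simp
    also have "\<dots> \<le> exp (\<epsilon> / 2 * ?n) *
        (real (card (model_labels P' N \<beta> \<B> K \<eta> V (\<sigma> p0))) * exp (\<epsilon> / 2 * ?n))"
      using data_le Q_le by (intro mult_mono) auto
    also have "\<dots> = (exp (\<epsilon> / 2 * ?n) * exp (\<epsilon> / 2 * ?n)) *
        real (card (model_labels P' N \<beta> \<B> K \<eta> V (\<sigma> p0)))" by simp
    also have "exp (\<epsilon> / 2 * ?n) * exp (\<epsilon> / 2 * ?n) = exp (\<epsilon> * ?n)"
      by (simp flip: exp_add)
    finally show "real (card (labelling V P ` Collect model))
       \<le> exp (\<epsilon> * ?n) * real (card (model_labels P' N \<beta> \<B> K \<eta> V (\<sigma> p0)))" .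
  qed
qed

end

abbreviation sparsely_connected ::
  "('g set \<Rightarrow> real) \<Rightarrow> 'g set \<Rightarrow> 'g set \<Rightarrow> nat \<Rightarrow> nat \<Rightarrow> (nat \<Rightarrow> 'g set) \<Rightarrow> 'v set \<Rightarrow> ('g \<Rightarrow> 'v \<Rightarrow> 'v) \<Rightarrow> bool" where
  "sparsely_connected \<upsilon> S T C n Ss V \<pi> \<equiv>
     \<exists>W Vs. W \<subseteq> V \<and> (\<forall>j\<in>{1..n}. Vs j \<subseteq> V) \<and>
       (\<Sum>j=1..n. \<upsilon> (Ss j) * measure (uniform_count_measure V) (Vs j)) \<le> 1 \<and>
       (\<Union>g\<in>S. \<pi> g ` W) = V \<and>
       (\<forall>w1\<in>W. \<forall>w2\<in>W. (\<exists>g\<in>T. \<pi> g w1 = w2) \<longrightarrow>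
         (\<exists>l p. 1 \<le> l \<and> l \<le> C \<and> p 0 = w1 \<and> p l = w2 \<and>
            (\<forall>i\<in>{1..l}. SC_edge \<pi> n Ss Vs (p (i - 1)) (p i))))"

lemma good_approximation_mono:
  assumes "good_approximation G F' \<delta>' (V, \<sigma>)" "F \<subseteq> F'" "\<delta>' \<le> \<delta>"
  shows "good_approximation G F \<delta> (V, \<sigma>)"
  unfolding good_approximation_def prod.case
proof (intro conjI ballI impI)
  fix s t assume "s \<in> F" "t \<in> F"
  then have st: "s \<in> F'" "t \<in> F'" using assms(2) by auto
  have "hamming V (\<sigma> (s \<otimes>\<^bsub>G\<^esub> t)) (\<sigma> s \<circ> \<sigma> t) \<le> \<delta>'"
    using assms(1) st by (auto simp: good_approximation_def)
  then show "hamming V (\<sigma> (s \<otimes>\<^bsub>G\<^esub> t)) (\<sigma> s \<circ> \<sigma> t) \<le> \<delta>" using assms(3) by simp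
  assume "s \<noteq> t"
  then have "hamming V (\<sigma> s) (\<sigma> t) \<ge> 1 - \<delta>'"
    using assms(1) st by (auto simp: good_approximation_def)
  then show "1 - \<delta> \<le> hamming V (\<sigma> s) (\<sigma> t)" using assms(3) by simp
qed

context bounded_oe
begin

lemma edge_cost_nonneg:
  assumes "E \<in> fin_sets G" "0 < \<epsilon>" shows "0 \<le> edge_cost \<epsilon> E"
proof -
  have "finite (\<Union>h\<in>E. range (\<kappa>' h))" "(\<Union>h\<in>E. range (\<kappa>' h)) \<noteq> {}"
    using assms(1) fin_\<kappa>' by (auto simp: fin_sets_def)
  then have "1 \<le> card (\<Union>h\<in>E. range (\<kappa>' h))" by (metis One_nat_def Suc_leI card_gt_0_iff)
  then show ?thesis using assms(2) by (simp add: edge_cost_def)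
qed

lemma separating_partition:
  assumes P: "fin_borel_partition M P" and S: "finite S" "S \<subseteq> carrier G"
    and L: "finite L" "L \<subseteq> carrier H"
  obtains P' where "fin_borel_partition N P'"
    "\<forall>B\<in>label_events P S L. \<forall>D\<in>P'. D \<subseteq> B \<or> D \<inter> B = {}"
proof -
  let ?E = "label_events P S L"
  have "finite ?E" using P S L by (auto simp: fin_borel_partition_def)
  moreover have "?E \<subseteq> sets N"
  proof
    fix B assume "B \<in> ?E"
    then consider A where "A \<in> P" "B = {y \<in> Y0. inv_into X0 \<Psi> y \<in> A}"
      | g h where "g \<in> S" "h \<in> L" "B = {y \<in> Y0. \<kappa> g (inv_into X0 \<Psi> y) = h}" by auto
    then show "B \<in> sets N"
    proof cases
      case 1
      then show ?thesis using P transported_sets by (auto simp: fin_borel_partition_def)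
    next
      case 2
      have "{x \<in> X0. \<kappa> g x = h} \<in> sets M" using 2 S L by (intro \<kappa>_level_sets) auto
      from transported_sets[OF this]
      have "{y \<in> Y0. inv_into X0 \<Psi> y \<in> {x \<in> X0. \<kappa> g x = h}} \<in> sets N" .
      also have "{y \<in> Y0. inv_into X0 \<Psi> y \<in> {x \<in> X0. \<kappa> g x = h}} = B"
        using \<Psi>_bij 2(3) by (auto simp: bij_betw_def inv_into_into)
      finally show ?thesis .
    qed
  qed
  ultimately have "fin_borel_partition N (atoms (space N) ?E)" by (rule atoms_fin_borel_partition)
  then show thesis
  proof (rule that, intro ballI)
    fix B D assume "B \<in> ?E" "D \<in> atoms (space N) ?E"
    from this(2,1) show "D \<subseteq> B \<or> D \<inter> B = {}" by (rule atoms_subset_or_disjoint)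
  qed
qed

text \<open>The order of quantifiers matters: \<open>P'\<close> is chosen before the required quality of the
  approximation of \<open>H\<close>, since the entropy of \<open>H\<close> is a supremum over \<open>P'\<close>.\<close>

theorem models_transfer:
  fixes \<S> :: "('g, 'v) sofic_map set"
  assumes SC: "property_SC G \<S>" and \<S>: "\<forall>\<pi>\<in>\<S>. sofic_approximation G \<pi>"
    and P: "fin_borel_partition M P" and \<epsilon>: "0 < \<epsilon>"
  obtains P' where "fin_borel_partition N P'"
    "\<And>\<B> K \<eta>. finite \<B> \<Longrightarrow> \<B> \<subseteq> sets N \<Longrightarrow> finite K \<Longrightarrow> K \<subseteq> carrier H \<Longrightarrow> 0 < \<eta> \<Longrightarrow>
      \<exists>\<A> F \<zeta>. finite \<A> \<and> \<A> \<subseteq> sets M \<and> finite F \<and> F \<subseteq> carrier G \<and> 0 < \<zeta> \<and>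
        (\<forall>(V, \<pi>)\<in>\<S>. good_approximation G F \<zeta> (V, \<pi>) \<longrightarrow> (\<exists>p. approx_model M \<alpha> \<A> F \<zeta> V \<pi> p) \<longrightarrow>
          (\<exists>\<sigma>. (\<forall>t\<in>carrier H. \<sigma> t permutes V) \<and> good_approximation H K \<eta> (V, \<sigma>) \<and>
             real (card (model_labels P M \<alpha> \<A> F \<zeta> V \<pi>)) \<le> exp (\<epsilon> * real (card V)) *
               real (card (model_labels P' N \<beta> \<B> K \<eta> V \<sigma>))))"
proof -
  have "\<forall>E\<in>fin_sets G. 0 \<le> edge_cost \<epsilon> E" using edge_cost_nonneg \<epsilon> by auto
  from spec[OF SC[unfolded property_SC_def], of "edge_cost \<epsilon>", THEN mp, OF this] obtain S where S: "S \<in> symm_fin_sets G" and SC_S: "\<forall>T\<in>symm_fin_sets G. \<exists>(C::nat) (n::nat) (Ss :: nat \<Rightarrow> 'g set).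
          (\<forall>j\<in>{1..n}. Ss j \<in> symm_fin_sets G) \<and>
          (\<exists>K \<theta>. finite K \<and> K \<subseteq> carrier G \<and> 0 < \<theta> \<and>
            (\<forall>(V, \<pi>)\<in>\<S>. good_approximation G K \<theta> (V, \<pi>) \<longrightarrow>
              sparsely_connected (edge_cost \<epsilon>) S T C n Ss V \<pi>))"
    by (rule bexE)
  have S': "finite S" "S \<subseteq> carrier G" "\<And>g. g \<in> S \<Longrightarrow> inv\<^bsub>G\<^esub> g \<in> S"
    using S by (auto simp: symm_fin_sets_def)
  define L where "L = (\<Union>g\<in>S. range (\<kappa>' g))"
  have L: "finite L" "L \<subseteq> carrier H" using S' fin_\<kappa>' \<kappa>'_closed by (auto simp: L_def)
  obtain P' where P': "fin_borel_partition N P'"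
    and sep: "\<forall>B\<in>label_events P S L. \<forall>D\<in>P'. D \<subseteq> B \<or> D \<inter> B = {}"
    by (rule separating_partition[OF P S'(1,2) L])
  obtain X1 where X1: "X1 \<in> sets M" "measure M X1 = 1" "\<And>x. x \<in> X1 \<Longrightarrow> free_at x"
    using free_at_conull by blast
  have P_fin: "finite P" using P by (simp add: fin_borel_partition_def)
  have "0 < \<epsilon> / 2" using \<epsilon> by simp
  have "\<exists>\<eta>'>0. \<forall>(V :: 'v set) f0. finite V \<longrightarrow> (\<forall>v\<in>V. f0 v \<in> P) \<longrightarrow>
       real (card {f \<in> (\<Pi>\<^sub>E v\<in>V. P). real (card {v \<in> V. f v \<noteq> f0 v}) \<le> \<eta>' * real (card V)})
         \<le> exp (\<epsilon> / 2 * real (card V))"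
    by (rule card_hamming_ball_le[OF P_fin \<open>0 < \<epsilon> / 2\<close>, where 'b = 'v], rule exI, intro conjI allI impI) auto
  then obtain \<eta>' where \<eta>': "0 < \<eta>'"
    "\<forall>(V :: 'v set) f0. finite V \<longrightarrow> (\<forall>v\<in>V. f0 v \<in> P) \<longrightarrow>
       real (card {f \<in> (\<Pi>\<^sub>E v\<in>V. P). real (card {v \<in> V. f v \<noteq> f0 v}) \<le> \<eta>' * real (card V)})
         \<le> exp (\<epsilon> / 2 * real (card V))" by (elim exE conjE) (rule that)
  show thesis
  proof (rule that[OF P'])
    fix \<B> K and \<eta> :: real
    assume \<B>: "finite \<B>" "\<B> \<subseteq> sets N" and K: "finite K" "K \<subseteq> carrier H" and \<eta>: "0 < \<eta>"
    define R where "R = L \<union> K \<union> (\<lambda>(s, t). s \<otimes>\<^bsub>H\<^esub> t) ` (K \<times> K)"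
    have R: "finite R" "R \<subseteq> carrier H" using L K by (auto simp: R_def)
    define \<Lambda> where "\<Lambda> = (\<Union>t\<in>R. lam t ` Y0)"
    have \<Lambda>: "finite \<Lambda>" "\<Lambda> \<subseteq> carrier G" using R fin_lam lam_closed by (auto simp: \<Lambda>_def)
    define T0 where "T0 = (\<lambda>(a, a'). inv\<^bsub>G\<^esub> a' \<otimes>\<^bsub>G\<^esub> a) ` (\<Lambda> \<times> \<Lambda>) \<union>
      (\<lambda>(g, g', c). inv\<^bsub>G\<^esub> g' \<otimes>\<^bsub>G\<^esub> (c \<otimes>\<^bsub>G\<^esub> g)) ` (S \<times> S \<times> \<Lambda>)"
    have T0: "finite T0" "T0 \<subseteq> carrier G"
    proof -
      show "finite T0" using \<Lambda> S' by (auto simp: T0_def)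
      have "inv\<^bsub>G\<^esub> a' \<otimes>\<^bsub>G\<^esub> a \<in> carrier G" if "a \<in> \<Lambda>" "a' \<in> \<Lambda>" for a a'
        using that \<Lambda>(2) by (simp add: subset_iff)
      moreover have "inv\<^bsub>G\<^esub> g' \<otimes>\<^bsub>G\<^esub> (c \<otimes>\<^bsub>G\<^esub> g) \<in> carrier G" if "g \<in> S" "g' \<in> S" "c \<in> \<Lambda>" for g g' c
        using that \<Lambda>(2) S'(2) by (simp add: subset_iff)
      ultimately show "T0 \<subseteq> carrier G" by (auto simp: T0_def)
    qed
    define T where "T = insert \<one>\<^bsub>G\<^esub> (T0 \<union> m_inv G ` T0)"
    have T: "T \<in> symm_fin_sets G" "finite T" "T \<subseteq> carrier G"
      using T0 by (auto simp: T_def symm_fin_sets_def subset_iff)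
    from bspec[OF SC_S T(1)] obtain C n :: nat and Ss :: "nat \<Rightarrow> 'g set" and K0 \<theta> where Ss: "\<forall>j\<in>{1..n}. Ss j \<in> symm_fin_sets G"
      and K0: "finite K0" "K0 \<subseteq> carrier G" "0 < \<theta>"
      and SC_T: "\<forall>(V, \<pi>)\<in>\<S>. good_approximation G K0 \<theta> (V, \<pi>) \<longrightarrow>
              sparsely_connected (edge_cost \<epsilon>) S T C n Ss V \<pi>"
      by (elim exE conjE) (rule that)
    have Ss': "finite (Ss j)" "Ss j \<subseteq> carrier G" if "j \<in> {1..n}" for j
      using bspec[OF Ss that] by (auto simp: symm_fin_sets_def)
    define words where
      "words = rec_nat {\<one>\<^bsub>G\<^esub>} (\<lambda>_ B. \<Union>j\<in>{1..n}. \<Union>h\<in>Ss j. (\<otimes>\<^bsub>G\<^esub>) h ` B)"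
    have words: "words 0 = {\<one>\<^bsub>G\<^esub>}"
      "\<And>i. words (Suc i) = (\<Union>j\<in>{1..n}. \<Union>h\<in>Ss j. (\<otimes>\<^bsub>G\<^esub>) h ` words i)" by (simp_all add: words_def)
    have words_fin: "finite (words i) \<and> words i \<subseteq> carrier G" for i
    proof (induction i)
      case (Suc i)
      have "h \<otimes>\<^bsub>G\<^esub> g \<in> carrier G" if "j \<in> {1..n}" "h \<in> Ss j" "g \<in> words i" for j h g
        using that Suc Ss'(2)[OF that(1)] by (simp add: subset_iff)
      then show ?case using Suc Ss' unfolding words(2) by auto
    qed (simp add: words(1))
    define F0 where "F0 = insert \<one>\<^bsub>G\<^esub> (S \<union> T \<union> \<Lambda> \<union> (\<lambda>(c, g). c \<otimes>\<^bsub>G\<^esub> g) ` (\<Lambda> \<times> S) \<union>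
      (\<Union>j\<in>{1..n}. Ss j) \<union> (\<Union>i\<le>C. words i))"
    have F0: "finite F0" "F0 \<subseteq> carrier G"
    proof -
      show "finite F0" using S' T \<Lambda> Ss' words_fin by (auto simp: F0_def)
      have "c \<otimes>\<^bsub>G\<^esub> g \<in> carrier G" if "g \<in> S" "c \<in> \<Lambda>" for g c
        using that \<Lambda>(2) S'(2) by (simp add: subset_iff)
      moreover have "(\<Union>j\<in>{1..n}. Ss j) \<subseteq> carrier G" using Ss'(2) by (rule UN_least)
      moreover have "(\<Union>i\<le>C. words i) \<subseteq> carrier G" using words_fin by (intro UN_least) simp
      ultimately show "F0 \<subseteq> carrier G"
        unfolding F0_def using S'(2) T(3) \<Lambda>(2) by (intro insert_subsetI Un_least image_subsetI) auto
    qed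
    define F where "F = F0 \<union> m_inv G ` F0"
    have F: "finite F" "F \<subseteq> carrier G" "\<one>\<^bsub>G\<^esub> \<in> F" "F0 \<subseteq> F"
      using F0 by (auto simp: F_def F0_def)
    have F_inv: "inv\<^bsub>G\<^esub> g \<in> F" if "g \<in> F" for g using that F0 by (auto simp: F_def)
    define \<A> where "\<A> = insert X1 ((\<Union>g\<in>F. (\<lambda>h. {x \<in> X0. \<kappa> g x = h}) ` \<kappa> g ` X0) \<union>
      (\<lambda>B. \<Phi> -` B \<inter> space M) ` \<B>)"
    have fin_\<A>: "finite \<A>" using F(1,2) fin_\<kappa> \<B>(1) by (auto simp: \<A>_def)
    have \<A>_sets: "\<A> \<subseteq> sets M"
    proof -
      have "{x \<in> X0. \<kappa> g x = \<kappa> g x'} \<in> sets M" if "g \<in> F" "x' \<in> X0" for g x'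
        using that F(2) by (intro \<kappa>_level_sets \<kappa>_closed) auto
      moreover have "\<Phi> -` B \<inter> space M \<in> sets M" if "B \<in> \<B>" for B
        using that \<B>(2) by (intro \<Phi>_vimage) auto
      ultimately show ?thesis using X1(1) by (auto simp: \<A>_def)
    qed
    define c where "c = 1 + 2 * incoherence_bound F \<A> + transport_bound F \<A> + (3 * core_bound F \<A> + 2)"
    have c: "0 < c" "2 * incoherence_bound F \<A> \<le> c" "transport_bound F \<A> \<le> c" "3 * core_bound F \<A> + 2 \<le> c"
      using bounds_nonneg[of F \<A>] by (auto simp: c_def)
    define \<zeta> where "\<zeta> = min \<theta> (min (\<eta> / c) (\<eta>' / c))"
    have \<zeta>: "0 < \<zeta>" "\<zeta> \<le> \<theta>" "c * \<zeta> \<le> \<eta>" "c * \<zeta> \<le> \<eta>'"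
    proof -
      show "0 < \<zeta>" "\<zeta> \<le> \<theta>" using K0 \<eta> \<eta>' c by (auto simp: \<zeta>_def)
      have "\<zeta> \<le> \<eta> / c" "\<zeta> \<le> \<eta>' / c" by (simp_all add: \<zeta>_def)
      then show "c * \<zeta> \<le> \<eta>" "c * \<zeta> \<le> \<eta>'" using c(1) by (simp_all add: pos_le_divide_eq mult.commute)
    qed
    have small: "a * \<zeta> \<le> \<eta>" "a * \<zeta> \<le> \<eta>'" if "a \<le> c" for a
    proof -
      have "a * \<zeta> \<le> c * \<zeta>" using that \<zeta>(1) by (intro mult_right_mono) auto
      then show "a * \<zeta> \<le> \<eta>" "a * \<zeta> \<le> \<eta>'" using \<zeta>(3,4) by auto
    qed
    have FK: "finite (F \<union> K0)" "F \<union> K0 \<subseteq> carrier G" using F K0 by auto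
    show "\<exists>\<A> F \<zeta>. finite \<A> \<and> \<A> \<subseteq> sets M \<and> finite F \<and> F \<subseteq> carrier G \<and> 0 < \<zeta> \<and>
        (\<forall>(V, \<pi>)\<in>\<S>. good_approximation G F \<zeta> (V, \<pi>) \<longrightarrow> (\<exists>p. approx_model M \<alpha> \<A> F \<zeta> V \<pi> p) \<longrightarrow>
          (\<exists>\<sigma>. (\<forall>t\<in>carrier H. \<sigma> t permutes V) \<and> good_approximation H K \<eta> (V, \<sigma>) \<and>
             real (card (model_labels P M \<alpha> \<A> F \<zeta> V \<pi>)) \<le> exp (\<epsilon> * real (card V)) *
               real (card (model_labels P' N \<beta> \<B> K \<eta> V \<sigma>))))"
    proof (intro exI[of _ \<A>] exI[of _ "F \<union> K0"] exI[of _ \<zeta>] conjI fin_\<A> \<A>_sets FK \<zeta>(1), clarify)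
      fix V :: "'v set" and \<pi> p1
      assume V\<pi>: "(V, \<pi>) \<in> \<S>" and good: "good_approximation G (F \<union> K0) \<zeta> (V, \<pi>)"
        and p1: "approx_model M \<alpha> \<A> (F \<union> K0) \<zeta> V \<pi> p1"
      have V: "finite V" "V \<noteq> {}" and perm: "\<And>g. g \<in> carrier G \<Longrightarrow> \<pi> g permutes V"
        using bspec[OF \<S> V\<pi>] by (auto simp: sofic_approximation_def)
      have sofic: "good_approximation G F \<zeta> (V, \<pi>)" "good_approximation G K0 \<theta> (V, \<pi>)"
        using good_approximation_mono[OF good] \<zeta>(2) by auto
      from bspec[OF SC_T V\<pi>, unfolded prod.case, THEN mp, OF sofic(2)]
      obtain W Vs where W: "W \<subseteq> V" "\<forall>j\<in>{1..n}. Vs j \<subseteq> V"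
        "(\<Sum>j=1..n. edge_cost \<epsilon> (Ss j) * measure (uniform_count_measure V) (Vs j)) \<le> 1"
        "(\<Union>g\<in>S. \<pi> g ` W) = V"
        and paths: "\<forall>w1\<in>W. \<forall>w2\<in>W. (\<exists>g\<in>T. \<pi> g w1 = w2) \<longrightarrow>
          (\<exists>l p. 1 \<le> l \<and> l \<le> C \<and> p 0 = w1 \<and> p l = w2 \<and> (\<forall>i\<in>{1..l}. SC_edge \<pi> n Ss Vs (p (i - 1)) (p i)))"
        by (elim exE conjE) (rule that)
      interpret O: oe_models G M \<alpha> H N \<beta> X0 Y0 \<Psi> \<kappa> lam X1 \<A> \<B> F S T \<Lambda> L R K V \<pi> \<zeta> W C n Ss Vs words
      proof (intro oe_models.intro oe_models_axioms.intro bounded_oe_axioms)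
        show "X1 \<in> \<A>" by (simp add: \<A>_def)
        show "{x \<in> X0. \<kappa> g x = h} \<in> \<A>" if "g \<in> F" "h \<in> \<kappa> g ` X0" for g h
          using that by (auto simp: \<A>_def)
        show "\<Phi> -` B \<inter> space M \<in> \<A>" if "B \<in> \<B>" for B using that by (auto simp: \<A>_def)
        show "S \<subseteq> F" "T \<subseteq> F" "\<Lambda> \<subseteq> F" using F(4) by (auto simp: F0_def)
        show "L \<subseteq> R" "K \<subseteq> R" by (auto simp: R_def)
        show "s \<otimes>\<^bsub>H\<^esub> t \<in> R" if "s \<in> K" "t \<in> K" for s t using that by (auto simp: R_def)
        show "\<kappa>' g x \<in> L" if "g \<in> S" for g x using that by (auto simp: L_def)
        show "lam t y \<in> \<Lambda>" if "t \<in> R" "y \<in> Y0" for t y using that by (auto simp: \<Lambda>_def)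
        show "inv\<^bsub>G\<^esub> a' \<otimes>\<^bsub>G\<^esub> a \<in> T" if "a \<in> \<Lambda>" "a' \<in> \<Lambda>" for a a'
          using that by (auto simp: T_def T0_def)
        show "inv\<^bsub>G\<^esub> g' \<otimes>\<^bsub>G\<^esub> (c \<otimes>\<^bsub>G\<^esub> g) \<in> T" if "g \<in> S" "g' \<in> S" "c \<in> \<Lambda>" for g g' c
        proof -
          have "(g, g', c) \<in> S \<times> S \<times> \<Lambda>" using that by simp
          then show ?thesis unfolding T_def T0_def by force
        qed
        show "c \<otimes>\<^bsub>G\<^esub> g \<in> F" if "g \<in> S" "c \<in> \<Lambda>" for g c
          using that F(4) by (auto simp: F0_def)
        show "words i \<subseteq> F" if "i \<le> C" for i using that F(4) by (auto simp: F0_def)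
        show "Ss j \<subseteq> F" if "j \<in> {1..n}" for j
        proof -
          have "Ss j \<subseteq> F0" using that unfolding F0_def by blast
          then show ?thesis using F(4) by simp
        qed
        show "\<exists>l p. 1 \<le> l \<and> l \<le> C \<and> p 0 = w1 \<and> p l = w2 \<and> (\<forall>i\<in>{1..l}. SC_edge \<pi> n Ss Vs (p (i - 1)) (p i))"
          if "w1 \<in> W" "w2 \<in> W" "g \<in> T" "\<pi> g w1 = w2" for w1 w2 g
          using bspec[OF bspec[OF paths that(1)] that(2)] that(3,4) by blast
      qed (fact X1(2,3) fin_\<A> \<B>(2) F(1-3) F_inv S'(3) R(2) words V perm sofic(1) \<zeta>(1) W(1,4))+
      show "\<exists>\<sigma>. (\<forall>t\<in>carrier H. \<sigma> t permutes V) \<and> good_approximation H K \<eta> (V, \<sigma>) \<and>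
             real (card (model_labels P M \<alpha> \<A> (F \<union> K0) \<zeta> V \<pi>)) \<le> exp (\<epsilon> * real (card V)) *
               real (card (model_labels P' N \<beta> \<B> K \<eta> V \<sigma>))"
      proof -
        have "O.model p1" unfolding O.model_def using p1 by (rule approx_model_mono) auto
        then have "\<exists>p. O.model p" by blast
        then obtain p0 where p0: "O.model p0"
          "real (card (labelling V P ` Collect O.model)) \<le> exp (\<epsilon> * real (card V)) *
             real (card (model_labels P' N \<beta> \<B> K \<eta> V (O.\<sigma> p0)))"
          using O.labellings_le[OF P P' bspec[OF bspec[OF sep]] \<epsilon> \<eta>'(2)[rule_format, OF V(1)] small(2)[OF c(4)] small(1)[OF c(3)] bspec[OF W(2)] W(3)]
          by blast
        have sub: "model_labels P M \<alpha> \<A> (F \<union> K0) \<zeta> V \<pi> \<subseteq> labelling V P ` Collect O.model"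
          unfolding O.model_def using approx_model_mono[of M \<alpha> \<A> "F \<union> K0" \<zeta> V \<pi> _ \<A> F \<zeta>] by auto
        have "card (model_labels P M \<alpha> \<A> (F \<union> K0) \<zeta> V \<pi>) \<le> card (labelling V P ` Collect O.model)"
          using finite_labellings[OF V(1) P_fin] sub by (rule card_mono)
        then have "real (card (model_labels P M \<alpha> \<A> (F \<union> K0) \<zeta> V \<pi>))
            \<le> real (card (labelling V P ` Collect O.model))" by simp
        with p0(2) have le: "real (card (model_labels P M \<alpha> \<A> (F \<union> K0) \<zeta> V \<pi>))
            \<le> exp (\<epsilon> * real (card V)) *
             real (card (model_labels P' N \<beta> \<B> K \<eta> V (O.\<sigma> p0)))" by simp
        have "good_approximation H K \<eta> (V, O.\<sigma> p0)"
          using O.\<sigma>_sofic[OF p0(1) small(1)[OF c(2)]] .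
        then show ?thesis using le O.\<sigma>_perm by blast
      qed
    qed
  qed
qed

end

section \<open>Entropy\<close>

lemma card_bij_Collect:
  assumes "bij_betw d V' V" shows "card {i \<in> V'. Q (d i)} = card {v \<in> V. Q v}"
proof -
  have "bij_betw d {i \<in> V'. Q (d i)} {v \<in> V. Q v}"
    using assms by (auto simp: bij_betw_def inj_on_def image_iff)
  then show ?thesis by (rule bij_betw_same_card)
qed

lemma relabel:
  fixes V :: "'v set"
  assumes V: "finite V" "V \<noteq> {}" and G: "group G" and \<sigma>: "\<And>g. g \<in> carrier G \<Longrightarrow> \<sigma> g permutes V"
    and F: "F \<subseteq> carrier G" and good: "good_approximation G F \<eta> (V, \<sigma>)" and P: "finite P"
  obtains V' :: "nat set" and \<sigma>' where "finite V'" "V' \<noteq> {}" "card V' = card V"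
    "\<And>g. g \<in> carrier G \<Longrightarrow> \<sigma>' g permutes V'" "good_approximation G F \<eta> (V', \<sigma>')"
    "card (model_labels P M \<alpha> \<A> F \<eta> V \<sigma>)
       \<le> card (model_labels P M \<alpha> \<A> F \<eta> V' \<sigma>')"
proof -
  interpret group G by fact
  define V' where "V' = {0..<card V}"
  obtain d where d: "bij_betw d V' V" using ex_bij_betw_nat_finite[OF V(1)] by (auto simp: V'_def)
  define e where "e = inv_into V' d"
  have e: "bij_betw e V V'" unfolding e_def using d by (rule bij_betw_inv_into)
  have de: "d (e v) = v" if "v \<in> V" for v using d that by (simp add: e_def bij_betw_inv_into_right)
  have ed: "e (d i) = i" if "i \<in> V'" for i using d that by (simp add: e_def bij_betw_inv_into_left)
  have dV: "d i \<in> V" if "i \<in> V'" for i using d that by (auto simp: bij_betw_def)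
  have eV: "e v \<in> V'" if "v \<in> V" for v using e that by (auto simp: bij_betw_def)
  define \<sigma>' where "\<sigma>' g i = (if i \<in> V' then e (\<sigma> g (d i)) else i)" for g i
  have \<sigma>V: "\<sigma> g v \<in> V" if "g \<in> carrier G" "v \<in> V" for g v using permutes_in_image[OF \<sigma>] that by simp
  have d\<sigma>: "d (\<sigma>' g i) = \<sigma> g (d i)" if "g \<in> carrier G" "i \<in> V'" for g i
    using that dV \<sigma>V de by (simp add: \<sigma>'_def)
  have \<sigma>'V: "\<sigma>' g i \<in> V'" if "g \<in> carrier G" "i \<in> V'" for g i
    using that dV \<sigma>V eV by (simp add: \<sigma>'_def)
  have d_inj: "d i = d j \<longleftrightarrow> i = j" if "i \<in> V'" "j \<in> V'" for i j
    using that ed by metis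
  have cV: "card V' = card V" by (simp add: V'_def)
  have perm: "\<sigma>' g permutes V'" if g: "g \<in> carrier G" for g
  proof (rule bij_imp_permutes)
    have "bij_betw (e \<circ> (\<sigma> g \<circ> d)) V' V'"
      using d e permutes_imp_bij[OF \<sigma>[OF g]] by (intro bij_betw_trans)
    then show "bij_betw (\<sigma>' g) V' V'" by (rule bij_betw_cong[THEN iffD1, rotated]) (simp add: \<sigma>'_def)
    show "\<sigma>' g i = i" if "i \<notin> V'" for i using that by (simp add: \<sigma>'_def)
  qed
  have ham1: "hamming V' (\<sigma>' (s \<otimes>\<^bsub>G\<^esub> t)) (\<sigma>' s \<circ> \<sigma>' t) = hamming V (\<sigma> (s \<otimes>\<^bsub>G\<^esub> t)) (\<sigma> s \<circ> \<sigma> t)"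
    if st: "s \<in> carrier G" "t \<in> carrier G" for s t
  proof -
    have "{i \<in> V'. \<sigma>' (s \<otimes>\<^bsub>G\<^esub> t) i \<noteq> (\<sigma>' s \<circ> \<sigma>' t) i}
        = {i \<in> V'. \<sigma> (s \<otimes>\<^bsub>G\<^esub> t) (d i) \<noteq> (\<sigma> s \<circ> \<sigma> t) (d i)}"
      using st by (intro Collect_cong conj_cong refl) (simp add: \<sigma>'V d\<sigma> flip: d_inj)
    then show ?thesis
      using card_bij_Collect[OF d, of "\<lambda>v. \<sigma> (s \<otimes>\<^bsub>G\<^esub> t) v \<noteq> (\<sigma> s \<circ> \<sigma> t) v"] cV
      by (simp add: hamming_def)
  qed
  have ham2: "hamming V' (\<sigma>' s) (\<sigma>' t) = hamming V (\<sigma> s) (\<sigma> t)"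
    if st: "s \<in> carrier G" "t \<in> carrier G" for s t
  proof -
    have "{i \<in> V'. \<sigma>' s i \<noteq> \<sigma>' t i} = {i \<in> V'. \<sigma> s (d i) \<noteq> \<sigma> t (d i)}"
      using st by (intro Collect_cong conj_cong refl) (simp add: \<sigma>'V d\<sigma> flip: d_inj)
    then show ?thesis
      using card_bij_Collect[OF d, of "\<lambda>v. \<sigma> s v \<noteq> \<sigma> t v"] cV by (simp add: hamming_def)
  qed
  have am: "approx_model M \<alpha> \<A> F \<eta> V' \<sigma>' (p \<circ> d)" if p: "approx_model M \<alpha> \<A> F \<eta> V \<sigma> p" for p
    unfolding approx_model_def
  proof (intro conjI ballI)
    show "p \<circ> d \<in> V' \<rightarrow> space M" using p dV by (auto simp: approx_model_def)
    fix A assume A: "A \<in> \<A>"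
    show "\<bar>real (card {i \<in> V'. (p \<circ> d) i \<in> A}) / real (card V') - measure M A\<bar> \<le> \<eta>"
      using p A card_bij_Collect[OF d, of "\<lambda>v. p v \<in> A"] cV by (simp add: approx_model_def)
    fix g assume g: "g \<in> F"
    then have gG: "g \<in> carrier G" using F by auto
    have "{i \<in> V'. ((p \<circ> d) (\<sigma>' g i) \<in> A) \<noteq> (\<alpha> g ((p \<circ> d) i) \<in> A)}
        = {i \<in> V'. (p (\<sigma> g (d i)) \<in> A) \<noteq> (\<alpha> g (p (d i)) \<in> A)}"
      using gG by (intro Collect_cong conj_cong refl) (simp add: d\<sigma>)
    also have "card \<dots> = card {v \<in> V. (p (\<sigma> g v) \<in> A) \<noteq> (\<alpha> g (p v) \<in> A)}"
      by (rule card_bij_Collect[OF d, of "\<lambda>v. (p (\<sigma> g v) \<in> A) \<noteq> (\<alpha> g (p v) \<in> A)"])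
    finally show "real (card {i \<in> V'. ((p \<circ> d) (\<sigma>' g i) \<in> A) \<noteq> (\<alpha> g ((p \<circ> d) i) \<in> A)}) \<le> \<eta> * real (card V')"
      using p A g cV by (simp add: approx_model_def)
  qed
  let ?h = "\<lambda>L. restrict (\<lambda>A. d ` (L A)) P"
  have "labelling V P p = ?h (labelling V' P (p \<circ> d))" for p
    unfolding labelling_def
  proof (rule restrict_ext)
    fix A assume A: "A \<in> P"
    have "d ` {i \<in> V'. p (d i) \<in> A} = {v \<in> V. p v \<in> A}"
      using d by (auto simp: bij_betw_def)
    then show "{v \<in> V. p v \<in> A} = d ` (restrict (\<lambda>A. {i \<in> V'. (p \<circ> d) i \<in> A}) P) A"
      using A by simp
  qed
  then have "model_labels P M \<alpha> \<A> F \<eta> V \<sigma>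
      \<subseteq> ?h ` model_labels P M \<alpha> \<A> F \<eta> V' \<sigma>'"
    using am by auto
  moreover have fin: "finite (model_labels P M \<alpha> \<A> F \<eta> V' \<sigma>')"
    by (rule finite_labellings[OF _ P]) (simp add: V'_def)
  ultimately have "card (model_labels P M \<alpha> \<A> F \<eta> V \<sigma>)
      \<le> card (?h ` model_labels P M \<alpha> \<A> F \<eta> V' \<sigma>')"
    by (intro card_mono finite_imageI[of "labelling V' P ` _"])
  also have "\<dots> \<le> card (model_labels P M \<alpha> \<A> F \<eta> V' \<sigma>')"
    using fin by (rule card_image_le)
  finally have le: "card (model_labels P M \<alpha> \<A> F \<eta> V \<sigma>)
      \<le> card (model_labels P M \<alpha> \<A> F \<eta> V' \<sigma>')" .
  have "hamming V' (\<sigma>' (s \<otimes>\<^bsub>G\<^esub> t)) (\<sigma>' s \<circ> \<sigma>' t) \<le> \<eta> \<and> (s \<noteq> t \<longrightarrow> hamming V' (\<sigma>' s) (\<sigma>' t) \<ge> 1 - \<eta>)"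
    if "s \<in> F" "t \<in> F" for s t
  proof -
    have "s \<in> carrier G" "t \<in> carrier G" using that F by auto
    then show ?thesis using good that by (simp add: good_approximation_def ham1 ham2)
  qed
  then have good': "good_approximation G F \<eta> (V', \<sigma>')" by (auto simp: good_approximation_def)
  have "finite V'" "V' \<noteq> {}" using V by (auto simp: V'_def)
  then show thesis using cV perm good' le by (rule that)
qed

lemma less_normalized_logD:
  assumes "ereal c < normalized_log n d" "0 < d" shows "exp (c * real d) < real n"
proof -
  have n: "n \<noteq> 0" "c < ln (real n) / real d" using assms(1) by (auto simp: normalized_log_def split: if_splits)
  then have "c * real d < ln (real n)" using assms(2) by (simp add: less_divide_eq)
  then have "exp (c * real d) < exp (ln (real n))" by simp
  then show ?thesis using n by simp
qed

lemma le_normalized_logI: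
  assumes "exp (c * real d) \<le> real n" "0 < d" shows "ereal c \<le> normalized_log n d"
proof -
  have n: "0 < real n" using assms(1) exp_gt_zero[of "c * real d"] by linarith
  have "c * real d \<le> ln (real n)" using assms(1) n by (simp add: ln_ge_iff)
  then show ?thesis using n assms(2) by (simp add: normalized_log_def le_divide_eq)
qed

lemma finite_hom_restrictions:
  assumes "finite V" "finite P"
  shows "finite ((\<lambda>\<phi>. restrict \<phi> P) ` Hom_mu M \<alpha> C F \<delta> (V, \<sigma>))"
proof (rule finite_subset)
  show "finite (\<Pi>\<^sub>E A\<in>P. insert undefined (Pow V))" using assms by (intro finite_PiE) auto
  show "(\<lambda>\<phi>. restrict \<phi> P) ` Hom_mu M \<alpha> C F \<delta> (V, \<sigma>) \<subseteq> (\<Pi>\<^sub>E A\<in>P. insert undefined (Pow V))"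
  proof (rule image_subsetI)
    fix \<phi> assume "\<phi> \<in> Hom_mu M \<alpha> C F \<delta> (V, \<sigma>)"
    then have "\<phi> \<in> (algebra (space M) hull translate_join \<alpha> C F) \<rightarrow>\<^sub>E Pow V"
      by (simp add: Hom_mu_def boolean_homs_def)
    then have "\<phi> A \<in> insert undefined (Pow V)" for A
      by (cases "A \<in> algebra (space M) hull translate_join \<alpha> C F") (auto simp: PiE_def extensional_def Pi_def)
    then show "restrict \<phi> P \<in> (\<Pi>\<^sub>E A\<in>P. insert undefined (Pow V))" by auto
  qed
qed

abbreviation entropy_at ::
  "('g, 'r) monoid_scheme \<Rightarrow> 'x measure \<Rightarrow> ('g \<Rightarrow> 'x \<Rightarrow> 'x) \<Rightarrow> (nat \<Rightarrow> ('g, 'v) sofic_map) \<Rightarrow> 'x set set \<Rightarrow> ereal" where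
  "entropy_at G M \<alpha> \<Sigma> P \<equiv> (INF C\<in>{C. fin_borel_partition M C \<and> refines (space M) C P}.
     INF F\<in>{F. finite F \<and> F \<subseteq> carrier G \<and> \<one>\<^bsub>G\<^esub> \<in> F}. INF \<delta>\<in>{0<..}.
       limsup (\<lambda>k. normalized_log
         (card ((\<lambda>\<phi>. restrict \<phi> P) ` Hom_mu M \<alpha> C F \<delta> (\<Sigma> k))) (card (fst (\<Sigma> k)))))"

lemma (in pmp) entropy_gives_models:
  fixes \<Sigma> :: "nat \<Rightarrow> ('g, 'v) sofic_map"
  assumes \<Sigma>: "sofic_approximation_sequence G \<Sigma>" and P: "fin_borel_partition M P"
    and h: "ereal c < (entropy_at G M \<alpha> \<Sigma> P)"
    and \<A>: "finite \<A>" "\<A> \<subseteq> sets M" and F: "finite F" "F \<subseteq> carrier G" and \<zeta>: "0 < \<zeta>"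
  shows "\<exists>k. good_approximation G F \<zeta> (\<Sigma> k) \<and> exp (c * real (card (fst (\<Sigma> k)))) <
     real (card (model_labels P M \<alpha> \<A> F \<zeta> (fst (\<Sigma> k)) (snd (\<Sigma> k))))"
proof (rule labellings_of_homs[OF P \<A> F \<zeta>, where 'v = 'v], goal_cases)
  case (1 C F' \<delta>)
  let ?f = "\<lambda>k. normalized_log (card ((\<lambda>\<phi>. restrict \<phi> P) ` Hom_mu M \<alpha> C F' \<delta> (\<Sigma> k))) (card (fst (\<Sigma> k)))"
  note h
  also have "(entropy_at G M \<alpha> \<Sigma> P) \<le> limsup ?f"
    using 1(1-6) by (intro INF_lower2[of C] INF_lower2[of F'] INF_lower2[of \<delta>]) auto
  finally have lt: "ereal c < limsup ?f" .
  have "\<exists>k. good_approximation G F \<zeta> (\<Sigma> k) \<and> ereal c < ?f k"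
  proof (rule ccontr)
    assume "\<not> ?thesis"
    then have no: "\<And>k. good_approximation G F \<zeta> (\<Sigma> k) \<Longrightarrow> ?f k \<le> ereal c" by (auto simp: not_less)
    have "\<forall>\<^sub>F k in sequentially. good_approximation G F \<zeta> (\<Sigma> k)"
      using \<Sigma> F \<zeta> by (auto simp: sofic_approximation_sequence_def)
    then have "\<forall>\<^sub>F k in sequentially. ?f k \<le> ereal c" by eventually_elim (rule no)
    then have "limsup ?f \<le> ereal c" by (rule Limsup_bounded)
    then show False using lt by simp
  qed
  then obtain k where k: "good_approximation G F \<zeta> (\<Sigma> k)" "ereal c < ?f k" by blast
  obtain V \<pi> where V\<pi>: "\<Sigma> k = (V, \<pi>)" by (cases "\<Sigma> k")
  have "sofic_approximation G (V, \<pi>)"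
    using \<Sigma> V\<pi> unfolding sofic_approximation_sequence_def by metis
  then have V: "finite V" "V \<noteq> {}" "\<And>g. g \<in> carrier G \<Longrightarrow> \<pi> g permutes V"
    by (auto simp: sofic_approximation_def)
  have "exp (c * real (card V)) < real (card ((\<lambda>\<phi>. restrict \<phi> P) ` Hom_mu M \<alpha> C F' \<delta> (V, \<pi>)))"
    using k(2) V by (intro less_normalized_logD) (auto simp: V\<pi> card_gt_0_iff)
  also have "\<dots> \<le> real (card (model_labels P M \<alpha> \<A> F \<zeta> V \<pi>))"
    using 1(7)[OF V] P finite_labellings[OF V(1)] by (intro of_nat_mono card_mono) (auto simp: fin_borel_partition_def)
  finally show ?case using k(1) by (intro exI[of _ k]) (simp add: V\<pi>)
qed

lemma (in pmp) models_give_entropy: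
  fixes \<Sigma> :: "nat \<Rightarrow> ('g, 'v) sofic_map"
  assumes P: "fin_borel_partition M P" and \<Sigma>: "\<And>k. sofic_approximation G (\<Sigma> k)"
    and ev: "\<And>\<A> F \<eta>. finite \<A> \<Longrightarrow> \<A> \<subseteq> sets M \<Longrightarrow> finite F \<Longrightarrow> F \<subseteq> carrier G \<Longrightarrow> 0 < \<eta> \<Longrightarrow>
      \<forall>\<^sub>F k in sequentially. exp (c * real (card (fst (\<Sigma> k)))) \<le>
        real (card (model_labels P M \<alpha> \<A> F \<eta> (fst (\<Sigma> k)) (snd (\<Sigma> k))))"
  shows "ereal c \<le> sofic_entropy G M \<alpha> \<Sigma>"
  unfolding sofic_entropy_def
proof (rule SUP_upper2[of P])
  show "P \<in> {P. fin_borel_partition M P}" using P by simp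
  show "ereal c \<le> (entropy_at G M \<alpha> \<Sigma> P)"
  proof (intro INF_greatest)
    fix C F and \<delta> :: real
    assume "C \<in> {C. fin_borel_partition M C \<and> refines (space M) C P}"
      "F \<in> {F. finite F \<and> F \<subseteq> carrier G \<and> \<one>\<^bsub>G\<^esub> \<in> F}" "\<delta> \<in> {0<..}"
    then have C: "fin_borel_partition M C" "refines (space M) C P" and F: "finite F" "F \<subseteq> carrier G" "\<one>\<^bsub>G\<^esub> \<in> F"
      and \<delta>: "0 < \<delta>" by auto
    show "ereal c \<le> limsup (\<lambda>k. normalized_log
          (card ((\<lambda>\<phi>. restrict \<phi> P) ` Hom_mu M \<alpha> C F \<delta> (\<Sigma> k))) (card (fst (\<Sigma> k))))"
    proof (rule homs_of_labellings[OF C F \<delta>, where 'v = 'v], goal_cases)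
      case (1 \<A> \<eta>)
      have ev': "\<forall>\<^sub>F k in sequentially. exp (c * real (card (fst (\<Sigma> k)))) \<le>
        real (card (model_labels P M \<alpha> \<A> F \<eta> (fst (\<Sigma> k)) (snd (\<Sigma> k))))"
        using 1(1,2) F(1,2) 1(3) by (rule ev)
      show ?case
      proof (rule le_Limsup[OF sequentially_bot], use ev' in eventually_elim)
        fix k
        assume le: "exp (c * real (card (fst (\<Sigma> k)))) \<le>
          real (card (model_labels P M \<alpha> \<A> F \<eta> (fst (\<Sigma> k)) (snd (\<Sigma> k))))"
        obtain V \<pi> where V\<pi>: "\<Sigma> k = (V, \<pi>)" by (cases "\<Sigma> k")
        have "sofic_approximation G (V, \<pi>)" using \<Sigma>[of k] V\<pi> by simp
        then have V: "finite V" "V \<noteq> {}" "\<And>g. g \<in> carrier G \<Longrightarrow> \<pi> g permutes V"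
          by (auto simp: sofic_approximation_def)
        have Pf: "finite P" using P by (simp add: fin_borel_partition_def)
        have "card (model_labels P M \<alpha> \<A> F \<eta> V \<pi>)
            \<le> card ((\<lambda>\<phi>. restrict \<phi> P) ` Hom_mu M \<alpha> C F \<delta> (V, \<pi>))"
          using finite_hom_restrictions[OF V(1) Pf] 1(4)[OF V] by (rule card_mono)
        then have "exp (c * real (card V)) \<le> real (card ((\<lambda>\<phi>. restrict \<phi> P) ` Hom_mu M \<alpha> C F \<delta> (V, \<pi>)))"
          using le by (simp add: V\<pi>)
        then show "ereal c \<le> normalized_log
          (card ((\<lambda>\<phi>. restrict \<phi> P) ` Hom_mu M \<alpha> C F \<delta> (\<Sigma> k))) (card (fst (\<Sigma> k)))"
          using V by (intro le_normalized_logI) (auto simp: V\<pi> card_gt_0_iff)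
      qed
    qed
  qed
qed

lemma (in bounded_oe) entropy_le:
  fixes \<S> :: "('g, 'v) sofic_map set"
  assumes cH: "countable (carrier H)" and SC: "property_SC G \<S>"
    and \<S>: "\<forall>\<pi>\<in>\<S>. sofic_approximation G \<pi>"
    and \<Sigma>: "sofic_approximation_sequence G \<Sigma>" "\<forall>k. \<Sigma> k \<in> \<S>"
  shows "sofic_entropy G M \<alpha> \<Sigma> \<le> max_sofic_entropy H N \<beta>"
  unfolding sofic_entropy_def
proof (rule SUP_least, rule ccontr)
  fix P assume "P \<in> {P. fin_borel_partition M P}"
  then have P: "fin_borel_partition M P" by simp
  let ?h = "entropy_at G M \<alpha> \<Sigma> P"
  assume "\<not> ?h \<le> max_sofic_entropy H N \<beta>"
  then have "max_sofic_entropy H N \<beta> < ?h" by (simp add: not_le)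
  then obtain c where c: "max_sofic_entropy H N \<beta> < ereal c" "ereal c < ?h" using ereal_dense2 by blast
  obtain c' where c': "ereal c < ereal c'" "ereal c' < ?h" using ereal_dense2[OF c(2)] by blast
  then have \<epsilon>: "0 < c' - c" by simp
  show False
  proof (rule models_transfer[OF SC \<S> P \<epsilon>], goal_cases)
    case (1 P')
    note transfer = 1(2)
    have P'_fin: "finite P'" using 1(1) by (simp add: fin_borel_partition_def)
    show ?case
    proof (rule B.countable_family_suffices[OF cH 1(1), where 'v = nat], goal_cases)
      case (1 \<B> F)
      have "\<exists>V\<sigma> :: ('h, nat) sofic_map. sofic_approximation H V\<sigma> \<and>
          good_approximation H (F m) (1 / real (Suc m)) V\<sigma> \<and> exp (c * real (card (fst V\<sigma>))) \<le>
            real (card (model_labels P' N \<beta> (\<B> m) (F m) (1 / real (Suc m)) (fst V\<sigma>) (snd V\<sigma>)))" for m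
      proof -
        have pos: "0 < 1 / real (Suc m)" by simp
        obtain \<A> E \<zeta> where t: "finite \<A>" "\<A> \<subseteq> sets M" "finite E" "E \<subseteq> carrier G" "0 < \<zeta>"
          and tr: "\<forall>(V, \<pi>)\<in>\<S>. good_approximation G E \<zeta> (V, \<pi>) \<longrightarrow> (\<exists>p. approx_model M \<alpha> \<A> E \<zeta> V \<pi> p) \<longrightarrow>
          (\<exists>\<sigma>. (\<forall>t\<in>carrier H. \<sigma> t permutes V) \<and> good_approximation H (F m) (1 / real (Suc m)) (V, \<sigma>) \<and>
             real (card (model_labels P M \<alpha> \<A> E \<zeta> V \<pi>)) \<le> exp ((c' - c) * real (card V)) *
               real (card (model_labels P' N \<beta> (\<B> m) (F m) (1 / real (Suc m)) V \<sigma>)))"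
          using transfer[OF 1(1)[of m] 1(2)[of m] 1(3)[of m] 1(4)[of m] pos] by (elim exE conjE) (rule that)
        obtain i where i: "good_approximation G E \<zeta> (\<Sigma> i)" "exp (c' * real (card (fst (\<Sigma> i)))) <
            real (card (model_labels P M \<alpha> \<A> E \<zeta> (fst (\<Sigma> i)) (snd (\<Sigma> i))))"
          using A.entropy_gives_models[OF \<Sigma>(1) P c'(2) t] by blast
        obtain V \<pi> where V\<pi>: "\<Sigma> i = (V, \<pi>)" by (cases "\<Sigma> i")
        have V\<pi>\<S>: "(V, \<pi>) \<in> \<S>" using \<Sigma>(2) V\<pi> by metis
        then have V: "finite V" "V \<noteq> {}" using bspec[OF \<S> V\<pi>\<S>] by (auto simp: sofic_approximation_def)
        let ?n = "real (card V)"
        have big: "exp (c' * ?n) < real (card (model_labels P M \<alpha> \<A> E \<zeta> V \<pi>))"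
          using i(2) by (simp add: V\<pi>)
        have "{p. approx_model M \<alpha> \<A> E \<zeta> V \<pi> p} \<noteq> {}"
        proof
          assume "{p. approx_model M \<alpha> \<A> E \<zeta> V \<pi> p} = {}"
          then have "exp (c' * ?n) < 0" using big by (simp only: image_empty card.empty of_nat_0)
          then show False using exp_gt_zero[of "c' * ?n"] by linarith
        qed
        then have ex: "\<exists>p. approx_model M \<alpha> \<A> E \<zeta> V \<pi> p" by blast
        have good: "good_approximation G E \<zeta> (V, \<pi>)" using i(1) V\<pi> by simp
        from bspec[OF tr V\<pi>\<S>, unfolded prod.case, THEN mp, OF good, THEN mp, OF ex]
        obtain \<sigma> where \<sigma>: "\<forall>t\<in>carrier H. \<sigma> t permutes V" "good_approximation H (F m) (1 / real (Suc m)) (V, \<sigma>)"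
          and le: "real (card (model_labels P M \<alpha> \<A> E \<zeta> V \<pi>)) \<le> exp ((c' - c) * ?n) *
               real (card (model_labels P' N \<beta> (\<B> m) (F m) (1 / real (Suc m)) V \<sigma>))"
          by (elim exE conjE) (rule that)
        have "exp ((c' - c) * ?n) * exp (c * ?n) = exp (c' * ?n)"
          by (simp add: algebra_simps flip: exp_add)
        also have "\<dots> \<le> exp ((c' - c) * ?n) *
            real (card (model_labels P' N \<beta> (\<B> m) (F m) (1 / real (Suc m)) V \<sigma>))"
          using big le by linarith
        finally have le': "exp (c * ?n) \<le>
            real (card (model_labels P' N \<beta> (\<B> m) (F m) (1 / real (Suc m)) V \<sigma>))"
          by (simp add: mult_le_cancel_left_pos)
        show ?thesis
        proof (rule relabel[OF V B.group_G bspec[OF \<sigma>(1)] 1(4)[of m] \<sigma>(2) P'_fin,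
              where M = N and \<alpha> = \<beta> and \<A> = "\<B> m"], assumption, goal_cases)
          case (1 V' \<sigma>')
          have "exp (c * real (card V')) \<le>
            real (card (model_labels P' N \<beta> (\<B> m) (F m) (1 / real (Suc m)) V' \<sigma>'))"
            using le' of_nat_mono[OF 1(6), where 'a = real] 1(3) by simp
          moreover have "sofic_approximation H (V', \<sigma>')"
            using 1(1,2,4) by (simp add: sofic_approximation_def)
          ultimately show ?case using 1(5) by (intro exI[of _ "(V', \<sigma>')"]) simp
        qed
      qed
      then obtain \<Sigma>' :: "nat \<Rightarrow> ('h, nat) sofic_map" where \<Sigma>': "\<And>m. sofic_approximation H (\<Sigma>' m)"
        "\<And>m. good_approximation H (F m) (1 / real (Suc m)) (\<Sigma>' m)"
        "\<And>m. exp (c * real (card (fst (\<Sigma>' m)))) \<le> real (card (model_labels P' N \<beta> (\<B> m) (F m) (1 / real (Suc m)) (fst (\<Sigma>' m)) (snd (\<Sigma>' m))))"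
        by metis
      have seq: "sofic_approximation_sequence H \<Sigma>'"
        unfolding sofic_approximation_sequence_def
      proof (intro conjI allI impI)
        show "sofic_approximation H (\<Sigma>' k)" for k by (rule \<Sigma>'(1))
        fix K and \<delta> :: real assume K: "finite K \<and> K \<subseteq> carrier H \<and> 0 < \<delta>"
        obtain m0 where m0: "\<forall>m\<ge>m0. K \<subseteq> F m" using 1(5)[of K] K by blast
        obtain m1 where m1: "1 / real (Suc m1) < \<delta>" using K nat_approx_posE by metis
        have "good_approximation H K \<delta> (\<Sigma>' m)" if "m \<ge> max m0 m1" for m
        proof -
          have "1 / real (Suc m) \<le> 1 / real (Suc m1)" using that by (intro divide_left_mono) auto
          then have "1 / real (Suc m) \<le> \<delta>" using m1 by simp
          then show ?thesis
            using good_approximation_mono[of H "F m" "1 / real (Suc m)" "fst (\<Sigma>' m)" "snd (\<Sigma>' m)" K \<delta>]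
              \<Sigma>'(2)[of m] m0 that by simp
        qed
        then show "\<forall>\<^sub>F m in sequentially. good_approximation H K \<delta> (\<Sigma>' m)"
          unfolding eventually_sequentially by blast
      qed
      have "ereal c \<le> sofic_entropy H N \<beta> \<Sigma>'"
      proof (rule B.models_give_entropy[OF \<open>fin_borel_partition N P'\<close> \<Sigma>'(1)])
        fix \<A> K and \<eta> :: real
        assume "finite \<A>" "\<A> \<subseteq> sets N" "finite K" "K \<subseteq> carrier H" "0 < \<eta>"
        from 1(6)[OF this] obtain m0 where m0: "\<forall>m\<ge>m0. \<forall>(V :: nat set) \<sigma>. finite V \<longrightarrow> V \<noteq> {} \<longrightarrow>
           (\<forall>g\<in>carrier H. \<sigma> g permutes V) \<longrightarrow>
           model_labels P' N \<beta> (\<B> m) (F m) (1 / real (Suc m)) V \<sigma>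
             \<subseteq> model_labels P' N \<beta> \<A> K \<eta> V \<sigma>" by (rule exE)
        have "exp (c * real (card (fst (\<Sigma>' m)))) \<le> real (card (model_labels P' N \<beta> \<A> K \<eta> (fst (\<Sigma>' m)) (snd (\<Sigma>' m))))" if m: "m \<ge> m0" for m
        proof -
          have V: "finite (fst (\<Sigma>' m))" "fst (\<Sigma>' m) \<noteq> {}" "\<forall>g\<in>carrier H. snd (\<Sigma>' m) g permutes fst (\<Sigma>' m)"
            using \<Sigma>'(1)[of m] by (auto simp: sofic_approximation_def split: prod.splits)
          note \<Sigma>'(3)[of m]
          also have "real (card (model_labels P' N \<beta> (\<B> m) (F m) (1 / real (Suc m)) (fst (\<Sigma>' m)) (snd (\<Sigma>' m))))
            \<le> real (card (model_labels P' N \<beta> \<A> K \<eta> (fst (\<Sigma>' m)) (snd (\<Sigma>' m))))"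
            using finite_labellings[OF V(1) P'_fin] m0[rule_format, OF m V(1,2) bspec[OF V(3)]] by (intro of_nat_mono card_mono)
          finally show ?thesis .
        qed
        then show "\<forall>\<^sub>F m in sequentially. exp (c * real (card (fst (\<Sigma>' m)))) \<le> real (card (model_labels P' N \<beta> \<A> K \<eta> (fst (\<Sigma>' m)) (snd (\<Sigma>' m))))"
          unfolding eventually_sequentially by blast
      qed
      also have "\<dots> \<le> max_sofic_entropy H N \<beta>"
        unfolding max_sofic_entropy_def using seq by (intro SUP_upper) simp
      finally show ?case using c(1) by simp
    qed
  qed
qed

theorem theorem5p2:
  fixes G :: "('g, 'r) monoid_scheme" and H :: "('h, 's) monoid_scheme"
    and M :: "'x measure" and N :: "'y measure"
    and \<alpha> :: "'g \<Rightarrow> 'x \<Rightarrow> 'x" and \<beta> :: "'h \<Rightarrow> 'y \<Rightarrow> 'y"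
    and \<S> :: "('g, 'v) sofic_map set" and \<Sigma> :: "nat \<Rightarrow> ('g, 'v) sofic_map"
  assumes "group G" and "countable (carrier G)"
    and "group H" and "countable (carrier H)"
    and "pmp_action G M \<alpha>" and "free_action G M \<alpha>"
    and "pmp_action H N \<beta>" and "free_action H N \<beta>"
    and "boundedly_orbit_equivalent G M \<alpha> H N \<beta>"
    and "\<forall>\<pi>\<in>\<S>. sofic_approximation G \<pi>"
    and "property_SC G \<S>"
    and "uniquely_ergodic H N \<beta>"
    and "sofic_approximation_sequence G \<Sigma>"
    and "\<forall>k. \<Sigma> k \<in> \<S>"
  shows "max_sofic_entropy H N \<beta> \<ge> sofic_entropy G M \<alpha> \<Sigma>"
proof -
  obtain X0 Y0 \<Psi> \<kappa> lam where *: "orbit_equivalence G M \<alpha> H N \<beta> X0 Y0 \<Psi>"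
    "orbit_cocycle G M \<alpha> H \<beta> X0 \<Psi> \<kappa>" "orbit_cocycle H N \<beta> G \<alpha> Y0 (inv_into X0 \<Psi>) lam"
    "\<forall>g\<in>carrier G. finite (\<kappa> g ` X0)" "\<forall>t\<in>carrier H. finite (lam t ` Y0)"
    using assms(9) unfolding boundedly_orbit_equivalent_def by blast
  interpret bounded_oe G M \<alpha> H N \<beta> X0 Y0 \<Psi> \<kappa> lam
    using assms(1,3,5-8) * by (intro bounded_oe.intro pmp.intro bounded_oe_axioms.intro) auto
  show ?thesis using assms(4,11,10,13,14) by (rule entropy_le)
qed

end
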